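(* Let $(G,g)$ be a connected, simply connected three-dimensional Lie group with a left-invariant Lorentzian metric of Type II, i.e. its Lie algebra $\mathfrak{g}$ admits an orthonormal basis $\{e_1,e_2,e_3\}$ of signature $(++-)$ with $$[e_1,e_2]=\tfrac12 e_2-(\beta-\tfrac12)e_3,\quad [e_1,e_3]=-(\beta+\tfrac12)e_2-\tfrac12 e_3,\quad [e_2,e_3]=\alpha e_1$$ for some $\alpha,\beta\in\mathbb{R}$. Then $(G,g)$ admits a non-trivial left-invariant Cotton soliton if and only if one of the following conditions holds: (i) $\alpha=\beta\neq 0$, and then $\mathfrak{g}$ is isomorphic to $\mathfrak{so}(1,2)\cong\mathfrak{sl}(2,\mathbb{R})$; (ii) $\alpha=0\neq\beta$, and then $G=E(1,1)$. Moreover, in these cases the left-invariant Cotton solitons are always steady ($\lambda=0$) and are respectively given by: (i) $X=\frac34\beta^2e_1+\kappa(e_2+e_3)$, where $\kappa\in\mathbb{R}$; (ii) $X=2\beta^2e_1$.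
   Context: Let $\nabla$ be the Levi-Civita connection of a three-dimensional pseudo-Riemannian manifold, $R(X,Y)=\nabla_{[X,Y]}-[\nabla_X,\nabla_Y]$, Ricci tensor $\rho(X,Y)=\operatorname{trace}\{Z\mapsto R(X,Z)Y\}$, scalar curvature $\tau$, Schouten tensor $S=\rho-\frac{\tau}{4}g$. The $(0,3)$-Cotton tensor is $C_{ijk}=(\nabla_iS)_{jk}-(\nabla_jS)_{ik}$, and the $(0,2)$-Cotton tensor is $C_{ij}=\frac{1}{2\sqrt{|\det g|}}C_{nmi}\,\epsilon^{nm\ell}g_{\ell j}$, where $\epsilon^{ijk}$ is the Levi-Civita symbol with $\epsilon^{123}=1$; here the orientation is the one for which $\{e_1,e_2,e_3\}$ is positively oriented. Signature $(++-)$ means $g(e_1,e_1)=g(e_2,e_2)=-g(e_3,e_3)=1$. A Cotton soliton is a vector field $X$ satisfying $\mathcal{L}_Xg+C=\lambda g$ for some $\lambda\in\mathbb{R}$; it is trivial if $C=0$, and steady if $\lambda=0$. Elements of $\mathfrak{g}$ are identified with left-invariant vector fields on $G$. $E(1,1)$ is the (connected, simply connected) group of rigid motions of the Minkowski plane, with Lie algebra $\mathbb{R}\ltimes\mathbb{R}^2$ where $\mathbb{R}$ acts by multiples of $\operatorname{diag}(1,-1)$. *)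

theory Defs
  imports "HOL-Analysis.Analysis" "HOL-Algebra.Group"
begin

section \<open>Smooth manifolds\<close>

primrec k_smooth_on ::
  "nat \<Rightarrow> 'a::real_normed_vector set \<Rightarrow> ('a \<Rightarrow> 'b::real_normed_vector) \<Rightarrow> bool" where
  "k_smooth_on 0 S f \<longleftrightarrow> continuous_on S f"
| "k_smooth_on (Suc k) S f \<longleftrightarrow>
     (\<forall>x\<in>S. f differentiable (at x)) \<and>
     (\<forall>v. k_smooth_on k S (\<lambda>x. frechet_derivative f (at x) v))"

text \<open>Only used for open \<open>S\<close>.\<close>

definition smooth_on :: "'a::real_normed_vector set \<Rightarrow> ('a \<Rightarrow> 'b::real_normed_vector) \<Rightarrow> bool" where
  "smooth_on S f \<longleftrightarrow> (\<forall>k. k_smooth_on k S f)"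

text \<open>
  The underlying set of a manifold is a whole type, whose class supplies the topology
  (Hausdorff and second countable in the theorem). The dimension is that of the model space
  \<open>'e\<close>. A chart is a pair of its domain and its coordinate map.
\<close>

type_synonym ('m, 'e) atlas = "('m set \<times> ('m \<Rightarrow> 'e)) set"

definition smooth_atlas :: "('m::topological_space, 'e::euclidean_space) atlas \<Rightarrow> bool" where
  "smooth_atlas A \<longleftrightarrow>
     (\<forall>(U, \<phi>)\<in>A. open U \<and> open (\<phi> ` U) \<and> homeomorphism U (\<phi> ` U) \<phi> (inv_into U \<phi>)) \<and>
     (\<Union>(U, \<phi>)\<in>A. U) = UNIV \<and>
     (\<forall>(U, \<phi>)\<in>A. \<forall>(V, \<psi>)\<in>A. smooth_on (\<phi> ` (U \<inter> V)) (\<psi> \<circ> inv_into U \<phi>))"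

definition smooth_map ::
  "('m::topological_space, 'e::euclidean_space) atlas \<Rightarrow>
   ('n::topological_space, 'd::euclidean_space) atlas \<Rightarrow> ('m \<Rightarrow> 'n) \<Rightarrow> bool" where
  "smooth_map A B h \<longleftrightarrow>
     continuous_on UNIV h \<and>
     (\<forall>(U, \<phi>)\<in>A. \<forall>(V, \<psi>)\<in>B. smooth_on (\<phi> ` (U \<inter> h -` V)) (\<psi> \<circ> h \<circ> inv_into U \<phi>))"

definition product_atlas ::
  "('m, 'e) atlas \<Rightarrow> ('n, 'd) atlas \<Rightarrow> ('m \<times> 'n, 'e \<times> 'd) atlas" where
  "product_atlas A B = {(U \<times> V, map_prod \<phi> \<psi>) | U \<phi> V \<psi>. (U, \<phi>) \<in> A \<and> (V, \<psi>) \<in> B}"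

text \<open>\<open>f\<close> is smooth on some open neighbourhood of \<open>p\<close>.\<close>

definition smooth_near ::
  "('m::topological_space, 'e::euclidean_space) atlas \<Rightarrow> 'm \<Rightarrow> ('m \<Rightarrow> real) \<Rightarrow> bool" where
  "smooth_near A p f \<longleftrightarrow>
     (\<exists>(U, \<phi>)\<in>A. \<exists>W. open W \<and> p \<in> W \<and> W \<subseteq> U \<and> smooth_on (\<phi> ` W) (f \<circ> inv_into U \<phi>))"

definition smooth_function ::
  "('m::topological_space, 'e::euclidean_space) atlas \<Rightarrow> ('m \<Rightarrow> real) \<Rightarrow> bool" where
  "smooth_function A f \<longleftrightarrow> (\<forall>p. smooth_near A p f)"


section \<open>Tangent vectors and vector fields\<close>

text \<open>
  A tangent vector at \<open>p\<close> is a derivation on the functions that are smooth near \<open>p\<close>. It is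
  extended by \<open>0\<close> to all other functions, so that it is determined by its values on the former.
  The Leibniz rule forces \<open>v f\<close> to depend only on the germ of \<open>f\<close> at \<open>p\<close>: if \<open>f\<close> vanishes on a
  neighbourhood \<open>W\<close> of \<open>p\<close>, apply it to \<open>f = f * (indicator of the complement of W)\<close>.
\<close>

type_synonym 'm tangent = "('m \<Rightarrow> real) \<Rightarrow> real"
type_synonym 'm vfield = "'m \<Rightarrow> 'm tangent"

definition tangent_space ::
  "('m::topological_space, 'e::euclidean_space) atlas \<Rightarrow> 'm \<Rightarrow> 'm tangent set" where
  "tangent_space A p = {v.
     (\<forall>f. \<not> smooth_near A p f \<longrightarrow> v f = 0) \<and>
     (\<forall>f h a b. smooth_near A p f \<and> smooth_near A p h \<longrightarrow>
        v (\<lambda>q. a * f q + b * h q) = a * v f + b * v h) \<and>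
     (\<forall>f h. smooth_near A p f \<and> smooth_near A p h \<longrightarrow>
        v (\<lambda>q. f q * h q) = v f * h p + f p * v h)}"

definition tangent_comb :: "real \<Rightarrow> 'm tangent \<Rightarrow> real \<Rightarrow> 'm tangent \<Rightarrow> 'm tangent" where
  "tangent_comb a v b w = (\<lambda>f. a * v f + b * w f)"

definition tangent_map :: "('m \<Rightarrow> 'n) \<Rightarrow> 'm tangent \<Rightarrow> 'n tangent" where
  "tangent_map h v = (\<lambda>f. v (f \<circ> h))"

definition vector_field ::
  "('m::topological_space, 'e::euclidean_space) atlas \<Rightarrow> 'm vfield \<Rightarrow> bool" where
  "vector_field A X \<longleftrightarrow>
     (\<forall>p. X p \<in> tangent_space A p) \<and>
     (\<forall>p f. smooth_near A p f \<longrightarrow> smooth_near A p (\<lambda>q. X q f))"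

definition vf_add :: "'m vfield \<Rightarrow> 'm vfield \<Rightarrow> 'm vfield" where
  "vf_add X Y = (\<lambda>p f. X p f + Y p f)"

definition vf_diff :: "'m vfield \<Rightarrow> 'm vfield \<Rightarrow> 'm vfield" where
  "vf_diff X Y = (\<lambda>p f. X p f - Y p f)"

definition vf_scale :: "('m \<Rightarrow> real) \<Rightarrow> 'm vfield \<Rightarrow> 'm vfield" where
  "vf_scale h X = (\<lambda>p f. h p * X p f)"

definition lie_bracket ::
  "('m::topological_space, 'e::euclidean_space) atlas \<Rightarrow> 'm vfield \<Rightarrow> 'm vfield \<Rightarrow> 'm vfield" where
  "lie_bracket A X Y =
     (\<lambda>p f. if smooth_near A p f then X p (\<lambda>q. Y q f) - Y p (\<lambda>q. X q f) else 0)"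

definition frame_comb :: "(3 \<Rightarrow> 'm vfield) \<Rightarrow> real^3 \<Rightarrow> 'm vfield" where
  "frame_comb E c = (\<lambda>p f. \<Sum>i\<in>UNIV. c $ i * E i p f)"

text \<open>The components at \<open>p\<close> of a vector field with respect to a frame \<open>E\<close>.\<close>

definition frame_coord :: "(3 \<Rightarrow> 'm vfield) \<Rightarrow> 'm vfield \<Rightarrow> 'm \<Rightarrow> real^3" where
  "frame_coord E X p = (THE c. X p = frame_comb E c p)"


section \<open>Lorentzian metrics and the Levi-Civita connection\<close>

type_synonym 'm metric = "'m \<Rightarrow> 'm tangent \<Rightarrow> 'm tangent \<Rightarrow> real"

definition minkowski :: "3 \<Rightarrow> 3 \<Rightarrow> real" where
  "minkowski i j = (if i \<noteq> j then 0 else if i = 3 then -1 else 1)"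

definition metric_on :: "'m metric \<Rightarrow> 'm vfield \<Rightarrow> 'm vfield \<Rightarrow> 'm \<Rightarrow> real" where
  "metric_on g X Y = (\<lambda>p. g p (X p) (Y p))"

text \<open>
  The orthonormal basis required in every tangent space makes the form non-degenerate and of
  signature \<open>(++-)\<close>.
\<close>

definition lorentzian_metric ::
  "('m::topological_space, real^3) atlas \<Rightarrow> 'm metric \<Rightarrow> bool" where
  "lorentzian_metric A g \<longleftrightarrow>
     (\<forall>p. \<forall>u\<in>tangent_space A p. \<forall>v\<in>tangent_space A p. \<forall>w\<in>tangent_space A p. \<forall>a b.
        g p (tangent_comb a u b v) w = a * g p u w + b * g p v w) \<and>
     (\<forall>p. \<forall>v\<in>tangent_space A p. \<forall>w\<in>tangent_space A p. g p v w = g p w v) \<and>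
     (\<forall>p. \<exists>b :: 3 \<Rightarrow> 'm tangent.
        (\<forall>i. b i \<in> tangent_space A p) \<and>
        (\<forall>v\<in>tangent_space A p. \<exists>c :: real^3. v = (\<lambda>f. \<Sum>i\<in>UNIV. c $ i * b i f)) \<and>
        (\<forall>i j. g p (b i) (b j) = minkowski i j)) \<and>
     (\<forall>X Y. vector_field A X \<and> vector_field A Y \<longrightarrow> smooth_function A (metric_on g X Y))"

type_synonym 'm connection = "'m vfield \<Rightarrow> 'm vfield \<Rightarrow> 'm vfield"

definition affine_connection ::
  "('m::topological_space, 'e::euclidean_space) atlas \<Rightarrow> 'm connection \<Rightarrow> bool" where
  "affine_connection A D \<longleftrightarrow>
     (\<forall>X Y. vector_field A X \<and> vector_field A Y \<longrightarrow> vector_field A (D X Y)) \<and>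
     (\<forall>X Y Z. vector_field A X \<and> vector_field A Y \<and> vector_field A Z \<longrightarrow>
        D (vf_add X Y) Z = vf_add (D X Z) (D Y Z) \<and>
        D X (vf_add Y Z) = vf_add (D X Y) (D X Z)) \<and>
     (\<forall>h X Y. smooth_function A h \<and> vector_field A X \<and> vector_field A Y \<longrightarrow>
        D (vf_scale h X) Y = vf_scale h (D X Y) \<and>
        D X (vf_scale h Y) = vf_add (vf_scale (\<lambda>p. X p h) Y) (vf_scale h (D X Y)))"

definition levi_civita_connection ::
  "('m::topological_space, 'e::euclidean_space) atlas \<Rightarrow> 'm metric \<Rightarrow> 'm connection \<Rightarrow> bool" where
  "levi_civita_connection A g D \<longleftrightarrow>
     affine_connection A D \<and>
     (\<forall>X Y. vector_field A X \<and> vector_field A Y \<longrightarrow>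
        vf_diff (D X Y) (D Y X) = lie_bracket A X Y) \<and>
     (\<forall>X Y Z p. vector_field A X \<and> vector_field A Y \<and> vector_field A Z \<longrightarrow>
        X p (metric_on g Y Z) = metric_on g (D X Y) Z p + metric_on g Y (D X Z) p)"


section \<open>Curvature and Cotton tensors\<close>

text \<open>
  A tensor field of type \<open>(0,k)\<close> is represented by its values on vector fields. Traces and
  components are taken in a global frame \<open>E\<close> (every Lie group has one); the traces do not depend
  on it.
\<close>

definition curvature ::
  "('m::topological_space, 'e::euclidean_space) atlas \<Rightarrow> 'm connection \<Rightarrow>
   'm vfield \<Rightarrow> 'm vfield \<Rightarrow> 'm vfield \<Rightarrow> 'm vfield" where
  "curvature A D X Y Z = vf_diff (D (lie_bracket A X Y) Z) (vf_diff (D X (D Y Z)) (D Y (D X Z)))"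

definition frame_trace :: "(3 \<Rightarrow> 'm vfield) \<Rightarrow> ('m vfield \<Rightarrow> 'm vfield) \<Rightarrow> 'm \<Rightarrow> real" where
  "frame_trace E T p = (\<Sum>k\<in>UNIV. frame_coord E (T (E k)) p $ k)"

definition ricci ::
  "('m::topological_space, 'e::euclidean_space) atlas \<Rightarrow> 'm connection \<Rightarrow> (3 \<Rightarrow> 'm vfield) \<Rightarrow>
   'm vfield \<Rightarrow> 'm vfield \<Rightarrow> 'm \<Rightarrow> real" where
  "ricci A D E X Y = frame_trace E (\<lambda>Z. curvature A D X Z Y)"

definition gram :: "'m metric \<Rightarrow> (3 \<Rightarrow> 'm vfield) \<Rightarrow> 'm \<Rightarrow> real^3^3" where
  "gram g E p = (\<chi> i j. metric_on g (E i) (E j) p)"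

definition scalar_curvature ::
  "('m::topological_space, 'e::euclidean_space) atlas \<Rightarrow> 'm metric \<Rightarrow> 'm connection \<Rightarrow>
   (3 \<Rightarrow> 'm vfield) \<Rightarrow> 'm \<Rightarrow> real" where
  "scalar_curvature A g D E p =
     (\<Sum>i\<in>UNIV. \<Sum>j\<in>UNIV. matrix_inv (gram g E p) $ i $ j * ricci A D E (E i) (E j) p)"

definition schouten ::
  "('m::topological_space, 'e::euclidean_space) atlas \<Rightarrow> 'm metric \<Rightarrow> 'm connection \<Rightarrow>
   (3 \<Rightarrow> 'm vfield) \<Rightarrow> 'm vfield \<Rightarrow> 'm vfield \<Rightarrow> 'm \<Rightarrow> real" where
  "schouten A g D E X Y p = ricci A D E X Y p - scalar_curvature A g D E p / 4 * metric_on g X Y p"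

text \<open>\<open>cov_deriv D X S Y Z\<close> is the function usually written \<open>(\<nabla>\<^sub>X S)(Y, Z)\<close>.\<close>

definition cov_deriv ::
  "'m connection \<Rightarrow> 'm vfield \<Rightarrow> ('m vfield \<Rightarrow> 'm vfield \<Rightarrow> 'm \<Rightarrow> real) \<Rightarrow>
   'm vfield \<Rightarrow> 'm vfield \<Rightarrow> 'm \<Rightarrow> real" where
  "cov_deriv D X S Y Z p = X p (S Y Z) - S (D X Y) Z p - S Y (D X Z) p"

definition cotton3 ::
  "('m::topological_space, 'e::euclidean_space) atlas \<Rightarrow> 'm metric \<Rightarrow> 'm connection \<Rightarrow>
   (3 \<Rightarrow> 'm vfield) \<Rightarrow> 'm vfield \<Rightarrow> 'm vfield \<Rightarrow> 'm vfield \<Rightarrow> 'm \<Rightarrow> real" where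
  "cotton3 A g D E X Y Z p =
     cov_deriv D X (schouten A g D E) Y Z p - cov_deriv D Y (schouten A g D E) X Z p"

definition levi_civita_symbol :: "3 \<Rightarrow> 3 \<Rightarrow> 3 \<Rightarrow> real" where
  "levi_civita_symbol i j k =
     (if (i, j, k) \<in> {(1, 2, 3), (2, 3, 1), (3, 1, 2)} then 1
      else if (i, j, k) \<in> {(1, 3, 2), (2, 1, 3), (3, 2, 1)} then -1
      else 0)"

text \<open>
  The components of the \<open>(0,2)\<close>-Cotton tensor in the frame \<open>E\<close>, for the orientation in which \<open>E\<close>
  is positively oriented.
\<close>

definition cotton_component ::
  "('m::topological_space, 'e::euclidean_space) atlas \<Rightarrow> 'm metric \<Rightarrow> 'm connection \<Rightarrow>
   (3 \<Rightarrow> 'm vfield) \<Rightarrow> 3 \<Rightarrow> 3 \<Rightarrow> 'm \<Rightarrow> real" where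
  "cotton_component A g D E i j p =
     1 / (2 * sqrt \<bar>det (gram g E p)\<bar>) *
     (\<Sum>n\<in>UNIV. \<Sum>m\<in>UNIV. \<Sum>l\<in>UNIV.
        cotton3 A g D E (E n) (E m) (E i) p * levi_civita_symbol n m l * gram g E p $ l $ j)"

definition cotton ::
  "('m::topological_space, 'e::euclidean_space) atlas \<Rightarrow> 'm metric \<Rightarrow> 'm connection \<Rightarrow>
   (3 \<Rightarrow> 'm vfield) \<Rightarrow> 'm vfield \<Rightarrow> 'm vfield \<Rightarrow> 'm \<Rightarrow> real" where
  "cotton A g D E Y Z p =
     (\<Sum>i\<in>UNIV. \<Sum>j\<in>UNIV.
        frame_coord E Y p $ i * frame_coord E Z p $ j * cotton_component A g D E i j p)"

definition lie_deriv_metric ::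
  "('m::topological_space, 'e::euclidean_space) atlas \<Rightarrow> 'm metric \<Rightarrow>
   'm vfield \<Rightarrow> 'm vfield \<Rightarrow> 'm vfield \<Rightarrow> 'm \<Rightarrow> real" where
  "lie_deriv_metric A g X Y Z p =
     X p (metric_on g Y Z) - metric_on g (lie_bracket A X Y) Z p - metric_on g Y (lie_bracket A X Z) p"

definition cotton_soliton ::
  "('m::topological_space, 'e::euclidean_space) atlas \<Rightarrow> 'm metric \<Rightarrow> 'm connection \<Rightarrow>
   (3 \<Rightarrow> 'm vfield) \<Rightarrow> 'm vfield \<Rightarrow> real \<Rightarrow> bool" where
  "cotton_soliton A g D E X c \<longleftrightarrow>
     vector_field A X \<and>
     (\<forall>Y Z p. vector_field A Y \<and> vector_field A Z \<longrightarrow>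
        lie_deriv_metric A g X Y Z p + cotton A g D E Y Z p = c * metric_on g Y Z p)"

definition cotton_flat ::
  "('m::topological_space, 'e::euclidean_space) atlas \<Rightarrow> 'm metric \<Rightarrow> 'm connection \<Rightarrow>
   (3 \<Rightarrow> 'm vfield) \<Rightarrow> bool" where
  "cotton_flat A g D E \<longleftrightarrow>
     (\<forall>Y Z p. vector_field A Y \<and> vector_field A Z \<longrightarrow> cotton A g D E Y Z p = 0)"


section \<open>Lie groups\<close>

definition lie_group :: "('g::topological_space, 'e::euclidean_space) atlas \<Rightarrow> 'g monoid \<Rightarrow> bool" where
  "lie_group A G \<longleftrightarrow>
     smooth_atlas A \<and> group G \<and> carrier G = UNIV \<and>
     smooth_map (product_atlas A A) A (\<lambda>(x, y). x \<otimes>\<^bsub>G\<^esub> y) \<and>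
     smooth_map A A (\<lambda>x. inv\<^bsub>G\<^esub> x)"

definition lie_group_isomorphic ::
  "('g::topological_space, 'e::euclidean_space) atlas \<Rightarrow> 'g monoid \<Rightarrow>
   ('h::topological_space, 'd::euclidean_space) atlas \<Rightarrow> 'h monoid \<Rightarrow> bool" where
  "lie_group_isomorphic A G B H \<longleftrightarrow>
     (\<exists>h. h \<in> iso G H \<and> smooth_map A B h \<and> smooth_map B A (inv_into (carrier G) h))"

definition left_invariant :: "'g monoid \<Rightarrow> 'g vfield \<Rightarrow> bool" where
  "left_invariant G X \<longleftrightarrow> (\<forall>a p. tangent_map (\<lambda>q. a \<otimes>\<^bsub>G\<^esub> q) (X p) = X (a \<otimes>\<^bsub>G\<^esub> p))"

definition lie_algebra ::
  "('g::topological_space, 'e::euclidean_space) atlas \<Rightarrow> 'g monoid \<Rightarrow> 'g vfield set" where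
  "lie_algebra A G = {X. vector_field A X \<and> left_invariant G X}"

definition lie_algebra_basis ::
  "('g::topological_space, 'e::euclidean_space) atlas \<Rightarrow> 'g monoid \<Rightarrow> (3 \<Rightarrow> 'g vfield) \<Rightarrow> bool" where
  "lie_algebra_basis A G e \<longleftrightarrow>
     (\<forall>i. e i \<in> lie_algebra A G) \<and> (\<forall>X\<in>lie_algebra A G. \<exists>!c. X = frame_comb e c)"

definition left_invariant_metric ::
  "('g::topological_space, 'e::euclidean_space) atlas \<Rightarrow> 'g monoid \<Rightarrow> 'g metric \<Rightarrow> bool" where
  "left_invariant_metric A G g \<longleftrightarrow>
     (\<forall>a p. \<forall>v\<in>tangent_space A p. \<forall>w\<in>tangent_space A p.
        g (a \<otimes>\<^bsub>G\<^esub> p) (tangent_map (\<lambda>q. a \<otimes>\<^bsub>G\<^esub> q) v) (tangent_map (\<lambda>q. a \<otimes>\<^bsub>G\<^esub> q) w) = g p v w)"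

text \<open>The Lie algebra of \<open>G\<close> is isomorphic to a matrix Lie algebra with the commutator bracket.\<close>

definition lie_algebra_isomorphic_matrices ::
  "('g::topological_space, 'e::euclidean_space) atlas \<Rightarrow> 'g monoid \<Rightarrow> (real^'n^'n) set \<Rightarrow> bool" where
  "lie_algebra_isomorphic_matrices A G M \<longleftrightarrow>
     (\<exists>\<Phi>. bij_betw \<Phi> (lie_algebra A G) M \<and>
        (\<forall>X\<in>lie_algebra A G. \<forall>Y\<in>lie_algebra A G.
           \<Phi> (vf_add X Y) = \<Phi> X + \<Phi> Y \<and>
           (\<forall>a. \<Phi> (vf_scale (\<lambda>_. a) X) = a *\<^sub>R \<Phi> X) \<and>
           \<Phi> (lie_bracket A X Y) = \<Phi> X ** \<Phi> Y - \<Phi> Y ** \<Phi> X))"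

definition so12 :: "(real^3^3) set" where
  "so12 = {M. let J = (\<chi> i j. if i \<noteq> j then 0 else if i = 1 then 1 else -1)
              in transpose M ** J + J ** M = 0}"

definition sl2 :: "(real^2^2) set" where
  "sl2 = {M. trace M = 0}"

text \<open>
  In null coordinates \<open>(u, v)\<close> of the Minkowski plane, with metric \<open>du dv\<close>, the triple
  \<open>(t, x, y)\<close> stands for the rigid motion \<open>(u, v) \<mapsto> (exp t * u + x, exp (- t) * v + y)\<close>, and the
  product is composition. These motions form the identity component of the isometry group.
\<close>

definition E11 :: "(real^3) monoid" where
  "E11 = \<lparr>carrier = UNIV,
     mult = (\<lambda>a b. vector [a$1 + b$1, a$2 + exp (a$1) * b$2, a$3 + exp (- a$1) * b$3]),
     one = 0\<rparr>"

definition E11_atlas :: "(real^3, real^3) atlas" where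
  "E11_atlas = {(UNIV, id)}"

end

theory Submission
  imports Defs
begin

text \<open>
  In the frame \<open>e\<close> the Koszul formula determines the connection, because the frame is orthonormal and
  its brackets have constant coefficients; curvature, Ricci, Schouten and Cotton tensors are then
  polynomials in \<open>\<alpha>\<close> and \<open>\<beta>\<close>. With \<open>P = 2\<beta>\<^sup>2 - \<alpha>\<beta> - \<alpha>\<^sup>2/4\<close> and \<open>Q = \<alpha>\<^sup>2(\<beta> - \<alpha>)/2\<close> the Cotton tensor
  has the components \<open>C\<^sub>1\<^sub>1 = \<alpha>\<^sup>2(\<alpha> - \<beta>)\<close>, \<open>C\<^sub>2\<^sub>2 = P + Q\<close>, \<open>C\<^sub>3\<^sub>3 = P - Q\<close>, \<open>C\<^sub>2\<^sub>3 = - P\<close>, and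
  \<open>C\<^sub>1\<^sub>2 = C\<^sub>1\<^sub>3 = 0\<close> (\<open>cotton_component_value\<close>). Both sides of the soliton equation are tensors, so for
  \<open>X = x\<^sub>1e\<^sub>1 + x\<^sub>2e\<^sub>2 + x\<^sub>3e\<^sub>3\<close> the equation is a system of six scalar equations. The first one reads
  \<open>\<lambda> = \<alpha>\<^sup>2(\<alpha> - \<beta>) = -2Q\<close>, while the entries \<open>22\<close> and \<open>23\<close> add up to \<open>\<lambda> = Q\<close>; hence
  \<open>\<lambda> = Q = 0\<close>, so \<open>\<alpha> = 0\<close> or \<open>\<alpha> = \<beta>\<close>, and \<open>x\<^sub>1 = P\<close>. The entries \<open>12\<close> and \<open>13\<close> restrict \<open>x\<^sub>2\<close> and \<open>x\<^sub>3\<close>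
  (\<open>cotton_soliton_iff\<close>). When \<open>Q = 0\<close>, the Cotton tensor vanishes exactly if \<open>P = 0\<close>, that is, if
  \<open>\<beta> = 0\<close>.

  For \<open>\<alpha> = \<beta> \<noteq> 0\<close> the Lie algebra has a standard basis of \<open>sl(2)\<close> consisting of \<open>-2e\<^sub>1/\<beta>\<close>, \<open>e\<^sub>2 + e\<^sub>3\<close>
  and a third vector, and explicit matrices give the two isomorphisms.

  For \<open>\<alpha> = 0 \<noteq> \<beta>\<close> the fields \<open>X = e\<^sub>1/\<beta>\<close>, \<open>Z = e\<^sub>2 + e\<^sub>3\<close> and \<open>Y = e\<^sub>2 - e\<^sub>3 + Z/(2\<beta>)\<close> satisfy
  \<open>[X, Y] = Y\<close>, \<open>[X, Z] = - Z\<close>, \<open>[Y, Z] = 0\<close>, the relations of \<open>E(1,1)\<close>. That the group itself is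
  \<open>E(1,1)\<close> is shown in three steps. If \<open>\<omega>\<^sub>1, \<omega>\<^sub>2, \<omega>\<^sub>3\<close> is the dual coframe, then \<open>\<omega>\<^sub>1 = dt\<close>,
  \<open>exp t \<omega>\<^sub>2 = da\<close> and \<open>exp (- t) \<omega>\<^sub>3 = db\<close> near the unit by the Poincare lemma
  (\<open>closed_form_potential\<close>, \<open>E11_coordinates\<close>), and \<open>(t, a, b)\<close> is a chart. Left invariance makes this
  chart a local homomorphism: for fixed \<open>p\<close> the functions \<open>t(pq) - t(q)\<close>, \<open>a(pq) - exp (t(p)) a(q)\<close> and
  \<open>b(pq) - exp (- t(p)) b(q)\<close> of \<open>q\<close> have zero derivative along the frame. Its inverse extends to a
  homomorphism \<open>s\<close> on all of \<open>E(1,1)\<close>, built from three one-parameter subgroups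
  (\<open>one_parameter_extension\<close>, \<open>global_homomorphism\<close>). Finally \<open>s\<close> is onto because \<open>G\<close> is connected, and
  injective because \<open>G\<close> is simply connected: the image under \<open>s\<close> of a segment from \<open>0\<close> to a point of the
  kernel is a loop, and lifting a contraction of that loop to \<open>E(1,1)\<close> shows that the point is \<open>0\<close>
  (\<open>global_isomorphism\<close>).
\<close>

section \<open>Calculus of smooth maps\<close>

lemma k_smooth_on_subset:
  "k_smooth_on k T f \<Longrightarrow> S \<subseteq> T \<Longrightarrow> k_smooth_on k S f"
  by (induction k arbitrary: f) (auto intro: continuous_on_subset)

lemma k_smooth_on_continuous:
  "k_smooth_on k S f \<Longrightarrow> continuous_on S f"
  by (cases k) (auto intro!: continuous_at_imp_continuous_on differentiable_imp_continuous_within)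

lemma k_smooth_on_Suc_D: "k_smooth_on (Suc k) S f \<Longrightarrow> k_smooth_on k S f"
proof (induction k arbitrary: f)
  case 0
  then show ?case using k_smooth_on_continuous[of "Suc 0" S f] by simp
next
  case (Suc k)
  then show ?case by (metis k_smooth_on.simps(2))
qed

lemma k_smooth_on_local:
  assumes "\<And>x. x \<in> S \<Longrightarrow> \<exists>W. open W \<and> x \<in> W \<and> k_smooth_on k W f"
  shows "k_smooth_on k S f"
  using assms
proof (induction k arbitrary: f)
  case 0
  show ?case unfolding k_smooth_on.simps
    by (rule continuous_at_imp_continuous_on)
      (metis 0 continuous_on_eq_continuous_at k_smooth_on.simps(1))
next
  case (Suc k)
  show ?case
    unfolding k_smooth_on.simps
  proof (intro conjI ballI allI)
    fix x assume "x \<in> S"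
    with Suc.prems obtain W where "x \<in> W" "k_smooth_on (Suc k) W f" by blast
    then show "f differentiable at x" by auto
  next
    fix v
    show "k_smooth_on k S (\<lambda>x. frechet_derivative f (at x) v)"
    proof (rule Suc.IH)
      fix x assume "x \<in> S"
      with Suc.prems obtain W where "open W" "x \<in> W" "k_smooth_on (Suc k) W f" by blast
      then show "\<exists>W. open W \<and> x \<in> W \<and> k_smooth_on k W (\<lambda>x. frechet_derivative f (at x) v)"
        by auto
    qed
  qed
qed

lemma frechet_derivative_cong_open:
  assumes "open S" "x \<in> S" "\<And>y. y \<in> S \<Longrightarrow> f y = g y"
  shows "frechet_derivative f (at x) = frechet_derivative g (at x)"
proof -
  have "(f has_derivative D) (at x) \<longleftrightarrow> (g has_derivative D) (at x)" for D
    using assms by (metis has_derivative_transform_within_open)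
  then show ?thesis unfolding frechet_derivative_def by simp
qed

lemma k_smooth_on_cong:
  assumes "open S" "\<And>x. x \<in> S \<Longrightarrow> f x = g x" "k_smooth_on k S f"
  shows "k_smooth_on k S g"
  using assms(2,3)
proof (induction k arbitrary: f g)
  case 0
  then show ?case by (metis continuous_on_cong k_smooth_on.simps(1))
next
  case (Suc k)
  have "g differentiable at x" if "x \<in> S" for x
    using Suc.prems that \<open>open S\<close> unfolding k_smooth_on.simps differentiable_def
    by (metis has_derivative_transform_within_open)
  moreover have "k_smooth_on k S (\<lambda>x. frechet_derivative g (at x) v)" for v
  proof (rule Suc.IH)
    show "k_smooth_on k S (\<lambda>x. frechet_derivative f (at x) v)" using Suc.prems by simp
    show "frechet_derivative f (at x) v = frechet_derivative g (at x) v" if "x \<in> S" for x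
      using frechet_derivative_cong_open[OF assms(1) that] Suc.prems(1) by metis
  qed
  ultimately show ?case by simp
qed

text \<open>
  The working form of the recursion: on an open set any expression for the derivative may replace
  \<open>frechet_derivative\<close>.
\<close>
lemma k_smooth_on_SucI:
  assumes "open S" "\<And>x. x \<in> S \<Longrightarrow> (f has_derivative f' x) (at x)"
    and "\<And>v. k_smooth_on k S (\<lambda>x. f' x v)"
  shows "k_smooth_on (Suc k) S f"
  unfolding k_smooth_on.simps
proof (intro conjI ballI allI)
  show "f differentiable at x" if "x \<in> S" for x
    using assms(2)[OF that] differentiable_def by blast
  fix v
  show "k_smooth_on k S (\<lambda>x. frechet_derivative f (at x) v)"
  proof (rule k_smooth_on_cong[OF assms(1) _ assms(3)])
    show "f' x v = frechet_derivative f (at x) v" if "x \<in> S" for x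
      using frechet_derivative_at[OF assms(2)[OF that]] by simp
  qed
qed

lemma k_smooth_on_Suc_derivative:
  assumes "k_smooth_on (Suc k) S f" "x \<in> S"
  shows "(f has_derivative frechet_derivative f (at x)) (at x)"
  using assms by (simp add: frechet_derivative_works)

lemma k_smooth_on_const: "open S \<Longrightarrow> k_smooth_on k S (\<lambda>x. c)"
proof (induction k arbitrary: c)
  case (Suc k)
  show ?case
    by (rule k_smooth_on_SucI[where f' = "\<lambda>_ _. 0"]) (use Suc in auto)
qed simp

lemma k_smooth_on_bounded_linear:
  assumes "open S" "bounded_linear L" "k_smooth_on k S f"
  shows "k_smooth_on k S (\<lambda>x. L (f x))"
  using assms(3)
proof (induction k arbitrary: f)
  case 0
  then show ?case using assms(2) by (simp add: bounded_linear.continuous_on)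
next
  case (Suc k)
  show ?case
  proof (rule k_smooth_on_SucI[OF assms(1)])
    show "((\<lambda>x. L (f x)) has_derivative (\<lambda>v. L (frechet_derivative f (at x) v))) (at x)"
      if "x \<in> S" for x
      using k_smooth_on_Suc_derivative[OF Suc.prems that] bounded_linear.has_derivative[OF assms(2)]
      by blast
    show "k_smooth_on k S (\<lambda>x. L (frechet_derivative f (at x) v))" for v
      using Suc by simp
  qed
qed

lemma k_smooth_on_id: "open S \<Longrightarrow> k_smooth_on k S (\<lambda>x. x)"
proof (cases k)
  case (Suc n)
  assume "open S"
  then show ?thesis unfolding Suc
    by (intro k_smooth_on_SucI[where f' = "\<lambda>_ v. v"] k_smooth_on_const) auto
qed simp

lemma k_smooth_on_add:
  assumes "open S" "k_smooth_on k S f" "k_smooth_on k S g"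
  shows "k_smooth_on k S (\<lambda>x. f x + g x)"
  using assms(2,3)
proof (induction k arbitrary: f g)
  case 0
  then show ?case by (simp add: continuous_on_add)
next
  case (Suc k)
  show ?case
  proof (rule k_smooth_on_SucI[OF assms(1)])
    show "((\<lambda>x. f x + g x) has_derivative
        (\<lambda>v. frechet_derivative f (at x) v + frechet_derivative g (at x) v)) (at x)"
      if "x \<in> S" for x
      using has_derivative_add[OF k_smooth_on_Suc_derivative[OF Suc.prems(1) that]
          k_smooth_on_Suc_derivative[OF Suc.prems(2) that]] .
    show "k_smooth_on k S (\<lambda>x. frechet_derivative f (at x) v + frechet_derivative g (at x) v)" for v
      using Suc by simp
  qed
qed

lemma k_smooth_on_bilinear:
  assumes "open S" "bounded_bilinear h" "k_smooth_on k S f" "k_smooth_on k S g"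
  shows "k_smooth_on k S (\<lambda>x. h (f x) (g x))"
  using assms(3,4)
proof (induction k arbitrary: f g)
  case 0
  then show ?case using assms(2) by (simp add: bounded_bilinear.continuous_on)
next
  case (Suc k)
  show ?case
  proof (rule k_smooth_on_SucI[OF assms(1)])
    show "((\<lambda>x. h (f x) (g x)) has_derivative
        (\<lambda>v. h (f x) (frechet_derivative g (at x) v) + h (frechet_derivative f (at x) v) (g x))) (at x)"
      if "x \<in> S" for x
      using bounded_bilinear.FDERIV[OF assms(2)
          k_smooth_on_Suc_derivative[OF Suc.prems(1) that] k_smooth_on_Suc_derivative[OF Suc.prems(2) that]] .
    show "k_smooth_on k S (\<lambda>x. h (f x) (frechet_derivative g (at x) v)
        + h (frechet_derivative f (at x) v) (g x))" for v
      using Suc.prems k_smooth_on_Suc_D[OF Suc.prems(1)] k_smooth_on_Suc_D[OF Suc.prems(2)]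
      by (intro k_smooth_on_add[OF assms(1)] Suc.IH) auto
  qed
qed

lemma k_smooth_on_sum:
  assumes "open S" "\<And>i. i \<in> I \<Longrightarrow> k_smooth_on k S (f i)"
  shows "k_smooth_on k S (\<lambda>x. \<Sum>i\<in>I. f i x)"
  using assms(2)
  by (induction I rule: infinite_finite_induct)
    (auto intro: k_smooth_on_const k_smooth_on_add assms(1))

lemma has_derivative_basis_expansion:
  fixes x :: "'a::euclidean_space"
  assumes "(g has_derivative g') F"
  shows "g' x = (\<Sum>b\<in>Basis. (x \<bullet> b) *\<^sub>R g' b)"
proof -
  have "linear g'" using assms has_derivative_linear by blast
  then have "g' (\<Sum>b\<in>Basis. (x \<bullet> b) *\<^sub>R b) = (\<Sum>b\<in>Basis. (x \<bullet> b) *\<^sub>R g' b)"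
    by (simp add: linear_sum linear_cmul)
  then show ?thesis by (simp add: euclidean_representation)
qed

text \<open>
  The chain rule yields \<open>g'(f x)(f'(x) v)\<close>, whose direction varies with \<open>x\<close>. Expanding that direction in
  a basis of the Euclidean space in between gives a sum of products of maps that are smooth by the
  induction hypothesis.
\<close>
lemma k_smooth_on_compose:
  fixes f :: "'a::real_normed_vector \<Rightarrow> 'b::euclidean_space"
  assumes "open S" "open T" "f ` S \<subseteq> T"
    and "k_smooth_on k S f" "k_smooth_on k T g"
  shows "k_smooth_on k S (\<lambda>x. g (f x))"
  using assms(4,5)
proof (induction k arbitrary: g)
  case 0
  then show ?case using assms(3) by (auto intro: continuous_on_compose2)
next
  case (Suc k)
  let ?f = "\<lambda>x. frechet_derivative f (at x)" and ?g = "\<lambda>x. frechet_derivative g (at x)"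
  show ?case
  proof (rule k_smooth_on_SucI[OF assms(1)])
    fix x assume x: "x \<in> S"
    then have fx: "f x \<in> T" using assms(3) by blast
    have dg: "(g has_derivative ?g (f x)) (at (f x))"
      using k_smooth_on_Suc_derivative[OF Suc.prems(2) fx] .
    have "((\<lambda>x. g (f x)) has_derivative (\<lambda>v. ?g (f x) (?f x v))) (at x)"
      using has_derivative_compose[OF k_smooth_on_Suc_derivative[OF Suc.prems(1) x] dg] .
    then show "((\<lambda>x. g (f x)) has_derivative (\<lambda>v. \<Sum>b\<in>Basis. (?f x v \<bullet> b) *\<^sub>R ?g (f x) b)) (at x)"
      unfolding has_derivative_basis_expansion[OF dg, symmetric] .
  next
    fix v
    show "k_smooth_on k S (\<lambda>x. \<Sum>b\<in>Basis. (?f x v \<bullet> b) *\<^sub>R ?g (f x) b)"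
    proof (intro k_smooth_on_sum assms(1) k_smooth_on_bilinear[OF assms(1) bounded_bilinear_scaleR]
        k_smooth_on_bounded_linear[OF assms(1) bounded_linear_inner_left])
      show "k_smooth_on k S (\<lambda>x. ?f x v)" using Suc.prems by simp
      show "k_smooth_on k S (\<lambda>x. ?g (f x) b)" for b
        using Suc.prems k_smooth_on_Suc_D[OF Suc.prems(1)] by (intro Suc.IH) auto
    qed
  qed
qed

lemma k_smooth_on_inverse: "k_smooth_on k (- {0}) (inverse :: real \<Rightarrow> real)"
proof (induction k)
  case 0
  show ?case by (simp add: continuous_on_inverse[OF continuous_on_id])
next
  case (Suc k)
  have o: "open (- {0::real})" by auto
  show ?case
  proof (rule k_smooth_on_SucI[OF o])
    show "(inverse has_derivative (\<lambda>v. - v * (inverse x * inverse x))) (at x)" if "x \<in> - {0}" for x :: real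
      using that by (auto intro!: derivative_eq_intros)
    show "k_smooth_on k (- {0}) (\<lambda>x::real. - v * (inverse x * inverse x))" for v
      by (rule k_smooth_on_bilinear[OF o bounded_bilinear_mult k_smooth_on_const[OF o]
            k_smooth_on_bilinear[OF o bounded_bilinear_mult Suc Suc]])
  qed
qed

lemma k_smooth_on_exp: "k_smooth_on k UNIV (exp :: real \<Rightarrow> real)"
proof (induction k)
  case 0
  show ?case by (simp add: continuous_on_exp[OF continuous_on_id])
next
  case (Suc k)
  show ?case
  proof (rule k_smooth_on_SucI[OF open_UNIV])
    show "(exp has_derivative (\<lambda>v. v * exp x)) (at x)" for x :: real
      by (auto intro!: derivative_eq_intros)
    show "k_smooth_on k UNIV (\<lambda>x::real. v * exp x)" for v
      by (rule k_smooth_on_bilinear[OF open_UNIV bounded_bilinear_mult k_smooth_on_const[OF open_UNIV] Suc])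
  qed
qed

lemma smooth_on_subset: "smooth_on T f \<Longrightarrow> S \<subseteq> T \<Longrightarrow> smooth_on S f"
  unfolding smooth_on_def using k_smooth_on_subset by blast

lemma smooth_on_continuous: "smooth_on S f \<Longrightarrow> continuous_on S f"
  unfolding smooth_on_def using k_smooth_on_continuous by blast

lemma smooth_on_local:
  "(\<And>x. x \<in> S \<Longrightarrow> \<exists>W. open W \<and> x \<in> W \<and> smooth_on W f) \<Longrightarrow> smooth_on S f"
  unfolding smooth_on_def by (metis k_smooth_on_local)

lemma smooth_on_cong:
  "smooth_on S f \<Longrightarrow> open S \<Longrightarrow> (\<And>x. x \<in> S \<Longrightarrow> f x = g x) \<Longrightarrow> smooth_on S g"
  unfolding smooth_on_def by (metis k_smooth_on_cong)

lemma smooth_on_derivative: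
  "smooth_on S f \<Longrightarrow> x \<in> S \<Longrightarrow> (f has_derivative frechet_derivative f (at x)) (at x)"
  unfolding smooth_on_def using k_smooth_on_Suc_derivative by blast

lemma smooth_on_frechet: "smooth_on S f \<Longrightarrow> smooth_on S (\<lambda>x. frechet_derivative f (at x) v)"
  unfolding smooth_on_def by (metis k_smooth_on.simps(2))

lemma smooth_onI_derivative:
  assumes "open S" "\<And>x. x \<in> S \<Longrightarrow> (f has_derivative f' x) (at x)"
    and "\<And>v. smooth_on S (\<lambda>x. f' x v)"
  shows "smooth_on S f"
  unfolding smooth_on_def
proof
  fix k
  have "k_smooth_on (Suc k) S f"
    by (rule k_smooth_on_SucI[OF assms(1,2)]) (use assms(3) in \<open>simp_all add: smooth_on_def\<close>)
  then show "k_smooth_on k S f" by (rule k_smooth_on_Suc_D)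
qed

lemma smooth_on_const: "open S \<Longrightarrow> smooth_on S (\<lambda>x. c)"
  unfolding smooth_on_def by (simp add: k_smooth_on_const)

lemma smooth_on_id: "open S \<Longrightarrow> smooth_on S (\<lambda>x. x)"
  unfolding smooth_on_def by (simp add: k_smooth_on_id)

lemma smooth_on_add:
  "open S \<Longrightarrow> smooth_on S f \<Longrightarrow> smooth_on S h \<Longrightarrow> smooth_on S (\<lambda>x. f x + h x)"
  unfolding smooth_on_def by (simp add: k_smooth_on_add)

lemma smooth_on_sum:
  "open S \<Longrightarrow> (\<And>i. i \<in> I \<Longrightarrow> smooth_on S (f i)) \<Longrightarrow> smooth_on S (\<lambda>x. \<Sum>i\<in>I. f i x)"
  unfolding smooth_on_def by (simp add: k_smooth_on_sum)

lemma smooth_on_bounded_linear: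
  "open S \<Longrightarrow> bounded_linear L \<Longrightarrow> smooth_on S f \<Longrightarrow> smooth_on S (\<lambda>x. L (f x))"
  unfolding smooth_on_def by (simp add: k_smooth_on_bounded_linear)

lemma smooth_on_bilinear:
  "open S \<Longrightarrow> bounded_bilinear b \<Longrightarrow> smooth_on S f \<Longrightarrow> smooth_on S h \<Longrightarrow>
    smooth_on S (\<lambda>x. b (f x) (h x))"
  unfolding smooth_on_def by (simp add: k_smooth_on_bilinear)

lemma smooth_on_compose:
  fixes f :: "'a::real_normed_vector \<Rightarrow> 'b::euclidean_space"
  assumes "smooth_on T g" "smooth_on S f" "open S" "open T" "f ` S \<subseteq> T"
  shows "smooth_on S (\<lambda>x. g (f x))"
  unfolding smooth_on_def
  using k_smooth_on_compose[OF assms(3,4,5)] assms(1,2)[unfolded smooth_on_def] by blast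

lemma smooth_on_mult:
  fixes f h :: "'a::real_normed_vector \<Rightarrow> real"
  shows "open S \<Longrightarrow> smooth_on S f \<Longrightarrow> smooth_on S h \<Longrightarrow> smooth_on S (\<lambda>x. f x * h x)"
  by (rule smooth_on_bilinear[OF _ bounded_bilinear_mult])

lemma smooth_on_exp:
  "open S \<Longrightarrow> smooth_on S f \<Longrightarrow> smooth_on S (\<lambda>x. exp (f x :: real))"
  by (rule smooth_on_compose[where T=UNIV]) (auto simp: smooth_on_def k_smooth_on_exp)

lemma smooth_on_inverse:
  assumes "open S" "smooth_on S f" "\<And>x. x \<in> S \<Longrightarrow> f x \<noteq> (0::real)"
  shows "smooth_on S (\<lambda>x. inverse (f x))"
  by (rule smooth_on_compose[where T="-{0}"]) (use assms in \<open>auto simp: smooth_on_def k_smooth_on_inverse\<close>)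

lemma smooth_on_prod:
  assumes "open S" "\<And>i. i \<in> I \<Longrightarrow> smooth_on S (f i :: 'a::real_normed_vector \<Rightarrow> real)"
  shows "smooth_on S (\<lambda>x. \<Prod>i\<in>I. f i x)"
  using assms(2)
proof (induction I rule: infinite_finite_induct)
  case (insert i I)
  have "smooth_on S (\<lambda>x. f i x * (\<Prod>i\<in>I. f i x))"
    by (rule smooth_on_mult[OF assms(1)]) (use insert in auto)
  then show ?case using insert by simp
qed (simp_all add: smooth_on_const assms(1))

lemma smooth_on_nth:
  fixes f :: "'a::real_normed_vector \<Rightarrow> real^'n"
  shows "open S \<Longrightarrow> smooth_on S f \<Longrightarrow> smooth_on S (\<lambda>x. f x $ i)"
  by (rule smooth_on_bounded_linear[OF _ bounded_linear_vec_nth])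

lemma smooth_on_vec:
  fixes f :: "'a::real_normed_vector \<Rightarrow> real^'n"
  assumes "open S" "\<And>i. smooth_on S (\<lambda>x. f x $ i)"
  shows "smooth_on S f"
proof (rule smooth_on_cong[OF _ assms(1)])
  show "smooth_on S (\<lambda>x. \<Sum>i\<in>UNIV. (f x $ i) *\<^sub>R axis i 1)"
    by (rule smooth_on_sum[OF assms(1)],
        rule smooth_on_bounded_linear[OF assms(1) bounded_linear_scaleR_left assms(2)])
  show "(\<Sum>i\<in>UNIV. (f x $ i) *\<^sub>R axis i 1) = f x" for x
    by (simp add: vec_eq_iff axis_def if_distrib[of "(*) _"] cong: if_cong)
qed

lemma smooth_on_Pair:
  fixes f :: "'a::real_normed_vector \<Rightarrow> 'b::euclidean_space" and h :: "'a \<Rightarrow> 'c::euclidean_space"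
  assumes "open S" "smooth_on S f" "smooth_on S h"
  shows "smooth_on S (\<lambda>x. (f x, h x))"
proof -
  have "bounded_linear (\<lambda>x::'b. (x, 0::'c))" "bounded_linear (\<lambda>x::'c. (0::'b, x))"
    by (simp_all add: bounded_linear_Pair bounded_linear_ident bounded_linear_zero)
  from smooth_on_bounded_linear[OF assms(1) this(1) assms(2)]
    smooth_on_bounded_linear[OF assms(1) this(2) assms(3)]
  have "smooth_on S (\<lambda>x. (f x, 0) + (0, h x))"
    using smooth_on_add[OF assms(1)] by blast
  then show ?thesis by simp
qed

section \<open>Closed one-forms and coordinates adapted to a frame\<close>

abbreviation dir_deriv :: "('a::real_normed_vector \<Rightarrow> 'b::real_normed_vector) \<Rightarrow> 'a \<Rightarrow> 'a \<Rightarrow> 'b" where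
  "dir_deriv f x v \<equiv> frechet_derivative f (at x) v"

lemma smooth_on_linear_dir_deriv:
  "smooth_on S f \<Longrightarrow> x \<in> S \<Longrightarrow> linear (dir_deriv f x)"
  using smooth_on_derivative has_derivative_linear by blast

lemma dir_deriv_eq: "(f has_derivative f') (at x) \<Longrightarrow> dir_deriv f x v = f' v"
  using frechet_derivative_at by metis

text \<open>
  The Poincare lemma on a ball, with one-forms written as vector fields. The potential is the integral
  of \<open>\<omega>\<close> along rays. By symmetry of the derivative of \<open>\<omega>\<close>, differentiation under the integral sign
  produces the \<open>t\<close>-derivative of \<open>t * (\<omega> (c + t(x - c)) \<bullet> v)\<close>, which integrates to \<open>\<omega> x \<bullet> v\<close>. The potential
  is smooth because its derivative is.
\<close>
lemma closed_form_potential: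
  fixes \<omega> :: "'a::euclidean_space \<Rightarrow> 'a"
  assumes sm: "smooth_on (ball c r) \<omega>"
    and sym: "\<And>x u v. x \<in> ball c r \<Longrightarrow> dir_deriv \<omega> x u \<bullet> v = dir_deriv \<omega> x v \<bullet> u"
  obtains f where "smooth_on (ball c r) f" "f c = 0"
    "\<And>x. x \<in> ball c r \<Longrightarrow> (f has_derivative (\<lambda>v. \<omega> x \<bullet> v)) (at x)"
proof -
  define S where "S = ball c r"
  define y where "y = (\<lambda>x t. c + t *\<^sub>R (x - c))"
  define W where "W = (\<lambda>x t. t *\<^sub>R dir_deriv \<omega> (y x t) (x - c) + \<omega> (y x t))"
  define f where "f = (\<lambda>x. integral (cbox 0 1) (\<lambda>t. \<omega> (y x t) \<bullet> (x - c)))"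
  have yS: "y x t \<in> S" if "x \<in> S" "t \<in> cbox 0 1" for x t
  proof -
    have "dist c (y x t) = \<bar>t\<bar> * dist c x"
      by (simp add: y_def dist_norm norm_minus_commute)
    also have "\<dots> \<le> dist c x" using that by (auto intro: mult_left_le_one_le)
    finally show ?thesis using that by (simp add: S_def)
  qed
  have dw: "(\<omega> has_derivative dir_deriv \<omega> x) (at x)" if "x \<in> S" for x
    using smooth_on_derivative[OF sm] that by (simp add: S_def)
  have cy: "continuous_on (S \<times> cbox 0 1) (\<lambda>(x, t). y x t)"
    unfolding y_def split_beta by (intro continuous_intros)
  have yim: "(\<lambda>(x, t). y x t) ` (S \<times> cbox 0 1) \<subseteq> S" using yS by auto
  have cw: "continuous_on (S \<times> cbox 0 1) (\<lambda>(x, t). \<omega> (y x t))"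
    using continuous_on_compose2[OF smooth_on_continuous[OF sm, folded S_def] cy yim]
    by (simp add: split_beta)
  have cd: "continuous_on (S \<times> cbox 0 1) (\<lambda>(x, t). dir_deriv \<omega> (y x t) b)" for b
    using continuous_on_compose2[OF smooth_on_continuous[OF smooth_on_frechet[OF sm], folded S_def] cy yim]
    by (simp add: split_beta)
  have exp: "dir_deriv \<omega> (y x t) v = (\<Sum>b\<in>Basis. (v \<bullet> b) *\<^sub>R dir_deriv \<omega> (y x t) b)"
    if "x \<in> S" "t \<in> cbox 0 1" for x t v
    using has_derivative_basis_expansion[OF dw[OF yS[OF that]]] .
  have "continuous_on (S \<times> cbox 0 1) (\<lambda>(x, t). t *\<^sub>R (\<Sum>b\<in>Basis. ((x - c) \<bullet> b) *\<^sub>R dir_deriv \<omega> (y x t) b) + \<omega> (y x t))"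
    using cd cw unfolding split_beta by (intro continuous_intros) auto
  then have cW: "continuous_on (S \<times> cbox 0 1) (\<lambda>(x, t). W x t)"
    by (rule continuous_on_eq) (auto simp: W_def exp)
  have cWB: "continuous_on (S \<times> cbox 0 1) (\<lambda>(x, t). blinfun_inner_right (W x t))"
    using bounded_linear.continuous_on[OF bounded_linear_blinfun_inner_right cW]
    by (simp add: split_beta)
  have conv: "convex S" "open S" by (auto simp: S_def)
  have cP: "continuous_on (cbox 0 1) (Pair x :: real \<Rightarrow> 'a \<times> real)" for x
    by (rule continuous_on_Pair[OF continuous_on_const continuous_on_id])
  have der: "(f has_derivative integral (cbox 0 1) (\<lambda>t. blinfun_inner_right (W x t))) (at x)"
    if x: "x \<in> S" for x
  proof -
    have "(f has_derivative integral (cbox 0 1) (\<lambda>t. blinfun_inner_right (W x t))) (at x within S)"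
      unfolding f_def
    proof (rule leibniz_rule[OF _ _ cWB x conv(1)])
      fix x t assume x: "x \<in> S" and t: "t \<in> cbox (0::real) 1"
      have "((\<lambda>x. \<omega> (y x t) \<bullet> (x - c)) has_derivative
          (\<lambda>v. \<omega> (y x t) \<bullet> v + dir_deriv \<omega> (y x t) (t *\<^sub>R v) \<bullet> (x - c))) (at x)"
      proof -
        have "((\<lambda>x. y x t) has_derivative (\<lambda>v. t *\<^sub>R v)) (at x)"
          unfolding y_def by (auto intro!: derivative_eq_intros)
        note 1 = has_derivative_compose[OF this dw[OF yS[OF x t]]]
        have 2: "((\<lambda>x. x - c) has_derivative (\<lambda>v. v)) (at x)"
          by (auto intro!: derivative_eq_intros)
        show ?thesis using has_derivative_inner[OF 1 2] .
      qed
      moreover have "\<omega> (y x t) \<bullet> v + dir_deriv \<omega> (y x t) (t *\<^sub>R v) \<bullet> (x - c) = W x t \<bullet> v" for v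
      proof -
        have "dir_deriv \<omega> (y x t) (t *\<^sub>R v) \<bullet> (x - c) = t * (dir_deriv \<omega> (y x t) v \<bullet> (x - c))"
          using linear_cmul[OF has_derivative_linear[OF dw[OF yS[OF x t]]]] by simp
        also have "\<dots> = t * (dir_deriv \<omega> (y x t) (x - c) \<bullet> v)"
          using sym yS[OF x t] by (simp add: S_def)
        finally show ?thesis by (simp add: W_def inner_add_left)
      qed
      ultimately show "((\<lambda>x. \<omega> (y x t) \<bullet> (x - c)) has_derivative blinfun_apply (blinfun_inner_right (W x t))) (at x within S)"
        by (simp add: has_derivative_at_withinI)
    next
      fix x assume x: "x \<in> S"
      have "continuous_on (cbox 0 1) (\<lambda>t. \<omega> (y x t))"
        using continuous_on_compose2[OF cw cP] x by auto
      then show "(\<lambda>t. \<omega> (y x t) \<bullet> (x - c)) integrable_on cbox 0 1"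
        by (intro integrable_continuous continuous_on_inner continuous_on_const)
    qed
    then show ?thesis unfolding at_within_open[OF x conv(2)] .
  qed
  have val: "blinfun_apply (integral (cbox 0 1) (\<lambda>t. blinfun_inner_right (W x t))) v = \<omega> x \<bullet> v"
    if x: "x \<in> S" for x v
  proof -
    have "continuous_on (cbox 0 1) (\<lambda>t. blinfun_inner_right (W x t))"
      using continuous_on_compose2[OF cWB cP] x by auto
    then have "blinfun_apply (integral (cbox 0 1) (\<lambda>t. blinfun_inner_right (W x t))) v
        = integral (cbox 0 1) (\<lambda>t. W x t \<bullet> v)"
      by (subst blinfun_apply_integral[OF integrable_continuous]) simp_all
    moreover have "((\<lambda>t. W x t \<bullet> v) has_integral 1 * (\<omega> (y x 1) \<bullet> v) - 0 * (\<omega> (y x 0) \<bullet> v)) {0..1}"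
    proof (rule fundamental_theorem_of_calculus)
      fix t :: real assume t: "t \<in> {0..1}"
      then have yt: "y x t \<in> S" using yS x by simp
      have "((\<lambda>t. t * (\<omega> (y x t) \<bullet> v)) has_derivative
          (\<lambda>s. s * (\<omega> (y x t) \<bullet> v) + t * (dir_deriv \<omega> (y x t) (s *\<^sub>R (x - c)) \<bullet> v))) (at t)"
      proof -
        have "((\<lambda>t. y x t) has_derivative (\<lambda>s. s *\<^sub>R (x - c))) (at t)"
          unfolding y_def by (auto intro!: derivative_eq_intros)
        note has_derivative_compose[OF this dw[OF yt]]
        from has_derivative_mult[OF has_derivative_ident has_derivative_inner_left[OF this, of v]]
        show ?thesis by (simp add: add.commute)
      qed
      moreover have "s * (\<omega> (y x t) \<bullet> v) + t * (dir_deriv \<omega> (y x t) (s *\<^sub>R (x - c)) \<bullet> v)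
          = s *\<^sub>R (W x t \<bullet> v)" for s
        unfolding linear_cmul[OF has_derivative_linear[OF dw[OF yt]]]
        by (simp add: W_def inner_add_left ring_distribs)
      ultimately show "((\<lambda>t. t * (\<omega> (y x t) \<bullet> v)) has_vector_derivative W x t \<bullet> v) (at t within {0..1})"
        unfolding has_vector_derivative_def by (simp add: has_derivative_at_withinI)
    qed simp
    ultimately show ?thesis using has_integral_iff by (auto simp: y_def)
  qed
  have D: "(f has_derivative (\<lambda>v. \<omega> x \<bullet> v)) (at x)" if "x \<in> S" for x
  proof -
    have "blinfun_apply (integral (cbox 0 1) (\<lambda>t. blinfun_inner_right (W x t))) = (\<lambda>v. \<omega> x \<bullet> v)"
      using val[OF that] by auto
    then show ?thesis using der[OF that] by metis
  qed
  have "smooth_on S f"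
    by (rule smooth_onI_derivative[OF conv(2) D])
      (auto intro: smooth_on_bounded_linear[OF conv(2) bounded_linear_inner_left sm[folded S_def]])
  moreover have "f c = 0" by (simp add: f_def)
  ultimately show thesis using that D by (simp add: S_def)
qed

text \<open>
  A function with prescribed derivatives \<open>u i\<close> along a frame \<open>M\<close> whose brackets have the constant
  coefficients \<open>C\<close>. The one-form \<open>\<omega>\<close> with \<open>\<omega>(M i) = u i\<close> is smooth by Cramer's rule, and the last
  hypothesis is \<open>d\<omega>(M i, M j) = 0\<close>. The hypothesis on \<open>w\<close> says that the fields span at every point.
\<close>
lemma frame_potential:
  fixes M :: "3 \<Rightarrow> real^3 \<Rightarrow> real^3" and u :: "3 \<Rightarrow> real^3 \<Rightarrow> real" and C :: "3 \<Rightarrow> 3 \<Rightarrow> real^3"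
  assumes smM: "\<And>i. smooth_on (ball c r) (M i)" and smu: "\<And>i. smooth_on (ball c r) (u i)"
    and nd: "\<And>x w. x \<in> ball c r \<Longrightarrow> (\<And>i. M i x \<bullet> w = 0) \<Longrightarrow> w = 0"
    and br: "\<And>x i j. x \<in> ball c r \<Longrightarrow>
      dir_deriv (M j) x (M i x) - dir_deriv (M i) x (M j x) = (\<Sum>k\<in>UNIV. (C i j $ k) *\<^sub>R M k x)"
    and cl: "\<And>x i j. x \<in> ball c r \<Longrightarrow>
      dir_deriv (u j) x (M i x) - dir_deriv (u i) x (M j x) = (\<Sum>k\<in>UNIV. C i j $ k * u k x)"
  obtains f where "smooth_on (ball c r) f" "f c = 0"
    "\<And>x i. x \<in> ball c r \<Longrightarrow> dir_deriv f x (M i x) = u i x"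
proof -
  define S where "S = ball c r"
  have S: "open S" by (simp add: S_def)
  define B where "B = (\<lambda>x. (\<chi> i j. M i x $ j) :: real^3^3)"
  define \<omega> where "\<omega> = (\<lambda>x. (\<chi> k. det (\<chi> i j. if j = k then u i x else B x $ i $ j) / det (B x)) :: real^3)"
  have Bw: "(B x *v w) $ i = M i x \<bullet> w" for x w i
    by (simp add: B_def matrix_vector_mult_def inner_vec_def)
  have detB: "det (B x) \<noteq> 0" if "x \<in> S" for x
  proof -
    have "B x *v w = 0 \<Longrightarrow> w = 0" for w
      using nd[of x w] that Bw[of x w] by (simp add: S_def)
    then have "\<exists>A. A ** B x = mat 1" using matrix_left_invertible_ker by blast
    then show ?thesis by (metis invertible_left_inverse invertible_det_nz)
  qed
  have w: "M i x \<bullet> \<omega> x = u i x" if "x \<in> S" for x i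
  proof -
    have "B x *v \<omega> x = (\<chi> i. u i x)"
      unfolding cramer[OF detB[OF that]] by (simp add: \<omega>_def cong: if_cong)
    then show ?thesis using Bw by (metis vec_lambda_beta)
  qed
  have smMs: "smooth_on S (\<lambda>x. M i x $ j)" for i j
    using smooth_on_nth[OF S smM[folded S_def]] .
  have smdet: "smooth_on S (\<lambda>x. det (A x))" if "\<And>i j. smooth_on S (\<lambda>x. A x $ i $ j)" for A :: "real^3 \<Rightarrow> real^3^3"
    unfolding det_def
    by (intro smooth_on_sum[OF S] smooth_on_mult[OF S smooth_on_const[OF S]] smooth_on_prod[OF S] that)
  have sm\<omega>: "smooth_on S \<omega>"
  proof (rule smooth_on_vec[OF S])
    fix k
    have "smooth_on S (\<lambda>x. (\<chi> i j. if j = k then u i x else B x $ i $ j) $ i $ j)" for i j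
      using smMs smu by (cases "j = k") (simp_all add: B_def S_def)
    moreover have "smooth_on S (\<lambda>x. inverse (det (B x)))"
      by (rule smooth_on_inverse[OF S smdet detB]) (simp add: B_def smMs)
    ultimately have "smooth_on S (\<lambda>x. det (\<chi> i j. if j = k then u i x else B x $ i $ j) * inverse (det (B x)))"
      by (intro smooth_on_mult[OF S] smdet)
    then show "smooth_on S (\<lambda>x. \<omega> x $ k)"
      by (simp add: \<omega>_def divide_inverse)
  qed
  have lin: "linear (dir_deriv \<omega> x)" if "x \<in> S" for x
    using smooth_on_linear_dir_deriv[OF sm\<omega> that] .
  have du: "dir_deriv (u i) x v = dir_deriv (M i) x v \<bullet> \<omega> x + M i x \<bullet> dir_deriv \<omega> x v"
    if x: "x \<in> S" for x i v
  proof -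
    have "((\<lambda>x. M i x \<bullet> \<omega> x) has_derivative
        (\<lambda>v. M i x \<bullet> dir_deriv \<omega> x v + dir_deriv (M i) x v \<bullet> \<omega> x)) (at x)"
      using smooth_on_derivative[OF smM, of x i] smooth_on_derivative[OF sm\<omega> x] x
      by (intro has_derivative_inner) (auto simp: S_def)
    then have "(u i has_derivative
        (\<lambda>v. M i x \<bullet> dir_deriv \<omega> x v + dir_deriv (M i) x v \<bullet> \<omega> x)) (at x)"
      using has_derivative_transform_within_open[OF _ S x] w by blast
    from dir_deriv_eq[OF this, of v] show ?thesis by simp
  qed
  have symM: "M i x \<bullet> dir_deriv \<omega> x (M j x) = M j x \<bullet> dir_deriv \<omega> x (M i x)" if x: "x \<in> S" for x i j
  proof -
    have "(dir_deriv (M j) x (M i x) - dir_deriv (M i) x (M j x)) \<bullet> \<omega> x = (\<Sum>k\<in>UNIV. C i j $ k * u k x)"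
      using br[of x j i] x w[OF x] by (simp add: S_def inner_sum_left)
    then show ?thesis using cl[of x j i] x du[OF x] by (simp add: S_def inner_diff_left)
  qed
  \<comment> \<open>The adjoint of the derivative agrees with it first on the spanning fields, then everywhere.\<close>
  have sym: "dir_deriv \<omega> x a \<bullet> b = dir_deriv \<omega> x b \<bullet> a" if x: "x \<in> S" for x a b
  proof -
    let ?L = "dir_deriv \<omega> x"
    have adj: "?L p \<bullet> q = p \<bullet> adjoint ?L q" for p q
      using adjoint_works[OF lin[OF x]] by metis
    have 1: "?L (M j x) = adjoint ?L (M j x)" for j
    proof -
      have "M i x \<bullet> (?L (M j x) - adjoint ?L (M j x)) = 0" for i
        using symM[OF x, of i j] adj[of "M i x" "M j x"] by (simp add: inner_diff_right inner_commute)
      then show ?thesis using nd[of x "?L (M j x) - adjoint ?L (M j x)"] x by (simp add: S_def)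
    qed
    have "M j x \<bullet> (?L b - adjoint ?L b) = 0" for j
      using 1[of j] adj[of b "M j x"] adj[of "M j x" b]
      by (simp add: inner_diff_right inner_commute)
    then have "?L b = adjoint ?L b" using nd[of x "?L b - adjoint ?L b"] x by (simp add: S_def)
    then show ?thesis using adj[of a b] by (simp add: inner_commute)
  qed
  obtain f where f: "smooth_on S f" "f c = 0" "\<And>x. x \<in> S \<Longrightarrow> (f has_derivative (\<lambda>v. \<omega> x \<bullet> v)) (at x)"
    using closed_form_potential[OF sm\<omega>[unfolded S_def] sym[unfolded S_def]] unfolding S_def by blast
  show thesis
  proof (rule that[OF f(1,2)[unfolded S_def]])
    show "dir_deriv f x (M i x) = u i x" if "x \<in> ball c r" for x i
      using dir_deriv_eq[OF f(3)] w that by (simp add: S_def inner_commute)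
  qed
qed

text \<open>
  Bootstrapping: if \<open>h\<close> is \<open>k\<close> times differentiable, then so is its derivative \<open>N v \<circ> h\<close>.
\<close>
lemma smooth_on_ode_solution:
  fixes h :: "'a::real_normed_vector \<Rightarrow> 'b::euclidean_space" and N :: "'a \<Rightarrow> 'b \<Rightarrow> 'b"
  assumes "open V" "open U" "h ` V \<subseteq> U" "\<And>v. smooth_on U (N v)"
    and d: "\<And>y. y \<in> V \<Longrightarrow> (h has_derivative (\<lambda>v. N v (h y))) (at y)"
  shows "smooth_on V h"
proof -
  have "k_smooth_on k V h" for k
  proof (induction k)
    case 0
    show ?case unfolding k_smooth_on.simps
      by (rule continuous_at_imp_continuous_on) (use d has_derivative_continuous in blast)
  next
    case (Suc k)
    have "\<And>v. k_smooth_on k V (\<lambda>y. N v (h y))"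
      using k_smooth_on_compose[OF assms(1-3) Suc] assms(4) unfolding smooth_on_def by blast
    from k_smooth_on_SucI[OF assms(1) d this] show ?case .
  qed
  then show ?thesis by (simp add: smooth_on_def)
qed


lemma dir_deriv_const [simp]: "dir_deriv (\<lambda>x. k) x v = 0"
  using dir_deriv_eq[OF has_derivative_const] .

lemma dir_deriv_exp_scale:
  fixes t :: "'a::real_normed_vector \<Rightarrow> real"
  assumes "smooth_on S t" "x \<in> S"
  shows "dir_deriv (\<lambda>x. exp (k * t x)) x v = k * dir_deriv t x v * exp (k * t x)"
proof (rule dir_deriv_eq)
  show "((\<lambda>x. exp (k * t x)) has_derivative (\<lambda>v. k * dir_deriv t x v * exp (k * t x))) (at x)"
    by (rule derivative_eq_intros smooth_on_derivative[OF assms] refl | simp)+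
qed

text \<open>
  For the coframe \<open>\<omega>\<^sub>1, \<omega>\<^sub>2, \<omega>\<^sub>3\<close> dual to \<open>X, Y, Z\<close> the brackets say \<open>d\<omega>\<^sub>1 = 0\<close>, \<open>d\<omega>\<^sub>2 = - \<omega>\<^sub>1 \<and> \<omega>\<^sub>2\<close> and
  \<open>d\<omega>\<^sub>3 = \<omega>\<^sub>1 \<and> \<omega>\<^sub>3\<close>. With \<open>\<omega>\<^sub>1 = dt\<close>, the forms \<open>exp t \<omega>\<^sub>2\<close> and \<open>exp (- t) \<omega>\<^sub>3\<close> are closed as well. The
  components of \<open>F\<close> are \<open>t\<close> and potentials of these two forms; thus \<open>F\<close> carries \<open>X, Y, Z\<close> to the
  left-invariant fields of \<open>E(1,1)\<close>.
\<close>
lemma E11_coordinates: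
  fixes X Y Z :: "real^3 \<Rightarrow> real^3"
  assumes smX: "smooth_on (ball c r) X" and smY: "smooth_on (ball c r) Y" and smZ: "smooth_on (ball c r) Z"
    and nd: "\<And>x w. x \<in> ball c r \<Longrightarrow> X x \<bullet> w = 0 \<Longrightarrow> Y x \<bullet> w = 0 \<Longrightarrow> Z x \<bullet> w = 0 \<Longrightarrow> w = 0"
    and XY: "\<And>x. x \<in> ball c r \<Longrightarrow> dir_deriv Y x (X x) - dir_deriv X x (Y x) = Y x"
    and XZ: "\<And>x. x \<in> ball c r \<Longrightarrow> dir_deriv Z x (X x) - dir_deriv X x (Z x) = - Z x"
    and YZ: "\<And>x. x \<in> ball c r \<Longrightarrow> dir_deriv Z x (Y x) - dir_deriv Y x (Z x) = 0"
  obtains F :: "real^3 \<Rightarrow> real^3" where "smooth_on (ball c r) F" "F c = 0"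
    "\<And>x. x \<in> ball c r \<Longrightarrow> dir_deriv F x (X x) = vector [1, 0, 0]"
    "\<And>x. x \<in> ball c r \<Longrightarrow> dir_deriv F x (Y x) = vector [0, exp (F x $ 1), 0]"
    "\<And>x. x \<in> ball c r \<Longrightarrow> dir_deriv F x (Z x) = vector [0, 0, exp (- F x $ 1)]"
proof -
  define M :: "3 \<Rightarrow> real^3 \<Rightarrow> real^3" where "M = (\<lambda>i. if i = 1 then X else if i = 2 then Y else Z)"
  define C :: "3 \<Rightarrow> 3 \<Rightarrow> real^3" where
    "C = (\<lambda>i j. if i = 1 \<and> j = 2 then vector [0, 1, 0] else if i = 2 \<and> j = 1 then vector [0, -1, 0]
      else if i = 1 \<and> j = 3 then vector [0, 0, -1] else if i = 3 \<and> j = 1 then vector [0, 0, 1] else 0)"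
  have M [simp]: "M 1 = X" "M 2 = Y" "M 3 = Z" by (simp_all add: M_def)
  have smM: "smooth_on (ball c r) (M i)" for i
    using exhaust_3[of i] smX smY smZ by auto
  have ndM: "w = 0" if "x \<in> ball c r" "\<And>i. M i x \<bullet> w = 0" for x w
    using nd[OF that(1)] that(2)[of 1] that(2)[of 2] that(2)[of 3] by simp
  have br: "dir_deriv (M j) x (M i x) - dir_deriv (M i) x (M j x) = (\<Sum>k\<in>UNIV. (C i j $ k) *\<^sub>R M k x)"
    if x: "x \<in> ball c r" for x i j
    using exhaust_3[of i] exhaust_3[of j] XY[OF x] XZ[OF x] YZ[OF x]
    by (auto simp: C_def sum_3 algebra_simps)
  have pot: thesis' if "\<And>i. smooth_on (ball c r) (u i)"
    and "\<And>x i j. x \<in> ball c r \<Longrightarrow>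
      dir_deriv (u j) x (M i x) - dir_deriv (u i) x (M j x) = (\<Sum>k\<in>UNIV. C i j $ k * u k x)"
    and "\<And>f. smooth_on (ball c r) f \<Longrightarrow> f c = 0 \<Longrightarrow>
      (\<And>x i. x \<in> ball c r \<Longrightarrow> dir_deriv f x (M i x) = u i x) \<Longrightarrow> thesis'"
    for u :: "3 \<Rightarrow> real^3 \<Rightarrow> real" and thesis'
    by (rule frame_potential[OF smM that(1) ndM br that(2)]) (use that(3) in blast)+
  define u1 :: "3 \<Rightarrow> real^3 \<Rightarrow> real" where "u1 = (\<lambda>i x. if i = 1 then 1 else 0)"
  obtain t where t: "smooth_on (ball c r) t" "t c = 0"
    "\<And>x i. x \<in> ball c r \<Longrightarrow> dir_deriv t x (M i x) = u1 i x"
  proof (rule pot[of u1])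
    show "smooth_on (ball c r) (u1 i)" for i
      unfolding u1_def by (simp add: smooth_on_const)
    fix x i j
    show "dir_deriv (u1 j) x (M i x) - dir_deriv (u1 i) x (M j x) = (\<Sum>k\<in>UNIV. C i j $ k * u1 k x)"
      by (simp add: u1_def C_def sum_3)
  qed (use that in blast)
  have tX: "dir_deriv t x (X x) = 1" and tY: "dir_deriv t x (Y x) = 0" and tZ: "dir_deriv t x (Z x) = 0"
    if "x \<in> ball c r" for x
    using t(3)[OF that, of 1] t(3)[OF that, of 2] t(3)[OF that, of 3] by (simp_all add: u1_def)
  have exp_potential: "\<exists>f. smooth_on (ball c r) f \<and> f c = 0 \<and>
      (\<forall>x\<in>ball c r. \<forall>i. dir_deriv f x (M i x) = (if i = j then exp (k * t x) else 0))"
    if jk: "j = 2 \<and> k = 1 \<or> j = 3 \<and> k = -1" for j :: 3 and k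
  proof -
    define u :: "3 \<Rightarrow> real^3 \<Rightarrow> real" where "u = (\<lambda>i x. if i = j then exp (k * t x) else 0)"
    obtain f where f: "smooth_on (ball c r) f" "f c = 0"
      "\<And>x i. x \<in> ball c r \<Longrightarrow> dir_deriv f x (M i x) = u i x"
    proof (rule pot[of u])
      have "smooth_on (ball c r) (\<lambda>x. exp (k * t x))"
        by (intro smooth_on_exp smooth_on_mult smooth_on_const t open_ball)
      then show "smooth_on (ball c r) (u i)" for i
        unfolding u_def by (cases "i = j") (simp_all add: smooth_on_const)
      fix x :: "real^3" and i l :: 3 assume x: "x \<in> ball c r"
      have "dir_deriv (u i) x v = (if i = j then k * dir_deriv t x v * exp (k * t x) else 0)" for i v
        using dir_deriv_exp_scale[OF t(1) x, of k v] by (cases "i = j") (simp_all add: u_def)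
      then show "dir_deriv (u l) x (M i x) - dir_deriv (u i) x (M l x) = (\<Sum>m\<in>UNIV. C i l $ m * u m x)"
        using exhaust_3[of i] exhaust_3[of l] tX[OF x] tY[OF x] tZ[OF x] jk
        by (auto simp: C_def sum_3 u_def)
    qed (use that in blast)
    then show ?thesis unfolding u_def by blast
  qed
  obtain a where a: "smooth_on (ball c r) a" "a c = 0"
    "\<And>x i. x \<in> ball c r \<Longrightarrow> dir_deriv a x (M i x) = (if i = 2 then exp (t x) else 0)"
    using exp_potential[of 2 1] by auto
  obtain b where b: "smooth_on (ball c r) b" "b c = 0"
    "\<And>x i. x \<in> ball c r \<Longrightarrow> dir_deriv b x (M i x) = (if i = 3 then exp (- t x) else 0)"
    using exp_potential[of 3 "-1"] by auto
  define F :: "real^3 \<Rightarrow> real^3" where "F = (\<lambda>x. vector [t x, a x, b x])"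
  have smF: "smooth_on (ball c r) F"
  proof (rule smooth_on_vec[OF open_ball])
    show "smooth_on (ball c r) (\<lambda>x. F x $ i)" for i
      using exhaust_3[of i] t(1) a(1) b(1) by (auto simp: F_def)
  qed
  have dF: "dir_deriv F x v = vector [dir_deriv t x v, dir_deriv a x v, dir_deriv b x v]"
    if x: "x \<in> ball c r" for x v
  proof -
    have "dir_deriv F x v $ i = dir_deriv (\<lambda>x. F x $ i) x v" for i
      using dir_deriv_eq[OF bounded_linear.has_derivative[OF bounded_linear_vec_nth
            smooth_on_derivative[OF smF x]]] by simp
    then show ?thesis by (simp add: vec_eq_iff forall_3 F_def)
  qed
  show thesis
  proof (rule that[OF smF])
    show "F c = 0" using t(2) a(2) b(2) by (simp add: F_def vec_eq_iff forall_3)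
    fix x assume x: "x \<in> ball c r"
    have F1: "F x $ 1 = t x" by (simp add: F_def)
    show "dir_deriv F x (X x) = vector [1, 0, 0]"
      using tX[OF x] a(3)[OF x, of 1] b(3)[OF x, of 1] by (simp add: dF[OF x])
    show "dir_deriv F x (Y x) = vector [0, exp (F x $ 1), 0]"
      using tY[OF x] a(3)[OF x, of 2] b(3)[OF x, of 2] by (simp add: dF[OF x] F1)
    show "dir_deriv F x (Z x) = vector [0, 0, exp (- F x $ 1)]"
      using tZ[OF x] a(3)[OF x, of 3] b(3)[OF x, of 3] by (simp add: dF[OF x] F1)
  qed
qed

text \<open>
  The field \<open>N v\<close> is the lift under \<open>F\<close> of the constant field \<open>v\<close>, so the local inverse \<open>h\<close> solves
  \<open>h' v = N v \<circ> h\<close> and inherits its smoothness from \<open>N\<close>.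
\<close>
lemma smooth_local_inverse:
  fixes F :: "'a::euclidean_space \<Rightarrow> 'a" and N :: "'a \<Rightarrow> 'a \<Rightarrow> 'a"
  assumes "open S" "c \<in> S" and smF: "smooth_on S F" and smN: "\<And>v. smooth_on S (N v)"
    and FN: "\<And>x v. x \<in> S \<Longrightarrow> dir_deriv F x (N v x) = v"
  obtains U V h where "open U" "c \<in> U" "U \<subseteq> S" "open V" "F c \<in> V"
    "homeomorphism U V F h" "smooth_on V h"
proof -
  have dF: "(F has_derivative dir_deriv F x) (at x)" if "x \<in> S" for x
    using smooth_on_derivative[OF smF that] .
  have bl: "blinfun_apply (Blinfun (dir_deriv F x)) = dir_deriv F x" if "x \<in> S" for x
    using has_derivative_bounded_linear[OF dF[OF that]] by (simp add: bounded_linear_Blinfun_apply)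
  have NF: "N (dir_deriv F x v) x = v" and linN: "linear (\<lambda>v. N v x)" if x: "x \<in> S" for x v
  proof -
    have lin: "linear (dir_deriv F x)" using smooth_on_linear_dir_deriv[OF smF x] .
    have "surj (dir_deriv F x)" using surjI[of _ "\<lambda>v. N v x"] FN[OF x] by blast
    then have inj: "inj (dir_deriv F x)" using lin linear_surjective_imp_injective by blast
    show "N (dir_deriv F x v) x = v" using FN[OF x] inj by (metis injD)
    show "linear (\<lambda>v. N v x)"
      by (rule linearI; rule injD[OF inj]) (simp_all add: FN[OF x] linear_add[OF lin] linear_cmul[OF lin])
  qed
  obtain U V h h' where UV: "open U" "U \<subseteq> S" "c \<in> U" "open V" "F c \<in> V" "homeomorphism U V F h"
    and dh: "\<And>y. y \<in> V \<Longrightarrow> (h has_derivative (h' y)) (at y)"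
    and h': "\<And>y. y \<in> V \<Longrightarrow> h' y = inv_into UNIV (blinfun_apply (Blinfun (dir_deriv F (h y))))"
  proof (rule inverse_function_theorem[OF \<open>open S\<close> _ _ \<open>c \<in> S\<close>])
    show "(F has_derivative blinfun_apply (Blinfun (dir_deriv F x))) (at x)" if "x \<in> S" for x
      using dF[OF that] bl[OF that] by simp
    show "continuous_on S (\<lambda>x. Blinfun (dir_deriv F x))"
    proof (rule continuous_on_blinfun_componentwise)
      fix i
      show "continuous_on S (\<lambda>x. blinfun_apply (Blinfun (dir_deriv F x)) i)"
        by (rule continuous_on_eq[OF smooth_on_continuous[OF smooth_on_frechet[OF smF, of i]]])
          (simp add: bl)
    qed
    show "Blinfun (\<lambda>v. N v c) o\<^sub>L Blinfun (dir_deriv F c) = id_blinfun"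
    proof (rule blinfun_eqI)
      fix v
      have "bounded_linear (\<lambda>v. N v c)" using linN[OF \<open>c \<in> S\<close>] by (simp add: linear_conv_bounded_linear)
      then show "blinfun_apply (Blinfun (\<lambda>v. N v c) o\<^sub>L Blinfun (dir_deriv F c)) v = blinfun_apply id_blinfun v"
        by (simp add: bl[OF \<open>c \<in> S\<close>] NF[OF \<open>c \<in> S\<close>] bounded_linear_Blinfun_apply)
    qed
  qed blast
  have hV: "h ` V \<subseteq> S" using UV(2,6) by (auto simp: homeomorphism_def)
  have "(h has_derivative (\<lambda>v. N v (h y))) (at y)" if y: "y \<in> V" for y
  proof -
    have hy: "h y \<in> S" using hV y by blast
    have "h' y v = N v (h y)" for v
    proof -
      have "h' y v = inv_into UNIV (dir_deriv F (h y)) v" using h'[OF y] bl[OF hy] by simp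
      also have "\<dots> = N v (h y)"
        using FN[OF hy] by (intro inv_f_eq injI) (metis NF[OF hy])+
      finally show ?thesis .
    qed
    then have "h' y = (\<lambda>v. N v (h y))" by blast
    then show ?thesis using dh[OF y] by metis
  qed
  then have "smooth_on V h"
    using smooth_on_ode_solution[OF UV(4) \<open>open S\<close> hV, of N] smN by blast
  then show thesis using that UV by blast
qed

section \<open>Smooth functions and tangent vectors on a manifold\<close>

locale smooth_manifold =
  fixes A :: "('m::topological_space, 'e::euclidean_space) atlas"
  assumes atlas: "smooth_atlas A"
begin

lemma chart_open: "(U, \<phi>) \<in> A \<Longrightarrow> open U"
  and chart_image_open: "(U, \<phi>) \<in> A \<Longrightarrow> open (\<phi> ` U)"
  and chart_homeomorphism: "(U, \<phi>) \<in> A \<Longrightarrow> homeomorphism U (\<phi> ` U) \<phi> (inv_into U \<phi>)"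
  and chart_transition: "(U, \<phi>) \<in> A \<Longrightarrow> (V, \<psi>) \<in> A \<Longrightarrow>
    smooth_on (\<phi> ` (U \<inter> V)) (\<psi> \<circ> inv_into U \<phi>)"
  using atlas unfolding smooth_atlas_def by fast+

lemma chart_around: obtains U \<phi> where "(U, \<phi>) \<in> A" "p \<in> U"
proof -
  have "p \<in> (\<Union>(U, \<phi>)\<in>A. U)" using atlas unfolding smooth_atlas_def by simp
  then show thesis using that by auto
qed

lemma chart_inv: "(U, \<phi>) \<in> A \<Longrightarrow> p \<in> U \<Longrightarrow> inv_into U \<phi> (\<phi> p) = p"
  using chart_homeomorphism homeomorphism_apply1 by metis

lemma chart_open_map:
  assumes "(U, \<phi>) \<in> A" "open W" "W \<subseteq> U"
  shows "open (\<phi> ` W)"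
proof -
  have "openin (top_of_set (\<phi> ` U)) (\<phi> ` W)"
    using homeomorphism_imp_open_map[OF chart_homeomorphism[OF assms(1)]] assms
    by (simp add: open_subset)
  then show ?thesis using chart_image_open[OF assms(1)] openin_open_eq by blast
qed

lemma chart_inv_open_map:
  assumes "(U, \<phi>) \<in> A" "open B" "B \<subseteq> \<phi> ` U"
  shows "open (inv_into U \<phi> ` B)"
proof -
  have "openin (top_of_set U) (inv_into U \<phi> ` B)"
    using homeomorphism_imp_open_map[OF homeomorphism_symD[OF chart_homeomorphism[OF assms(1)]]] assms
    by (simp add: open_subset)
  then show ?thesis using chart_open[OF assms(1)] openin_open_eq by blast
qed

lemma smooth_near_iff:
  "smooth_near A p f \<longleftrightarrow> (\<exists>U \<phi> W. (U, \<phi>) \<in> A \<and> open W \<and> p \<in> W \<and> W \<subseteq> U \<and>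
    smooth_on (\<phi> ` W) (f \<circ> inv_into U \<phi>))"
  by (simp add: smooth_near_def Bex_def)

lemma smooth_nearI:
  "(U, \<phi>) \<in> A \<Longrightarrow> open W \<Longrightarrow> p \<in> W \<Longrightarrow> W \<subseteq> U \<Longrightarrow> smooth_on (\<phi> ` W) (f \<circ> inv_into U \<phi>) \<Longrightarrow>
    smooth_near A p f"
  unfolding smooth_near_iff by (intro exI conjI)

text \<open>
  Smoothness near a point can be tested in any chart, because the transition maps are smooth.
\<close>
lemma smooth_near_chart:
  assumes "smooth_near A p f" "(U, \<phi>) \<in> A" "p \<in> U"
  obtains W where "open W" "p \<in> W" "W \<subseteq> U" "smooth_on (\<phi> ` W) (f \<circ> inv_into U \<phi>)"
proof -
  obtain V \<psi> W where V: "(V, \<psi>) \<in> A" and W: "open W" "p \<in> W" "W \<subseteq> V"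
    and sm: "smooth_on (\<psi> ` W) (f \<circ> inv_into V \<psi>)"
    using assms(1) unfolding smooth_near_iff by (elim exE conjE)
  let ?W = "W \<inter> U"
  have oW: "open ?W" using W chart_open[OF assms(2)] by blast
  have o: "open (\<phi> ` ?W)" "open (\<psi> ` W)"
    using chart_open_map[OF assms(2) oW] chart_open_map[OF V W(1,3)] by auto
  have tr: "smooth_on (\<phi> ` ?W) (\<psi> \<circ> inv_into U \<phi>)"
    by (rule smooth_on_subset[OF chart_transition[OF assms(2) V]]) (use W in blast)
  have "smooth_on (\<phi> ` ?W) (\<lambda>x. (f \<circ> inv_into V \<psi>) ((\<psi> \<circ> inv_into U \<phi>) x))"
    by (rule smooth_on_compose[OF sm tr o]) (auto simp: chart_inv[OF assms(2)])
  then have "smooth_on (\<phi> ` ?W) (f \<circ> inv_into U \<phi>)"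
  proof (rule smooth_on_cong[OF _ o(1)])
    fix x assume "x \<in> \<phi> ` ?W"
    then obtain q where q: "q \<in> W" "q \<in> U" "x = \<phi> q" by blast
    then have "q \<in> V" using W by blast
    with q show "(f \<circ> inv_into V \<psi>) ((\<psi> \<circ> inv_into U \<phi>) x) = (f \<circ> inv_into U \<phi>) x"
      by (simp add: chart_inv[OF assms(2)] chart_inv[OF V])
  qed
  then show thesis using that[OF oW] W assms(3) by blast
qed

lemma smooth_near_cong:
  assumes "smooth_near A p f" "open W" "p \<in> W" "\<And>q. q \<in> W \<Longrightarrow> f q = h q"
  shows "smooth_near A p h"
proof -
  obtain U \<phi> where U: "(U, \<phi>) \<in> A" "p \<in> U" using chart_around .
  obtain V where V: "open V" "p \<in> V" "V \<subseteq> U" "smooth_on (\<phi> ` V) (f \<circ> inv_into U \<phi>)"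
    using smooth_near_chart[OF assms(1) U] .
  let ?W = "V \<inter> W"
  have W: "open ?W" "?W \<subseteq> U" using V assms by auto
  have o: "open (\<phi> ` ?W)" using chart_open_map[OF U(1) W] .
  show ?thesis
  proof (rule smooth_nearI[OF U(1) W(1) _ W(2)])
    have "smooth_on (\<phi> ` ?W) (f \<circ> inv_into U \<phi>)"
      by (rule smooth_on_subset[OF V(4)]) blast
    then show "smooth_on (\<phi> ` ?W) (h \<circ> inv_into U \<phi>)"
    proof (rule smooth_on_cong[OF _ o])
      fix x assume "x \<in> \<phi> ` ?W"
      then obtain q where "q \<in> W" "q \<in> U" "x = \<phi> q" using W by blast
      then show "(f \<circ> inv_into U \<phi>) x = (h \<circ> inv_into U \<phi>) x"
        using assms(4) by (simp add: chart_inv[OF U(1)])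
    qed
  qed (use V assms in blast)
qed

lemma smooth_near_const: "smooth_near A p (\<lambda>q. k)"
proof -
  obtain U \<phi> where U: "(U, \<phi>) \<in> A" "p \<in> U" using chart_around .
  show ?thesis
    by (rule smooth_nearI[OF U(1) chart_open[OF U(1)] U(2) subset_refl])
      (simp add: comp_def smooth_on_const chart_image_open[OF U(1)])
qed

lemma smooth_near_binary:
  assumes "smooth_near A p f" "smooth_near A p h"
    and H: "\<And>S f h. open S \<Longrightarrow> smooth_on S f \<Longrightarrow> smooth_on S h \<Longrightarrow> smooth_on S (\<lambda>x::'e. H (f x) (h x))"
  shows "smooth_near A p (\<lambda>q. H (f q) (h q))"
proof -
  obtain U \<phi> where U: "(U, \<phi>) \<in> A" "p \<in> U" using chart_around .
  obtain V where V: "open V" "p \<in> V" "V \<subseteq> U" "smooth_on (\<phi> ` V) (f \<circ> inv_into U \<phi>)"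
    using smooth_near_chart[OF assms(1) U] .
  obtain W where W: "open W" "p \<in> W" "W \<subseteq> U" "smooth_on (\<phi> ` W) (h \<circ> inv_into U \<phi>)"
    using smooth_near_chart[OF assms(2) U] .
  have VW: "open (V \<inter> W)" "V \<inter> W \<subseteq> U" using V W by auto
  have o: "open (\<phi> ` (V \<inter> W))" using chart_open_map[OF U(1) VW] .
  have s: "smooth_on (\<phi> ` (V \<inter> W)) (f \<circ> inv_into U \<phi>)" "smooth_on (\<phi> ` (V \<inter> W)) (h \<circ> inv_into U \<phi>)"
    by (rule smooth_on_subset[OF V(4)], blast) (rule smooth_on_subset[OF W(4)], blast)
  show ?thesis
    by (rule smooth_nearI[OF U(1) VW(1) _ VW(2)]) (use V W H[OF o s] in \<open>simp_all add: comp_def\<close>)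
qed

lemma smooth_near_add: "smooth_near A p f \<Longrightarrow> smooth_near A p h \<Longrightarrow> smooth_near A p (\<lambda>q. f q + h q)"
  by (rule smooth_near_binary[where H = "(+)"]) (assumption | rule smooth_on_add)+

lemma smooth_near_mult: "smooth_near A p f \<Longrightarrow> smooth_near A p h \<Longrightarrow> smooth_near A p (\<lambda>q. f q * h q)"
  by (rule smooth_near_binary[where H = "(*)"]) (assumption | rule smooth_on_mult)+

lemma smooth_near_comb:
  "smooth_near A p f \<Longrightarrow> smooth_near A p h \<Longrightarrow> smooth_near A p (\<lambda>q. a * f q + b * h q)"
  by (intro smooth_near_add smooth_near_mult smooth_near_const)

lemma smooth_near_chart_function:
  assumes "(U, \<phi>) \<in> A" "p \<in> U" "open B" "\<phi> p \<in> B" "B \<subseteq> \<phi> ` U" "smooth_on B f"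
  shows "smooth_near A p (\<lambda>q. f (\<phi> q))"
proof (rule smooth_nearI[OF assms(1) chart_inv_open_map[OF assms(1,3,5)]])
  have B: "\<phi> ` inv_into U \<phi> ` B = B"
    using homeomorphism_apply2[OF chart_homeomorphism[OF assms(1)]] assms(5)
    by (force simp: image_image image_iff)
  show "p \<in> inv_into U \<phi> ` B"
    using chart_inv[OF assms(1,2)] assms(4) by (metis imageI)
  show "inv_into U \<phi> ` B \<subseteq> U"
    using assms(5) by (auto intro!: inv_into_into)
  have "f x = ((\<lambda>q. f (\<phi> q)) \<circ> inv_into U \<phi>) x" if "x \<in> B" for x
    using homeomorphism_apply2[OF chart_homeomorphism[OF assms(1)]] assms(5) that by force
  then show "smooth_on (\<phi> ` inv_into U \<phi> ` B) ((\<lambda>q. f (\<phi> q)) \<circ> inv_into U \<phi>)"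
    unfolding B by (rule smooth_on_cong[OF assms(6,3)])
qed

lemma smooth_near_coord:
  assumes "(U, \<phi>) \<in> A" "p \<in> U"
  shows "smooth_near A p (\<lambda>q. \<phi> q \<bullet> b)"
  using smooth_near_chart_function[OF assms chart_image_open[OF assms(1)], of "\<lambda>x. x \<bullet> b"] assms
    smooth_on_bounded_linear[OF chart_image_open[OF assms(1)] bounded_linear_inner_left
      smooth_on_id[OF chart_image_open[OF assms(1)]]]
  by simp

lemma smooth_near_has_derivative:
  assumes "smooth_near A p f" "(U, \<phi>) \<in> A" "p \<in> U"
  shows "((f \<circ> inv_into U \<phi>) has_derivative dir_deriv (f \<circ> inv_into U \<phi>) (\<phi> p)) (at (\<phi> p))"
proof -
  obtain W where "p \<in> W" "smooth_on (\<phi> ` W) (f \<circ> inv_into U \<phi>)"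
    using smooth_near_chart[OF assms] .
  then show ?thesis using smooth_on_derivative by blast
qed

text \<open>
  Directional differentiation in the chart, extended by \<open>0\<close> as the definition of tangent vectors demands.
\<close>
definition coordinate_tangent :: "'m set \<Rightarrow> ('m \<Rightarrow> 'e) \<Rightarrow> 'm \<Rightarrow> 'e \<Rightarrow> 'm tangent" where
  "coordinate_tangent U \<phi> p w =
    (\<lambda>f. if smooth_near A p f then dir_deriv (f \<circ> inv_into U \<phi>) (\<phi> p) w else 0)"

lemma coordinate_tangent:
  assumes "(U, \<phi>) \<in> A" "p \<in> U"
  shows "coordinate_tangent U \<phi> p w \<in> tangent_space A p"
  unfolding tangent_space_def mem_Collect_eq
proof (intro conjI allI impI)
  show "coordinate_tangent U \<phi> p w f = 0" if "\<not> smooth_near A p f" for f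
    using that by (simp add: coordinate_tangent_def)
next
  fix f h a b assume "smooth_near A p f \<and> smooth_near A p h"
  then have fh: "smooth_near A p f" "smooth_near A p h" by auto
  have "((\<lambda>q. a * f q + b * h q) \<circ> inv_into U \<phi> has_derivative
      (\<lambda>v. a * dir_deriv (f \<circ> inv_into U \<phi>) (\<phi> p) v + b * dir_deriv (h \<circ> inv_into U \<phi>) (\<phi> p) v)) (at (\<phi> p))"
    using has_derivative_add[OF has_derivative_mult_right[OF smooth_near_has_derivative[OF fh(1) assms], of a]
        has_derivative_mult_right[OF smooth_near_has_derivative[OF fh(2) assms], of b]]
    by (simp add: comp_def)
  then show "coordinate_tangent U \<phi> p w (\<lambda>q. a * f q + b * h q)
      = a * coordinate_tangent U \<phi> p w f + b * coordinate_tangent U \<phi> p w h"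
    using fh smooth_near_comb[OF fh] by (simp add: coordinate_tangent_def dir_deriv_eq)
next
  fix f h assume "smooth_near A p f \<and> smooth_near A p h"
  then have fh: "smooth_near A p f" "smooth_near A p h" by auto
  have "((\<lambda>q. f q * h q) \<circ> inv_into U \<phi> has_derivative
      (\<lambda>v. f p * dir_deriv (h \<circ> inv_into U \<phi>) (\<phi> p) v + dir_deriv (f \<circ> inv_into U \<phi>) (\<phi> p) v * h p)) (at (\<phi> p))"
    using has_derivative_mult[OF smooth_near_has_derivative[OF fh(1) assms]
        smooth_near_has_derivative[OF fh(2) assms]] chart_inv[OF assms]
    by (simp add: comp_def)
  then show "coordinate_tangent U \<phi> p w (\<lambda>q. f q * h q)
      = coordinate_tangent U \<phi> p w f * h p + f p * coordinate_tangent U \<phi> p w h"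
    using fh smooth_near_mult[OF fh] by (simp add: coordinate_tangent_def dir_deriv_eq)
qed

lemma tangent_nonsmooth: "v \<in> tangent_space A p \<Longrightarrow> \<not> smooth_near A p f \<Longrightarrow> v f = 0"
  and tangent_comb_fun: "v \<in> tangent_space A p \<Longrightarrow> smooth_near A p f \<Longrightarrow> smooth_near A p h \<Longrightarrow>
    v (\<lambda>q. a * f q + b * h q) = a * v f + b * v h"
  and tangent_mult: "v \<in> tangent_space A p \<Longrightarrow> smooth_near A p f \<Longrightarrow> smooth_near A p h \<Longrightarrow>
    v (\<lambda>q. f q * h q) = v f * h p + f p * v h"
  unfolding tangent_space_def by blast+

lemma tangent_const: assumes "v \<in> tangent_space A p" shows "v (\<lambda>q. k) = 0"
proof -
  have "v (\<lambda>q. 1 * 1) = v (\<lambda>q. 1) * 1 + 1 * v (\<lambda>q. 1)"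
    by (rule tangent_mult[OF assms smooth_near_const smooth_near_const])
  then have 1: "v (\<lambda>q. 1) = 0" by simp
  have "v (\<lambda>q. k * 1 + 0 * 1) = k * v (\<lambda>q. 1) + 0 * v (\<lambda>q. 1)"
    by (rule tangent_comb_fun[OF assms smooth_near_const smooth_near_const])
  then show ?thesis using 1 by simp
qed

lemma tangent_add: "v \<in> tangent_space A p \<Longrightarrow> smooth_near A p f \<Longrightarrow> smooth_near A p h \<Longrightarrow>
    v (\<lambda>q. f q + h q) = v f + v h"
  using tangent_comb_fun[of v p f h 1 1] by simp

lemma tangent_scale: "v \<in> tangent_space A p \<Longrightarrow> smooth_near A p f \<Longrightarrow> v (\<lambda>q. k * f q) = k * v f"
  using tangent_comb_fun[of v p f f k 0] by simp

lemma tangent_space_comb: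
  assumes "v \<in> tangent_space A p" "w \<in> tangent_space A p"
  shows "(\<lambda>f. a * v f + b * w f) \<in> tangent_space A p"
  unfolding tangent_space_def mem_Collect_eq
  using assms by (auto simp: tangent_nonsmooth tangent_comb_fun tangent_mult algebra_simps)

lemma vector_field_tangent: "vector_field A X \<Longrightarrow> X p \<in> tangent_space A p"
  and vector_field_smooth: "vector_field A X \<Longrightarrow> smooth_near A p f \<Longrightarrow> smooth_near A p (\<lambda>q. X q f)"
  unfolding vector_field_def by blast+

lemma vector_field_comb:
  assumes "vector_field A X" "vector_field A Y" "smooth_function A a" "smooth_function A b"
  shows "vector_field A (\<lambda>p f. a p * X p f + b p * Y p f)"
  unfolding vector_field_def
proof (intro conjI allI impI)
  show "(\<lambda>f. a p * X p f + b p * Y p f) \<in> tangent_space A p" for p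
    using assms(1,2) by (intro tangent_space_comb vector_field_tangent)
  fix p f assume f: "smooth_near A p f"
  show "smooth_near A p (\<lambda>q. a q * X q f + b q * Y q f)"
    using assms(3,4) unfolding smooth_function_def
    by (intro smooth_near_add smooth_near_mult vector_field_smooth[OF assms(1) f]
        vector_field_smooth[OF assms(2) f]) blast+
qed

lemma smooth_function_const: "smooth_function A (\<lambda>p. k)"
  by (simp add: smooth_function_def smooth_near_const)

lemma lie_bracket_vector_field_apply:
  "smooth_near A p f \<Longrightarrow> lie_bracket A X Y p f = X p (\<lambda>q. Y q f) - Y p (\<lambda>q. X q f)"
  by (simp add: lie_bracket_def)

end

lemma smooth_map_pullback:
  fixes A :: "('m::topological_space, 'e::euclidean_space) atlas"
    and B :: "('n::topological_space, 'd::euclidean_space) atlas"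
  assumes "smooth_manifold A" "smooth_manifold B" "smooth_map A B h" "smooth_near B (h p) f"
  shows "smooth_near A p (f \<circ> h)"
proof -
  interpret A: smooth_manifold A by fact
  interpret B: smooth_manifold B by fact
  obtain U \<phi> where U: "(U, \<phi>) \<in> A" "p \<in> U" using A.chart_around .
  obtain V \<psi> where V: "(V, \<psi>) \<in> B" "h p \<in> V" using B.chart_around .
  obtain W where W: "open W" "h p \<in> W" "W \<subseteq> V" "smooth_on (\<psi> ` W) (f \<circ> inv_into V \<psi>)"
    using B.smooth_near_chart[OF assms(4) V] .
  have h: "continuous_on UNIV h" "smooth_on (\<phi> ` (U \<inter> h -` V)) (\<psi> \<circ> h \<circ> inv_into U \<phi>)"
    using assms(3) U(1) V(1) unfolding smooth_map_def by fast+
  let ?W = "U \<inter> h -` W"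
  have oW: "open ?W" "?W \<subseteq> U"
    using A.chart_open[OF U(1)] open_vimage[OF W(1) h(1)] by auto
  have o: "open (\<phi> ` ?W)" "open (\<psi> ` W)"
    using A.chart_open_map[OF U(1) oW] B.chart_open_map[OF V(1) W(1,3)] by auto
  have s: "smooth_on (\<phi> ` ?W) (\<psi> \<circ> h \<circ> inv_into U \<phi>)"
    by (rule smooth_on_subset[OF h(2)]) (use W in blast)
  have "smooth_on (\<phi> ` ?W) (\<lambda>x. (f \<circ> inv_into V \<psi>) ((\<psi> \<circ> h \<circ> inv_into U \<phi>) x))"
    by (rule smooth_on_compose[OF W(4) s o]) (auto simp: A.chart_inv[OF U(1)])
  then have "smooth_on (\<phi> ` ?W) (f \<circ> h \<circ> inv_into U \<phi>)"
  proof (rule smooth_on_cong[OF _ o(1)])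
    fix x assume "x \<in> \<phi> ` ?W"
    then obtain q where "h q \<in> V" "q \<in> U" "x = \<phi> q" using W by blast
    then show "(f \<circ> inv_into V \<psi>) ((\<psi> \<circ> h \<circ> inv_into U \<phi>) x) = (f \<circ> h \<circ> inv_into U \<phi>) x"
      by (simp add: A.chart_inv[OF U(1)] B.chart_inv[OF V(1)])
  qed
  then show ?thesis
    by (intro A.smooth_nearI[OF U(1) oW(1) _ oW(2)]) (use U W in simp_all)
qed

text \<open>
  Restricting a smooth multiplication to the slice \<open>{a} \<times> M\<close>; in charts this is composition with
  \<open>x \<mapsto> (\<tau> a, x)\<close>.
\<close>
lemma smooth_map_slice:
  assumes "smooth_manifold A" "smooth_map (product_atlas A A) A (\<lambda>(x, y). m x y)"
  shows "smooth_map A A (m a)"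
proof -
  interpret smooth_manifold A by fact
  have c: "continuous_on UNIV (\<lambda>(x, y). m x y)"
    using assms(2) by (simp add: smooth_map_def)
  have ca: "continuous_on UNIV (m a)"
    using continuous_on_compose2[OF c, of UNIV "Pair a"]
      continuous_on_Pair[OF continuous_on_const continuous_on_id, of UNIV a] by simp
  have "smooth_on (\<phi> ` (U \<inter> m a -` V)) (\<psi> \<circ> m a \<circ> inv_into U \<phi>)"
    if U: "(U, \<phi>) \<in> A" and V: "(V, \<psi>) \<in> A" for U \<phi> V \<psi>
  proof -
    obtain T \<tau> where T: "(T, \<tau>) \<in> A" "a \<in> T" using chart_around .
    let ?P = "(T \<times> U) \<inter> (\<lambda>(x, y). m x y) -` V" and ?j = "inv_into (T \<times> U) (map_prod \<tau> \<phi>)"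
    have "(T \<times> U, map_prod \<tau> \<phi>) \<in> product_atlas A A"
      using T(1) U unfolding product_atlas_def by blast
    then have s: "smooth_on (map_prod \<tau> \<phi> ` ?P) (\<psi> \<circ> (\<lambda>(x, y). m x y) \<circ> ?j)"
      using assms(2) V unfolding smooth_map_def by fast
    have oP: "open ?P"
      using open_vimage[OF chart_open[OF V] c] chart_open[OF T(1)] chart_open[OF U]
      by (intro open_Int open_Times) auto
    have ci: "continuous_on (\<tau> ` T \<times> \<phi> ` U) (map_prod (inv_into T \<tau>) (inv_into U \<phi>))"
      using chart_homeomorphism[OF T(1)] chart_homeomorphism[OF U]
      unfolding map_prod_def split_beta homeomorphism_def
      by (intro continuous_on_Pair) (auto intro!: continuous_on_compose2[OF _ continuous_on_fst[OF continuous_on_id]]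
          continuous_on_compose2[OF _ continuous_on_snd[OF continuous_on_id]])
    have im: "map_prod \<tau> \<phi> ` ?P
        = (\<tau> ` T \<times> \<phi> ` U) \<inter> map_prod (inv_into T \<tau>) (inv_into U \<phi>) -` ?P"
      by (auto simp: chart_inv[OF T(1)] chart_inv[OF U] image_iff)
    have oI: "open (map_prod \<tau> \<phi> ` ?P)"
      unfolding im
      by (rule continuous_open_preimage[OF ci _ oP])
        (intro open_Times chart_image_open[OF T(1)] chart_image_open[OF U])
    have oU: "open (U \<inter> m a -` V)" "U \<inter> m a -` V \<subseteq> U"
      using chart_open[OF U] open_vimage[OF chart_open[OF V] ca] by auto
    have o: "open (\<phi> ` (U \<inter> m a -` V))" using chart_open_map[OF U oU] .
    have sp: "smooth_on (\<phi> ` (U \<inter> m a -` V)) (\<lambda>x. (\<tau> a, x))"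
      by (intro smooth_on_Pair smooth_on_const smooth_on_id o)
    have "smooth_on (\<phi> ` (U \<inter> m a -` V)) (\<lambda>x. (\<psi> \<circ> (\<lambda>(x, y). m x y) \<circ> ?j) (\<tau> a, x))"
      by (rule smooth_on_compose[OF s sp o oI]) (use T in force)
    then show ?thesis
    proof (rule smooth_on_cong[OF _ o])
      fix x assume "x \<in> \<phi> ` (U \<inter> m a -` V)"
      then obtain q where q: "q \<in> U" "x = \<phi> q" by blast
      have "inj_on (map_prod \<tau> \<phi>) (T \<times> U)"
        by (rule inj_onI) (auto, (metis chart_inv[OF T(1)] chart_inv[OF U])+)
      then have "?j (map_prod \<tau> \<phi> (a, q)) = (a, q)"
        using T q by (intro inv_into_f_f) auto
      then show "(\<psi> \<circ> (\<lambda>(x, y). m x y) \<circ> ?j) (\<tau> a, x) = (\<psi> \<circ> m a \<circ> inv_into U \<phi>) x"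
        using q by (simp add: chart_inv[OF U])
    qed
  qed
  with ca show ?thesis unfolding smooth_map_def by blast
qed

section \<open>Orthonormal frames of a Lorentzian metric\<close>

locale lorentz_frame = smooth_manifold A
  for A :: "('m::topological_space, real^3) atlas" +
  fixes g :: "'m metric" and e :: "3 \<Rightarrow> 'm vfield"
  assumes metric: "lorentzian_metric A g"
    and frame: "\<And>i. vector_field A (e i)"
    and orthonormal: "\<And>i j p. metric_on g (e i) (e j) p = minkowski i j"
begin

lemma g_orth: "g p (e i p) (e j p) = minkowski i j"
  using orthonormal by (simp add: metric_on_def)

lemma frame_tangent: "e i p \<in> tangent_space A p"
  by (rule vector_field_tangent[OF frame])

lemma lincomb3:
  "(\<lambda>f. \<Sum>i\<in>UNIV. (c::real^3) $ i * b i f) =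
    (\<lambda>f. 1 * (\<lambda>f. c $ 1 * b 1 f + c $ 2 * b 2 f) f + c $ 3 * b 3 f)"
  by (simp add: sum_3)

lemma lincomb_tangent:
  "(\<And>i. b i \<in> tangent_space A p) \<Longrightarrow> (\<lambda>f. \<Sum>i\<in>UNIV. (c::real^3) $ i * b i f) \<in> tangent_space A p"
  unfolding lincomb3 by (intro tangent_space_comb)

lemma g_comb_left: "u \<in> tangent_space A p \<Longrightarrow> v \<in> tangent_space A p \<Longrightarrow> w \<in> tangent_space A p \<Longrightarrow>
    g p (\<lambda>f. a * u f + b * v f) w = a * g p u w + b * g p v w"
  using metric unfolding lorentzian_metric_def tangent_comb_def by blast

lemma g_sym: "v \<in> tangent_space A p \<Longrightarrow> w \<in> tangent_space A p \<Longrightarrow> g p v w = g p w v"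
  using metric unfolding lorentzian_metric_def by blast

lemma metric_smooth: "vector_field A X \<Longrightarrow> vector_field A Y \<Longrightarrow> smooth_function A (metric_on g X Y)"
  using metric unfolding lorentzian_metric_def by blast

lemma g_lincomb_left:
  assumes "\<And>i. b i \<in> tangent_space A p" "w \<in> tangent_space A p"
  shows "g p (\<lambda>f. \<Sum>i\<in>UNIV. (c::real^3) $ i * b i f) w = (\<Sum>i\<in>UNIV. c $ i * g p (b i) w)"
  unfolding lincomb3
  by (subst g_comb_left) (simp_all add: g_comb_left tangent_space_comb assms sum_3)

lemma g_lincomb_right:
  assumes "\<And>i. b i \<in> tangent_space A p" "w \<in> tangent_space A p"
  shows "g p w (\<lambda>f. \<Sum>i\<in>UNIV. (c::real^3) $ i * b i f) = (\<Sum>i\<in>UNIV. c $ i * g p w (b i))"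
proof -
  have "g p w (\<lambda>f. \<Sum>i\<in>UNIV. c $ i * b i f) = g p (\<lambda>f. \<Sum>i\<in>UNIV. c $ i * b i f) w"
    by (rule g_sym[OF assms(2) lincomb_tangent[OF assms(1)]])
  also have "\<dots> = (\<Sum>i\<in>UNIV. c $ i * g p (b i) w)" by (rule g_lincomb_left[OF assms])
  finally show ?thesis using g_sym[OF assms(1) assms(2)] by simp
qed

lemma sum_minkowski [simp]:
  "(\<Sum>k\<in>UNIV. minkowski i k * f k) = minkowski i i * f i"
  "(\<Sum>k\<in>UNIV. f k * minkowski i k) = minkowski i i * f i"
  "(\<Sum>k\<in>UNIV. f k * minkowski k i) = minkowski i i * f i"
  using exhaust_3[of i] by (auto simp: sum_3 minkowski_def)

lemma minkowski_square [simp]: "minkowski i i * (minkowski i i * x) = x"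
  by (simp add: minkowski_def)

lemma frame_comb_apply: "frame_comb e c p = (\<lambda>f. \<Sum>i\<in>UNIV. c $ i * e i p f)"
  by (simp add: frame_comb_def)

lemma g_frame_comb: "g p (frame_comb e c p) (e i p) = minkowski i i * c $ i"
  unfolding frame_comb_apply by (subst g_lincomb_left) (auto simp: frame_tangent g_orth)

lemma frame_comb_inject: "frame_comb e c p = frame_comb e d p \<longleftrightarrow> c = d"
proof
  assume "frame_comb e c p = frame_comb e d p"
  then have "minkowski i i * c $ i = minkowski i i * d $ i" for i
    using g_frame_comb by metis
  then have "c $ i = d $ i" for i by (metis minkowski_square)
  then show "c = d" by (simp add: vec_eq_iff)
qed simp

text \<open>
  Each \<open>e i p\<close> is a combination, with coefficient matrix \<open>P\<close>, of an orthonormal basis that exists by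
  the definition of a Lorentzian metric. As both systems are orthonormal, \<open>P \<eta> P\<^sup>T = \<eta>\<close> for the
  Minkowski matrix \<open>\<eta>\<close>, so \<open>P\<close> is invertible.
\<close>
lemma frame_spans:
  assumes v: "v \<in> tangent_space A p"
  obtains c where "v = frame_comb e c p"
proof -
  obtain b :: "3 \<Rightarrow> 'm tangent" where b: "\<And>i. b i \<in> tangent_space A p"
    and span: "\<And>v. v \<in> tangent_space A p \<Longrightarrow> \<exists>c :: real^3. v = (\<lambda>f. \<Sum>i\<in>UNIV. c $ i * b i f)"
    and gb: "\<And>i j. g p (b i) (b j) = minkowski i j"
    using metric[unfolded lorentzian_metric_def, THEN conjunct2, THEN conjunct2, THEN conjunct1,
        THEN spec[of _ p]] by (elim exE conjE) blast
  obtain E :: "3 \<Rightarrow> real^3" where E: "\<And>i. e i p = (\<lambda>f. \<Sum>k\<in>UNIV. E i $ k * b k f)"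
    using span[OF frame_tangent] by metis
  obtain c :: "real^3" where c: "v = (\<lambda>f. \<Sum>i\<in>UNIV. c $ i * b i f)"
    using span[OF v] by blast
  define P :: "real^3^3" where "P = (\<chi> i k. E i $ k)"
  define Q :: "real^3^3" where "Q = (\<chi> k j. minkowski k k * minkowski j j * E j $ k)"
  have 1: "minkowski i j = (\<Sum>k\<in>UNIV. E i $ k * (minkowski k k * E j $ k))" for i j
  proof -
    have "minkowski i j = g p (e i p) (e j p)" by (simp add: g_orth)
    also have "\<dots> = (\<Sum>k\<in>UNIV. E i $ k * g p (b k) (e j p))"
      unfolding E[of i] by (rule g_lincomb_left[OF b frame_tangent])
    also have "\<dots> = (\<Sum>k\<in>UNIV. E i $ k * (\<Sum>l\<in>UNIV. E j $ l * g p (b k) (b l)))"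
      unfolding E[of j] by (subst g_lincomb_right[OF b b]) simp
    finally show ?thesis by (simp add: gb)
  qed
  have "P ** Q = mat 1"
  proof -
    have "(P ** Q) $ i $ j = (mat 1 :: real^3^3) $ i $ j" for i j
    proof -
      have "(P ** Q) $ i $ j = minkowski j j * (\<Sum>k\<in>UNIV. E i $ k * (minkowski k k * E j $ k))"
        by (simp add: matrix_matrix_mult_def P_def Q_def sum_distrib_left mult_ac)
      also have "\<dots> = minkowski j j * minkowski i j" by (subst 1[of i j]) (rule refl)
      finally show ?thesis by (simp add: mat_def minkowski_def)
    qed
    then show ?thesis by (simp add: vec_eq_iff)
  qed
  then have QP: "Q ** P = mat 1" using matrix_left_right_inverse by blast
  have "b k = (\<lambda>f. \<Sum>i\<in>UNIV. Q $ k $ i * e i p f)" for k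
  proof
    fix f
    have "(\<Sum>i\<in>UNIV. Q $ k $ i * e i p f) = (\<Sum>l\<in>UNIV. (Q ** P) $ k $ l * b l f)"
      by (simp add: E matrix_matrix_mult_def P_def sum_3 algebra_simps)
    also have "\<dots> = b k f" using exhaust_3[of k] by (auto simp: QP mat_def sum_3)
    finally show "b k f = (\<Sum>i\<in>UNIV. Q $ k $ i * e i p f)" by simp
  qed
  then have "v = frame_comb e (c v* Q) p"
    unfolding c frame_comb_apply by (simp add: sum_3 vector_matrix_mult_def fun_eq_iff algebra_simps)
  then show thesis using that by blast
qed

lemma frame_coord_unique: "X p = frame_comb e c p \<Longrightarrow> frame_coord e X p = c"
  unfolding frame_coord_def by (rule the_equality) (simp_all add: frame_comb_inject)

lemma frame_coord_comb [simp]: "frame_coord e (frame_comb e c) p = c"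
  by (rule frame_coord_unique) (rule refl)

lemma frame_axis: "e i = frame_comb e (axis i 1)"
  using exhaust_3[of i] by (auto simp: frame_comb_def fun_eq_iff sum_3 axis_def)

lemma frame_coord_expand:
  assumes "X p \<in> tangent_space A p"
  shows "X p = frame_comb e (frame_coord e X p) p"
  using frame_spans[OF assms] frame_coord_unique by metis

lemma frame_coord_nth:
  assumes "X p \<in> tangent_space A p"
  shows "frame_coord e X p $ i = minkowski i i * g p (X p) (e i p)"
proof -
  have "g p (X p) (e i p) = minkowski i i * frame_coord e X p $ i"
    by (subst frame_coord_expand[of X p, OF assms]) (rule g_frame_comb)
  then show ?thesis by simp
qed

lemma vector_field_frame_comb: "vector_field A (frame_comb e c)"
proof -
  have "vector_field A (\<lambda>p f. 1 * (\<lambda>p f. c $ 1 * e 1 p f + c $ 2 * e 2 p f) p f + c $ 3 * e 3 p f)"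
    by (intro vector_field_comb[where a = "\<lambda>p. 1" and b = "\<lambda>p. c $ 3"]
        vector_field_comb[where a = "\<lambda>p. c $ 1" and b = "\<lambda>p. c $ 2"] frame smooth_function_const)
  then show ?thesis by (simp add: frame_comb_def sum_3)
qed

lemma frame_coord_smooth:
  assumes "vector_field A X"
  shows "smooth_function A (\<lambda>p. frame_coord e X p $ i)"
proof -
  have "(\<lambda>p. frame_coord e X p $ i) = (\<lambda>p. minkowski i i * metric_on g X (e i) p)"
    by (rule ext) (simp add: frame_coord_nth[of X, OF vector_field_tangent[OF assms]] metric_on_def)
  then show ?thesis
    using metric_smooth[OF assms frame] smooth_near_mult[OF smooth_near_const]
    by (simp add: smooth_function_def)
qed

lemma metric_on_frame_coord:
  assumes "X p \<in> tangent_space A p" "Y p \<in> tangent_space A p"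
  shows "metric_on g X Y p = (\<Sum>i\<in>UNIV. minkowski i i * frame_coord e X p $ i * frame_coord e Y p $ i)"
proof -
  have "metric_on g X Y p = (\<Sum>i\<in>UNIV. frame_coord e Y p $ i * g p (X p) (e i p))"
    unfolding metric_on_def
    by (subst frame_coord_expand[of Y p, OF assms(2)], unfold frame_comb_apply)
      (rule g_lincomb_right[OF frame_tangent assms(1)])
  moreover have "g p (X p) (e i p) = minkowski i i * frame_coord e X p $ i" for i
    by (simp add: frame_coord_nth[of X p, OF assms(1)])
  ultimately show ?thesis by (simp add: mult_ac)
qed

text \<open>
  A derivation at \<open>p\<close> acts as a directional derivative in the chart. The three partial derivatives are
  linearly independent derivations, and the tangent space is spanned by the three vectors \<open>e i p\<close>; hence
  the partial derivatives span it too.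
\<close>
lemma tangent_chart:
  assumes U: "(U, \<phi>) \<in> A" "p \<in> U" and v: "v \<in> tangent_space A p" and f: "smooth_near A p f"
  shows "v f = dir_deriv (f \<circ> inv_into U \<phi>) (\<phi> p) (\<chi> j. v (\<lambda>q. \<phi> q $ j))"
proof -
  have sc: "smooth_near A p (\<lambda>q. \<phi> q $ j)" for j
    using smooth_near_coord[OF U, of "axis j 1"] by (simp add: inner_axis)
  define dd where "dd = (\<lambda>j. coordinate_tangent U \<phi> p (axis j 1))"
  have dd: "dd j \<in> tangent_space A p" for j
    unfolding dd_def by (rule coordinate_tangent[OF U])
  have delta: "dd j (\<lambda>q. \<phi> q $ k) = (if j = k then 1 else 0)" for j k
  proof -
    have "((\<lambda>x. x $ k) has_derivative (\<lambda>v. v $ k)) (at (\<phi> p))"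
      using bounded_linear.has_derivative[OF bounded_linear_vec_nth has_derivative_ident] .
    then have "((\<lambda>q. \<phi> q $ k) \<circ> inv_into U \<phi> has_derivative (\<lambda>v. v $ k)) (at (\<phi> p))"
      by (rule has_derivative_transform_within_open[OF _ chart_image_open[OF U(1)]])
        (use U in \<open>auto simp: chart_inv\<close>)
    from dir_deriv_eq[OF this] show ?thesis
      by (simp add: dd_def coordinate_tangent_def sc axis_def)
  qed
  obtain B :: "3 \<Rightarrow> real^3" where B: "\<And>j. dd j = frame_comb e (B j) p"
  proof -
    have "\<exists>c. dd j = frame_comb e c p" for j using frame_spans[OF dd, of j] by blast
    then show thesis using that by metis
  qed
  obtain c where c: "v = frame_comb e c p" using frame_spans[OF v] .
  define P :: "real^3^3" where "P = (\<chi> j i. B j $ i)"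
  define Q :: "real^3^3" where "Q = (\<chi> i k. e i p (\<lambda>q. \<phi> q $ k))"
  have "P ** Q = mat 1"
    using delta by (simp add: vec_eq_iff matrix_matrix_mult_def P_def Q_def B frame_comb_apply mat_def)
  then have QP: "Q ** P = mat 1" using matrix_left_right_inverse by blast
  have ef: "e i p f = (\<Sum>j\<in>UNIV. Q $ i $ j * dd j f)" for i
  proof -
    have "(\<Sum>j\<in>UNIV. Q $ i $ j * dd j f) = (\<Sum>l\<in>UNIV. (Q ** P) $ i $ l * e l p f)"
      by (simp add: B frame_comb_apply matrix_matrix_mult_def P_def sum_3 algebra_simps)
    also have "\<dots> = e i p f" using exhaust_3[of i] by (auto simp: QP mat_def sum_3)
    finally show ?thesis by simp
  qed
  let ?L = "dir_deriv (f \<circ> inv_into U \<phi>) (\<phi> p)"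
  have lin: "linear ?L" using has_derivative_linear[OF smooth_near_has_derivative[OF f U]] .
  have "v f = (\<Sum>j\<in>UNIV. v (\<lambda>q. \<phi> q $ j) * dd j f)"
    by (simp add: c frame_comb_apply ef Q_def sum_3 algebra_simps)
  also have "\<dots> = (\<Sum>j\<in>UNIV. ?L (v (\<lambda>q. \<phi> q $ j) *\<^sub>R axis j 1))"
    by (simp add: dd_def coordinate_tangent_def f linear_cmul[OF lin])
  also have "\<dots> = ?L (\<Sum>j\<in>UNIV. v (\<lambda>q. \<phi> q $ j) *\<^sub>R axis j 1)"
    by (rule linear_sum[OF lin, symmetric])
  also have "(\<Sum>j\<in>UNIV. v (\<lambda>q. \<phi> q $ j) *\<^sub>R axis j 1) = (\<chi> j. v (\<lambda>q. \<phi> q $ j))"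
    by (simp add: vec_eq_iff axis_def if_distrib[of "(*) _"] cong: if_cong)
  finally show ?thesis .
qed

lemma frame_comb_tangent: "frame_comb e c p \<in> tangent_space A p"
  by (rule vector_field_tangent[OF vector_field_frame_comb])

lemma lie_bracket_frame_comb_left:
  "lie_bracket A (frame_comb e a) Y p f = (\<Sum>i\<in>UNIV. a $ i * lie_bracket A (e i) Y p f)"
  if "vector_field A Y"
proof (cases "smooth_near A p f")
  case True
  have s: "smooth_near A p (\<lambda>q. e i q f)" for i by (rule vector_field_smooth[OF frame True])
  have "Y p (\<lambda>q. \<Sum>i\<in>UNIV. a $ i * e i q f) = (\<Sum>i\<in>UNIV. a $ i * Y p (\<lambda>q. e i q f))"
    unfolding sum_3 using s
    by (simp add: tangent_add[OF vector_field_tangent[OF that]] tangent_scale[OF vector_field_tangent[OF that]]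
        smooth_near_add smooth_near_mult smooth_near_const)
  then show ?thesis by (simp add: lie_bracket_def True frame_comb_def sum_3 algebra_simps)
qed (simp add: lie_bracket_def)

lemma lie_bracket_anti: "lie_bracket A X Y p f = - lie_bracket A Y X p f"
  by (simp add: lie_bracket_def)

lemma lie_bracket_function_comb:
  assumes X: "vector_field A X" and y: "\<And>i. smooth_function A (y i)"
    and Y: "\<And>p f. Y p f = (\<Sum>i\<in>UNIV. y i p * e i p f)"
  shows "lie_bracket A X Y p f = (\<Sum>i\<in>UNIV. X p (y i) * e i p f + y i p * lie_bracket A X (e i) p f)"
proof (cases "smooth_near A p f")
  case True
  have s: "smooth_near A p (\<lambda>q. e i q f)" for i by (rule vector_field_smooth[OF frame True])
  have sy: "smooth_near A p (y i)" for i using y by (simp add: smooth_function_def)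
  have "X p (\<lambda>q. \<Sum>i\<in>UNIV. y i q * e i q f) = (\<Sum>i\<in>UNIV. X p (y i) * e i p f + y i p * X p (\<lambda>q. e i q f))"
    unfolding sum_3
    by (simp add: tangent_add[OF vector_field_tangent[OF X]] tangent_mult[OF vector_field_tangent[OF X]]
        smooth_near_add smooth_near_mult s sy)
  then show ?thesis by (simp add: lie_bracket_def True Y sum_3 algebra_simps)
next
  case False
  then show ?thesis by (simp add: lie_bracket_def tangent_nonsmooth[OF frame_tangent])
qed

text \<open>
  The Lie derivative of the metric is tensorial: in \<open>X g(Y, Z) - g([X,Y], Z) - g(Y, [X,Z])\<close> the
  derivatives of the components of \<open>Y\<close> and \<open>Z\<close> cancel.
\<close>
lemma lie_deriv_metric_frame:
  assumes X: "vector_field A X" and Y: "vector_field A Y" and Z: "vector_field A Z"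
    and br: "\<And>i. lie_bracket A X (e i) = frame_comb e (b i)"
  shows "lie_deriv_metric A g X Y Z p = - (\<Sum>i\<in>UNIV. \<Sum>j\<in>UNIV. frame_coord e Y p $ i * frame_coord e Z p $ j *
    (minkowski j j * b i $ j + minkowski i i * b j $ i))"
proof -
  have half: "metric_on g (lie_bracket A X Y) Z p
      = (\<Sum>j\<in>UNIV. minkowski j j * (X p (\<lambda>q. frame_coord e Y q $ j) + (\<Sum>i\<in>UNIV. frame_coord e Y p $ i * b i $ j)) * frame_coord e Z p $ j)"
    and tan: "lie_bracket A X Y p \<in> tangent_space A p"
    if Y: "vector_field A Y" and Z: "vector_field A Z" for Y Z
  proof -
    let ?c = "\<chi> j. X p (\<lambda>q. frame_coord e Y q $ j) + (\<Sum>i\<in>UNIV. frame_coord e Y p $ i * b i $ j)"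
    have Ye: "Y p f = (\<Sum>i\<in>UNIV. frame_coord e Y p $ i * e i p f)" for p f
      using frame_coord_expand[of Y p, OF vector_field_tangent[OF Y]] frame_comb_apply by metis
    have eq: "lie_bracket A X Y p = frame_comb e ?c p"
      unfolding frame_comb_apply
      by (rule ext, subst lie_bracket_function_comb[OF X frame_coord_smooth[OF Y] Ye])
        (simp add: br frame_comb_apply sum_3 algebra_simps)
    show "lie_bracket A X Y p \<in> tangent_space A p" unfolding eq by (rule frame_comb_tangent)
    then show "metric_on g (lie_bracket A X Y) Z p
      = (\<Sum>j\<in>UNIV. minkowski j j * (X p (\<lambda>q. frame_coord e Y q $ j) + (\<Sum>i\<in>UNIV. frame_coord e Y p $ i * b i $ j)) * frame_coord e Z p $ j)"
      by (simp add: metric_on_frame_coord[of "lie_bracket A X Y" p Z] vector_field_tangent[OF Z]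
          frame_coord_unique[of "lie_bracket A X Y" p, OF eq])
  qed
  have sy: "smooth_near A p (\<lambda>q. frame_coord e Y q $ i)" and sz: "smooth_near A p (\<lambda>q. frame_coord e Z q $ i)" for i
    using frame_coord_smooth[OF Y] frame_coord_smooth[OF Z] by (auto simp: smooth_function_def)
  have "metric_on g Y Z = (\<lambda>q. \<Sum>i\<in>UNIV. minkowski i i * (frame_coord e Y q $ i * frame_coord e Z q $ i))"
    by (simp add: metric_on_frame_coord vector_field_tangent Y Z fun_eq_iff mult.assoc)
  then have 0: "X p (metric_on g Y Z) = (\<Sum>i\<in>UNIV. minkowski i i *
      (X p (\<lambda>q. frame_coord e Y q $ i) * frame_coord e Z p $ i + frame_coord e Y p $ i * X p (\<lambda>q. frame_coord e Z q $ i)))"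
    unfolding sum_3
    by (simp add: tangent_add[OF vector_field_tangent[OF X]] tangent_mult[OF vector_field_tangent[OF X]]
        tangent_scale[OF vector_field_tangent[OF X]] tangent_const[OF vector_field_tangent[OF X]]
        smooth_near_add smooth_near_mult smooth_near_const sy sz)
  have "metric_on g Y (lie_bracket A X Z) p = metric_on g (lie_bracket A X Z) Y p"
    unfolding metric_on_def by (rule g_sym[OF vector_field_tangent[OF Y] tan[OF Z Y]])
  then show ?thesis
    unfolding lie_deriv_metric_def 0 half[OF Y Z] half[OF Z Y]
    by (simp add: sum_3 algebra_simps)
qed

end

section \<open>The Cotton tensor of a Type II frame\<close>

definition vec3 :: "real \<Rightarrow> real \<Rightarrow> real \<Rightarrow> real^3" where
  "vec3 x y z = vector [x, y, z]"

lemma vec3_nth [simp]: "vec3 x y z $ 1 = x" "vec3 x y z $ 2 = y" "vec3 x y z $ 3 = z"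
  by (simp_all add: vec3_def)

lemma vec3_eq_iff: "(a :: real^3) = b \<longleftrightarrow> a $ 1 = b $ 1 \<and> a $ 2 = b $ 2 \<and> a $ 3 = b $ 3"
  by (simp add: vec_eq_iff forall_3)

lemma axis3_nth [simp]:
  "axis (1::3) (1::real) $ 1 = 1" "axis (1::3) (1::real) $ 2 = 0" "axis (1::3) (1::real) $ 3 = 0"
  "axis (2::3) (1::real) $ 1 = 0" "axis (2::3) (1::real) $ 2 = 1" "axis (2::3) (1::real) $ 3 = 0"
  "axis (3::3) (1::real) $ 1 = 0" "axis (3::3) (1::real) $ 2 = 0" "axis (3::3) (1::real) $ 3 = 1"
  by (simp_all add: axis_def)

lemma minkowski_values [simp]:
  "minkowski 1 1 = 1" "minkowski 2 2 = 1" "minkowski 3 3 = -1"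
  "minkowski 1 2 = 0" "minkowski 1 3 = 0" "minkowski 2 1 = 0" "minkowski 2 3 = 0"
  "minkowski 3 1 = 0" "minkowski 3 2 = 0"
  by (simp_all add: minkowski_def)

locale type_II_frame = lorentz_frame A g e
  for A :: "('m::topological_space, real^3) atlas" and g e +
  fixes \<alpha> \<beta> :: real
  assumes e12: "lie_bracket A (e 1) (e 2) = frame_comb e (vector [0, 1/2, - (\<beta> - 1/2)])"
    and e13: "lie_bracket A (e 1) (e 3) = frame_comb e (vector [0, - (\<beta> + 1/2), - (1/2)])"
    and e23: "lie_bracket A (e 2) (e 3) = frame_comb e (vector [\<alpha>, 0, 0])"
begin

text \<open>
  The functions below describe brackets, the connection and the curvature tensors on left-invariant
  fields, which are written as coordinate vectors with respect to \<open>e\<close>.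
\<close>
definition bracket_coords :: "real^3 \<Rightarrow> real^3 \<Rightarrow> real^3" where
  "bracket_coords a b = vec3 (\<alpha> * (a$2 * b$3 - a$3 * b$2))
     ((a$1 * b$2 - a$2 * b$1) / 2 - (\<beta> + 1/2) * (a$1 * b$3 - a$3 * b$1))
     (- (\<beta> - 1/2) * (a$1 * b$2 - a$2 * b$1) - (a$1 * b$3 - a$3 * b$1) / 2)"

lemma frame_comb_neg: "frame_comb e (- c) p f = - frame_comb e c p f"
  by (simp add: frame_comb_def sum_negf)

lemma lie_bracket_frame: "lie_bracket A (e i) (e j) = frame_comb e (bracket_coords (axis i 1) (axis j 1))"
proof -
  have v: "vector [0, 1/2, - (\<beta> - 1/2)] = bracket_coords (axis 1 1) (axis 2 1)"
    "vector [0, - (\<beta> + 1/2), - (1/2)] = bracket_coords (axis 1 1) (axis 3 1)"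
    "vector [\<alpha>, 0, 0] = bracket_coords (axis 2 1) (axis 3 1)"
    by (simp_all add: vec3_eq_iff bracket_coords_def)
  have self: "lie_bracket A (e i) (e i) = frame_comb e 0" for i
    by (simp add: lie_bracket_def frame_comb_def fun_eq_iff)
  have swap: "lie_bracket A (e j) (e i) = frame_comb e (- c)" if "lie_bracket A (e i) (e j) = frame_comb e c" for i j c
    using that by (simp add: fun_eq_iff frame_comb_neg lie_bracket_anti[of "e j" "e i"])
  have w: "bracket_coords (axis i 1) (axis i 1) = 0"
    "bracket_coords (axis 2 1) (axis 1 1) = - bracket_coords (axis 1 1) (axis 2 1)"
    "bracket_coords (axis 3 1) (axis 1 1) = - bracket_coords (axis 1 1) (axis 3 1)"
    "bracket_coords (axis 3 1) (axis 2 1) = - bracket_coords (axis 2 1) (axis 3 1)"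
    by (simp_all add: vec3_eq_iff bracket_coords_def)
  show ?thesis
    using exhaust_3[of i] exhaust_3[of j] w self
      e12[unfolded v] e13[unfolded v] e23[unfolded v]
      swap[OF e12[unfolded v]] swap[OF e13[unfolded v]] swap[OF e23[unfolded v]]
    by auto
qed

lemma lie_bracket_comb: "lie_bracket A (frame_comb e a) (frame_comb e b) = frame_comb e (bracket_coords a b)"
proof (intro ext)
  fix p f
  have r: "lie_bracket A (e i) (frame_comb e b) p f = (\<Sum>j\<in>UNIV. b $ j * lie_bracket A (e i) (e j) p f)" for i
    using lie_bracket_frame_comb_left[OF frame, of b i p f]
    by (subst lie_bracket_anti) (simp add: lie_bracket_anti[of "e i"] sum_negf)
  show "lie_bracket A (frame_comb e a) (frame_comb e b) p f = frame_comb e (bracket_coords a b) p f"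
    unfolding lie_bracket_frame_comb_left[OF vector_field_frame_comb] r lie_bracket_frame
    by (simp add: frame_comb_def sum_3 bracket_coords_def algebra_simps add_divide_distrib diff_divide_distrib)
qed

end

locale type_II_connection = type_II_frame +
  fixes D
  assumes lc: "levi_civita_connection A g D"
begin

lemma D_field: "vector_field A X \<Longrightarrow> vector_field A Y \<Longrightarrow> vector_field A (D X Y)"
  and D_add_left: "vector_field A X \<Longrightarrow> vector_field A Y \<Longrightarrow> vector_field A Z \<Longrightarrow>
    D (vf_add X Y) Z = vf_add (D X Z) (D Y Z)"
  and D_add_right: "vector_field A X \<Longrightarrow> vector_field A Y \<Longrightarrow> vector_field A Z \<Longrightarrow>
    D X (vf_add Y Z) = vf_add (D X Y) (D X Z)"
  and D_scale_left: "smooth_function A h \<Longrightarrow> vector_field A X \<Longrightarrow> vector_field A Y \<Longrightarrow>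
    D (vf_scale h X) Y = vf_scale h (D X Y)"
  and D_scale_right: "smooth_function A h \<Longrightarrow> vector_field A X \<Longrightarrow> vector_field A Y \<Longrightarrow>
    D X (vf_scale h Y) = vf_add (vf_scale (\<lambda>p. X p h) Y) (vf_scale h (D X Y))"
  and D_torsion_free: "vector_field A X \<Longrightarrow> vector_field A Y \<Longrightarrow> vf_diff (D X Y) (D Y X) = lie_bracket A X Y"
  and D_metric: "vector_field A X \<Longrightarrow> vector_field A Y \<Longrightarrow> vector_field A Z \<Longrightarrow>
    X p (metric_on g Y Z) = metric_on g (D X Y) Z p + metric_on g Y (D X Z) p"
  using lc unfolding levi_civita_connection_def affine_connection_def by simp_all

definition nabla_coords :: "real^3 \<Rightarrow> real^3 \<Rightarrow> real^3" where
  "nabla_coords a b = vec3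
    (a$2 * b$2 / 2 + (\<alpha> - 1) / 2 * a$2 * b$3 - (1 + \<alpha>) / 2 * a$3 * b$2 + a$3 * b$3 / 2)
    ((\<alpha> / 2 - \<beta>) * a$1 * b$3 - a$2 * b$1 / 2 + (1 + \<alpha>) / 2 * a$3 * b$1)
    ((\<alpha> / 2 - \<beta>) * a$1 * b$2 + (\<alpha> - 1) / 2 * a$2 * b$1 + a$3 * b$1 / 2)"

text \<open>
  The Koszul formula. The numbers \<open>c i j k = g(D\<^sub>i e\<^sub>j, e\<^sub>k)\<close> are skew in \<open>j, k\<close> because the metric is
  constant in the frame, and their part skew in \<open>i, j\<close> is the bracket; these two properties
  determine them.
\<close>
lemma D_frame: "D (e i) (e j) = frame_comb e (nabla_coords (axis i 1) (axis j 1))"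
proof
  fix p
  define c where "c = (\<lambda>i j k. g p (D (e i) (e j) p) (e k p))"
  have tD: "D (e i) (e j) p \<in> tangent_space A p" for i j
    by (rule vector_field_tangent[OF D_field[OF frame frame]])
  have skew: "c i j k = - c i k j" for i j k
  proof -
    have "metric_on g (e j) (e k) = (\<lambda>q. minkowski j k)" using orthonormal by auto
    then have "0 = metric_on g (D (e i) (e j)) (e k) p + metric_on g (e j) (D (e i) (e k)) p"
      using D_metric[OF frame frame frame, where p = p] tangent_const[OF frame_tangent] by metis
    moreover have "metric_on g (e j) (D (e i) (e k)) p = c i k j"
      unfolding c_def metric_on_def by (rule g_sym[OF frame_tangent tD])
    ultimately show ?thesis by (simp add: c_def metric_on_def)
  qed
  have tor: "c i j k - c j i k = minkowski k k * bracket_coords (axis i 1) (axis j 1) $ k" for i j k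
  proof -
    have "(\<lambda>f. 1 * D (e i) (e j) p f + (-1) * D (e j) (e i) p f) = frame_comb e (bracket_coords (axis i 1) (axis j 1)) p"
      using D_torsion_free[OF frame frame] unfolding lie_bracket_frame vf_diff_def
      by (simp add: fun_eq_iff)
    then have "g p (\<lambda>f. 1 * D (e i) (e j) p f + (-1) * D (e j) (e i) p f) (e k p) = minkowski k k * bracket_coords (axis i 1) (axis j 1) $ k"
      by (simp only: g_frame_comb)
    then show ?thesis unfolding g_comb_left[OF tD tD frame_tangent] by (simp add: c_def)
  qed
  have koszul: "2 * c i j k = minkowski k k * bracket_coords (axis i 1) (axis j 1) $ k
      - minkowski i i * bracket_coords (axis j 1) (axis k 1) $ i + minkowski j j * bracket_coords (axis k 1) (axis i 1) $ j" for i j k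
    using tor[of i j k] tor[of j k i] tor[of k i j] skew[of i j k] skew[of j k i] skew[of k i j]
    by linarith
  have "frame_coord e (D (e i) (e j)) p $ k = minkowski k k * c i j k" for k
    unfolding frame_coord_nth[of "D (e i) (e j)" p, OF tD] c_def ..
  moreover have "minkowski k k * c i j k = nabla_coords (axis i 1) (axis j 1) $ k" for k
    using koszul[of i j k] exhaust_3[of i] exhaust_3[of j] exhaust_3[of k]
    by (auto simp: bracket_coords_def nabla_coords_def field_simps)
  ultimately have "frame_coord e (D (e i) (e j)) p = nabla_coords (axis i 1) (axis j 1)"
    by (simp add: vec_eq_iff)
  then show "D (e i) (e j) p = frame_comb e (nabla_coords (axis i 1) (axis j 1)) p"
    using frame_coord_expand[of "D (e i) (e j)" p, OF tD] by simp
qed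

lemma frame_comb_vf: "frame_comb e c =
    vf_add (vf_add (vf_scale (\<lambda>_. c $ 1) (e 1)) (vf_scale (\<lambda>_. c $ 2) (e 2))) (vf_scale (\<lambda>_. c $ 3) (e 3))"
  by (simp add: frame_comb_def vf_add_def vf_scale_def sum_3)

lemma vector_field_add: "vector_field A X \<Longrightarrow> vector_field A Y \<Longrightarrow> vector_field A (vf_add X Y)"
  using vector_field_comb[of X Y "\<lambda>_. 1" "\<lambda>_. 1"] smooth_function_const by (simp add: vf_add_def)

lemma vector_field_scale: "vector_field A X \<Longrightarrow> vector_field A (vf_scale (\<lambda>_. k) X)"
  using vector_field_comb[of X X "\<lambda>_. k" "\<lambda>_. 0"] smooth_function_const by (simp add: vf_scale_def)

lemma D_comb: "D (frame_comb e a) (frame_comb e b) = frame_comb e (nabla_coords a b)"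
proof -
  have l: "D (frame_comb e a) Z = (\<lambda>p f. \<Sum>i\<in>UNIV. a $ i * D (e i) Z p f)" if "vector_field A Z" for Z
    by (simp add: frame_comb_vf[of a] D_add_left D_scale_left that frame vector_field_add vector_field_scale
        smooth_function_const sum_3) (simp add: vf_add_def vf_scale_def)
  have r: "D (e i) (frame_comb e b) = (\<lambda>p f. \<Sum>j\<in>UNIV. b $ j * D (e i) (e j) p f)" for i
    by (simp add: frame_comb_vf[of b] D_add_right D_scale_right frame vector_field_add vector_field_scale
        smooth_function_const sum_3) (simp add: vf_add_def vf_scale_def tangent_const[OF frame_tangent])
  show ?thesis
    unfolding l[OF vector_field_frame_comb] r D_frame
    by (simp add: fun_eq_iff frame_comb_def sum_3 nabla_coords_def algebra_simps)
qed

definition curvature_coords :: "real^3 \<Rightarrow> real^3 \<Rightarrow> real^3 \<Rightarrow> real^3" where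
  "curvature_coords a b c = nabla_coords (bracket_coords a b) c - (nabla_coords a (nabla_coords b c) - nabla_coords b (nabla_coords a c))"

lemma curvature_comb:
  "curvature A D (frame_comb e a) (frame_comb e b) (frame_comb e c) = frame_comb e (curvature_coords a b c)"
  by (simp add: curvature_def lie_bracket_comb D_comb curvature_coords_def)
    (simp add: vf_diff_def frame_comb_def sum_subtractf left_diff_distrib)

definition ricci_coords :: "real^3 \<Rightarrow> real^3 \<Rightarrow> real" where
  "ricci_coords a b = - \<alpha>\<^sup>2 / 2 * (a$1 * b$1) + (- \<beta> + \<alpha> / 2 - \<alpha> * \<beta> + \<alpha>\<^sup>2 / 2) * (a$2 * b$2)
    + (\<beta> - \<alpha> / 2) * (a$2 * b$3 + a$3 * b$2) + (- \<beta> + \<alpha> / 2 + \<alpha> * \<beta> - \<alpha>\<^sup>2 / 2) * (a$3 * b$3)"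

lemma ricci_comb: "ricci A D e (frame_comb e a) (frame_comb e b) p = ricci_coords a b"
proof -
  have "curvature A D (frame_comb e a) (e k) (frame_comb e b) = frame_comb e (curvature_coords a (axis k 1) b)" for k
    by (subst frame_axis) (rule curvature_comb)
  then have "ricci A D e (frame_comb e a) (frame_comb e b) p = (\<Sum>k\<in>UNIV. curvature_coords a (axis k 1) b $ k)"
    by (simp add: ricci_def frame_trace_def)
  also have "\<dots> = ricci_coords a b"
    by (simp add: sum_3 curvature_coords_def nabla_coords_def bracket_coords_def ricci_coords_def field_simps power2_eq_square)
  finally show ?thesis .
qed

lemma gram_minkowski: "gram g e p = (\<chi> i j. minkowski i j)"
  using orthonormal by (simp add: gram_def)

lemma matrix_inv_minkowski: "matrix_inv (\<chi> i j. minkowski i j) = (\<chi> i j. minkowski i j)"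
proof -
  have 1: "(\<chi> i j. minkowski i j) ** (\<chi> i j. minkowski i j) = (mat 1 :: real^3^3)"
    by (simp add: vec_eq_iff matrix_matrix_mult_def forall_3 sum_3 mat_def)
  have "B = (\<chi> i j. minkowski i j)" if "(\<chi> i j. minkowski i j) ** B = mat 1" for B :: "real^3^3"
    using that matrix_mul_assoc[of "\<chi> i j. minkowski i j" "\<chi> i j. minkowski i j" B] 1 by simp
  with 1 show ?thesis unfolding matrix_inv_def by (intro some_equality) auto
qed

lemma scalar_curvature_value: "scalar_curvature A g D e p = \<alpha>\<^sup>2 / 2 - 2 * \<alpha> * \<beta>"
proof -
  have "ricci A D e (e i) (e j) p = ricci_coords (axis i 1) (axis j 1)" for i j
    by (metis frame_axis ricci_comb)
  then show ?thesis
    by (simp add: scalar_curvature_def gram_minkowski matrix_inv_minkowski sum_3 ricci_coords_def)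
qed

lemma metric_comb: "metric_on g (frame_comb e a) (frame_comb e b) p = a$1 * b$1 + a$2 * b$2 - a$3 * b$3"
  by (subst metric_on_frame_coord) (simp_all add: frame_comb_tangent sum_3)

definition schouten_coords :: "real^3 \<Rightarrow> real^3 \<Rightarrow> real" where
  "schouten_coords a b = ricci_coords a b - (\<alpha>\<^sup>2 / 2 - 2 * \<alpha> * \<beta>) / 4 * (a$1 * b$1 + a$2 * b$2 - a$3 * b$3)"

lemma schouten_comb: "schouten A g D e (frame_comb e a) (frame_comb e b) = (\<lambda>p. schouten_coords a b)"
  by (simp add: schouten_def schouten_coords_def ricci_comb scalar_curvature_value metric_comb fun_eq_iff)

lemma cotton3_comb: "cotton3 A g D e (frame_comb e a) (frame_comb e b) (frame_comb e c) p =
    schouten_coords (nabla_coords b a) c + schouten_coords a (nabla_coords b c) - schouten_coords (nabla_coords a b) c - schouten_coords b (nabla_coords a c)"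
  by (simp add: cotton3_def cov_deriv_def D_comb schouten_comb tangent_const[OF frame_comb_tangent])

definition cotton3_coords :: "3 \<Rightarrow> 3 \<Rightarrow> 3 \<Rightarrow> real" where
  "cotton3_coords i j k = schouten_coords (nabla_coords (axis j 1) (axis i 1)) (axis k 1) + schouten_coords (axis i 1) (nabla_coords (axis j 1) (axis k 1))
    - schouten_coords (nabla_coords (axis i 1) (axis j 1)) (axis k 1) - schouten_coords (axis j 1) (nabla_coords (axis i 1) (axis k 1))"

lemma cotton3_frame: "cotton3 A g D e (e i) (e j) (e k) p = cotton3_coords i j k"
  unfolding cotton3_coords_def by (metis frame_axis cotton3_comb)

definition cotton_p :: real where "cotton_p = 2 * \<beta>\<^sup>2 - \<alpha> * \<beta> - \<alpha>\<^sup>2 / 4"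
definition cotton_q :: real where "cotton_q = \<alpha>\<^sup>2 * (\<beta> - \<alpha>) / 2"

text \<open>
  In the block spanned by \<open>e\<^sub>2, e\<^sub>3\<close> the part \<open>cotton_p\<close> is the coefficient of the square of a null form,
  and \<open>cotton_q\<close> is a multiple of the metric. Since the Cotton tensor is trace-free, the
  entry \<open>11\<close> is \<open>- 2 * cotton_q\<close>.
\<close>
definition cotton_coords :: "3 \<Rightarrow> 3 \<Rightarrow> real" where
  "cotton_coords i j = (if i = 1 \<and> j = 1 then \<alpha>\<^sup>2 * (\<alpha> - \<beta>) else if i = 2 \<and> j = 2 then cotton_p + cotton_q
    else if i = 3 \<and> j = 3 then cotton_p - cotton_q else if i = 1 \<or> j = 1 then 0 else - cotton_p)"

lemma det_minkowski: "det (\<chi> i j. minkowski i j :: real^3^3) = -1"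
  by (simp add: det_3)

lemma levi_civita_symbol_sum:
  "(\<Sum>n\<in>UNIV. \<Sum>m\<in>UNIV. \<Sum>l\<in>UNIV. F n m * levi_civita_symbol n m l * G l) =
    (F 1 2 - F 2 1) * G 3 + (F 2 3 - F 3 2) * G 1 + (F 3 1 - F 1 3) * G 2"
  by (simp add: sum_3 levi_civita_symbol_def algebra_simps)

lemma cotton_component_value: "cotton_component A g D e i j p = cotton_coords i j"
proof -
  have v: "cotton3_coords 1 2 k - cotton3_coords 2 1 k = 2 * cotton3_coords 1 2 k" "cotton3_coords 2 3 k - cotton3_coords 3 2 k = 2 * cotton3_coords 2 3 k"
    "cotton3_coords 3 1 k - cotton3_coords 1 3 k = 2 * cotton3_coords 3 1 k" for k
    by (simp_all add: cotton3_coords_def)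
  have "cotton_component A g D e i j p
      = cotton3_coords 1 2 i * minkowski 3 j + cotton3_coords 2 3 i * minkowski 1 j + cotton3_coords 3 1 i * minkowski 2 j"
    unfolding cotton_component_def gram_minkowski det_minkowski cotton3_frame vec_lambda_beta
      levi_civita_symbol_sum v by simp
  also have "\<dots> = cotton_coords i j"
    using exhaust_3[of i] exhaust_3[of j]
    by (auto simp: cotton3_coords_def cotton_coords_def cotton_p_def cotton_q_def schouten_coords_def ricci_coords_def nabla_coords_def field_simps
        power2_eq_square power3_eq_cube)
  finally show ?thesis .
qed

lemma cotton_value: "cotton A g D e Y Z p =
    (\<Sum>i\<in>UNIV. \<Sum>j\<in>UNIV. frame_coord e Y p $ i * frame_coord e Z p $ j * cotton_coords i j)"
  by (simp add: cotton_def cotton_component_value)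

lemma cotton_flat_iff: "cotton_flat A g D e \<longleftrightarrow> \<alpha>\<^sup>2 * (\<alpha> - \<beta>) = 0 \<and> cotton_p = 0"
proof
  assume flat: "cotton_flat A g D e"
  have "cotton_coords i j = 0" for i j
  proof -
    have "cotton A g D e (e i) (e j) undefined = 0"
      using flat frame by (simp add: cotton_flat_def)
    moreover have "frame_coord e (e k) undefined = axis k 1" for k
      using frame_coord_comb frame_axis by metis
    ultimately show ?thesis
      using exhaust_3[of i] exhaust_3[of j] by (auto simp: cotton_value sum_3)
  qed
  from this[of 1 1] this[of 2 3] show "\<alpha>\<^sup>2 * (\<alpha> - \<beta>) = 0 \<and> cotton_p = 0"
    by (simp add: cotton_coords_def)
next
  assume z: "\<alpha>\<^sup>2 * (\<alpha> - \<beta>) = 0 \<and> cotton_p = 0"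
  then have "cotton_q = 0" by (auto simp: cotton_q_def)
  then have "cotton_coords i j = 0" for i j using z by (simp add: cotton_coords_def)
  then show "cotton_flat A g D e" by (simp add: cotton_flat_def cotton_value)
qed

lemma cotton_soliton_components: "cotton_soliton A g D e (frame_comb e x) c \<longleftrightarrow>
    (\<forall>i j. cotton_coords i j - (minkowski j j * bracket_coords x (axis i 1) $ j + minkowski i i * bracket_coords x (axis j 1) $ i)
      = c * minkowski i j)" (is "_ \<longleftrightarrow> (\<forall>i j. ?F i j = _)")
proof -
  have br: "lie_bracket A (frame_comb e x) (e i) = frame_comb e (bracket_coords x (axis i 1))" for i
    by (metis frame_axis lie_bracket_comb)
  have l: "lie_deriv_metric A g (frame_comb e x) Y Z p + cotton A g D e Y Z p =
      (\<Sum>i\<in>UNIV. \<Sum>j\<in>UNIV. frame_coord e Y p $ i * frame_coord e Z p $ j * ?F i j)"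
    if "vector_field A Y" "vector_field A Z" for Y Z p
    unfolding lie_deriv_metric_frame[OF vector_field_frame_comb that br] cotton_value
    by (simp add: sum_subtractf right_diff_distrib)
  have m: "metric_on g Y Z p = (\<Sum>i\<in>UNIV. \<Sum>j\<in>UNIV. frame_coord e Y p $ i * frame_coord e Z p $ j * minkowski i j)"
    if "vector_field A Y" "vector_field A Z" for Y Z p
    using metric_on_frame_coord[of Y p Z] vector_field_tangent that by (simp add: sum_3)
  show ?thesis
  proof
    assume sol: "cotton_soliton A g D e (frame_comb e x) c"
    show "\<forall>i j. ?F i j = c * minkowski i j"
    proof (intro allI)
      fix i j
      have "frame_coord e (e k) undefined = axis k 1" for k
        using frame_coord_comb frame_axis by metis
      moreover have "lie_deriv_metric A g (frame_comb e x) (e i) (e j) undefined + cotton A g D e (e i) (e j) undefined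
          = c * metric_on g (e i) (e j) undefined"
        using sol frame by (simp add: cotton_soliton_def)
      ultimately show "?F i j = c * minkowski i j"
        unfolding l[OF frame frame] orthonormal
        using exhaust_3[of i] exhaust_3[of j] by (auto simp: sum_3)
    qed
  next
    assume F: "\<forall>i j. ?F i j = c * minkowski i j"
    show "cotton_soliton A g D e (frame_comb e x) c"
      unfolding cotton_soliton_def
    proof (intro conjI allI impI)
      show "vector_field A (frame_comb e x)" by (rule vector_field_frame_comb)
      fix Y Z p assume YZ: "vector_field A Y \<and> vector_field A Z"
      have "(\<Sum>i\<in>UNIV. \<Sum>j\<in>UNIV. frame_coord e Y p $ i * frame_coord e Z p $ j * ?F i j)
          = (\<Sum>i\<in>UNIV. \<Sum>j\<in>UNIV. frame_coord e Y p $ i * frame_coord e Z p $ j * (c * minkowski i j))"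
        using F by (intro sum.cong refl) simp
      also have "\<dots> = c * metric_on g Y Z p"
        using YZ by (simp only: m sum_distrib_left mult_ac)
      finally show "lie_deriv_metric A g (frame_comb e x) Y Z p + cotton A g D e Y Z p = c * metric_on g Y Z p"
        using l YZ by simp
    qed
  qed
qed

text \<open>
  The entries \<open>22\<close>, \<open>23\<close> and \<open>33\<close> of the soliton equation give \<open>c = cotton_q\<close> and \<open>x\<^sub>1 = cotton_p\<close>,
  whereas the entry \<open>11\<close> gives \<open>c = - 2 * cotton_q\<close>; so \<open>c = 0\<close>. The last two conditions
  are combinations of the entries \<open>12\<close> and \<open>13\<close>.
\<close>
lemma cotton_soliton_iff: "cotton_soliton A g D e (frame_comb e x) c \<longleftrightarrow>
    c = 0 \<and> \<alpha>\<^sup>2 * (\<alpha> - \<beta>) = 0 \<and> x $ 1 = cotton_p \<and> x $ 2 - x $ 3 = 2 * (\<beta> - \<alpha>) * x $ 3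
    \<and> (\<beta> - \<alpha>) * (x $ 2 - x $ 3) = 0"
proof -
  have "cotton_soliton A g D e (frame_comb e x) c \<longleftrightarrow>
     \<alpha>\<^sup>2 * (\<alpha> - \<beta>) = c \<and> x$2 / 2 + x$3 * (\<alpha> - \<beta> - 1/2) = 0 \<and> x$2 * (\<beta> - \<alpha> - 1/2) + x$3 / 2 = 0
     \<and> cotton_p + cotton_q - x$1 = c \<and> x$1 - cotton_p = 0 \<and> cotton_p - cotton_q - x$1 = - c"
    unfolding cotton_soliton_components forall_3
    by (auto simp: cotton_coords_def bracket_coords_def algebra_simps)
  also have "\<dots> \<longleftrightarrow> c = 0 \<and> \<alpha>\<^sup>2 * (\<alpha> - \<beta>) = 0 \<and> x $ 1 = cotton_p \<and> x $ 2 - x $ 3 = 2 * (\<beta> - \<alpha>) * x $ 3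
    \<and> (\<beta> - \<alpha>) * (x $ 2 - x $ 3) = 0"
  proof -
    have "cotton_q = - (\<alpha>\<^sup>2 * (\<alpha> - \<beta>)) / 2" by (simp add: cotton_q_def algebra_simps)
    then show ?thesis by (auto simp: algebra_simps)
  qed
  finally show ?thesis .
qed

end

section \<open>One-parameter subgroups and the group E(1,1)\<close>

text \<open>
  Every real number is a natural multiple of a small one.
\<close>
lemma real_local_to_global:
  fixes P :: "real \<Rightarrow> bool"
  assumes "r > 0" "\<And>t. \<bar>t\<bar> < r \<Longrightarrow> P t" "\<And>t u. P t \<Longrightarrow> P u \<Longrightarrow> P (t + u)"
  shows "P t"
proof -
  have mult: "P (real n * u)" if "P u" for n u
  proof (induction n)
    case 0
    show ?case using assms(1,2) by simp
  next
    case (Suc n)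
    then show ?case using assms(3)[OF Suc that] by (simp add: algebra_simps)
  qed
  obtain n :: nat where n: "\<bar>t\<bar> / r < real n" using reals_Archimedean2 by blast
  have "n > 0" using n assms(1) by (cases n) (auto simp: divide_less_0_iff)
  then have "\<bar>t / real n\<bar> < r" using n assms(1) by (simp add: field_simps)
  from mult[OF assms(2)[OF this], of n] show "P t" using \<open>n > 0\<close> by simp
qed

text \<open>
  The extension is \<open>t \<mapsto> \<gamma>(t/n)\<^sup>n\<close> for any \<open>n\<close> large enough that \<open>t/n\<close> is small. Passing from \<open>n\<close> to \<open>n m\<close>
  does not change the value, so any two admissible exponents agree through their product.
\<close>
lemma (in group) one_parameter_extension:
  fixes \<gamma> :: "real \<Rightarrow> 'a"
  assumes r: "r > 0" and c: "\<And>t. \<gamma> t \<in> carrier G"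
    and loc: "\<And>a b. \<bar>a\<bar> < r \<Longrightarrow> \<bar>b\<bar> < r \<Longrightarrow> \<bar>a + b\<bar> < r \<Longrightarrow> \<gamma> (a + b) = \<gamma> a \<otimes> \<gamma> b"
  obtains \<phi> where "\<And>t. \<phi> t \<in> carrier G" "\<And>a b. \<phi> (a + b) = \<phi> a \<otimes> \<phi> b"
    "\<And>t. \<bar>t\<bar> < r \<Longrightarrow> \<phi> t = \<gamma> t"
proof -
  have pow: "\<gamma> (real n * u) = \<gamma> u [^] n" if "\<bar>real n * u\<bar> < r" for n u
    using that
  proof (induction n)
    case 0
    have "\<gamma> (0 + 0) = \<gamma> 0 \<otimes> \<gamma> 0" by (rule loc) (use r in simp_all)
    then show ?case using c l_cancel_one by (metis add_0 mult_zero_left nat_pow_0 of_nat_0)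
  next
    case (Suc n)
    have 1: "\<bar>real n * u\<bar> \<le> \<bar>real (Suc n) * u\<bar>" "\<bar>u\<bar> \<le> \<bar>real (Suc n) * u\<bar>"
      by (simp_all add: abs_mult mult_right_mono) (simp add: algebra_simps)
    have eq: "real n * u + u = real (Suc n) * u" by (simp add: algebra_simps)
    have "\<gamma> (real n * u + u) = \<gamma> (real n * u) \<otimes> \<gamma> u"
      by (rule loc) (use 1 Suc.prems eq in linarith)+
    then show ?case using Suc 1 by (simp add: eq)
  qed
  \<comment> \<open>The candidate value of the extension at \<open>t\<close> that uses \<open>n\<close> steps.\<close>
  define Q where "Q = (\<lambda>t n. \<gamma> (t / real n) [^] (n::nat))"
  have refine: "Q t n = Q t (n * m)" if "n > 0" "m > 0" "\<bar>t\<bar> < r * real n" for t n m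
  proof -
    have eq: "t / real n = real m * (t / real (n * m))" using that by simp
    have "\<bar>t / real n\<bar> < r" using that by (simp add: field_simps)
    then have "\<gamma> (t / real n) = \<gamma> (t / real (n * m)) [^] m" using pow[of m] eq by metis
    then show ?thesis by (simp add: Q_def nat_pow_pow c mult.commute)
  qed
  have indep: "Q t n = Q t m" if "n > 0" "m > 0" "\<bar>t\<bar> < r * real n" "\<bar>t\<bar> < r * real m" for t n m
    using refine[of n m t] refine[of m n t] that by (simp add: mult.commute)
  define N where "N = (\<lambda>t. Suc (nat \<lceil>\<bar>t\<bar> / r\<rceil>))"
  have N: "N t > 0" "\<bar>t\<bar> < r * real (N t)" for t
  proof -
    have "\<bar>t\<bar> / r < real (N t)" unfolding N_def by linarith
    then show "\<bar>t\<bar> < r * real (N t)" using r by (simp add: field_simps)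
  qed (simp add: N_def)
  define \<phi> where "\<phi> = (\<lambda>t. Q t (N t))"
  have \<phi>: "\<phi> t = Q t n" if "n > 0" "\<bar>t\<bar> < r * real n" for t n
    unfolding \<phi>_def by (rule indep) (use that N in auto)
  show thesis
  proof (rule that[of \<phi>])
    show "\<phi> t \<in> carrier G" for t by (simp add: \<phi>_def Q_def c)
    show "\<phi> t = \<gamma> t" if "\<bar>t\<bar> < r" for t
      using \<phi>[of 1 t] that by (simp add: Q_def c)
    fix a b
    define n where "n = N (\<bar>a\<bar> + \<bar>b\<bar>)"
    have n: "n > 0" "\<bar>a\<bar> + \<bar>b\<bar> < r * real n" using N[of "\<bar>a\<bar> + \<bar>b\<bar>"] by (simp_all add: n_def)
    have small: "\<bar>a / real n\<bar> < r" "\<bar>b / real n\<bar> < r" "\<bar>a / real n + b / real n\<bar> < r"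
      using n by (simp_all add: field_simps)
    have "\<gamma> (a / real n) \<otimes> \<gamma> (b / real n) = \<gamma> (b / real n) \<otimes> \<gamma> (a / real n)"
      using loc[OF small] loc[of "b / real n" "a / real n"] small by (simp add: add.commute)
    then have "(\<gamma> (a / real n) \<otimes> \<gamma> (b / real n)) [^] n = \<gamma> (a / real n) [^] n \<otimes> \<gamma> (b / real n) [^] n"
      by (rule pow_mult_distrib) (simp_all add: c)
    then have "Q (a + b) n = Q a n \<otimes> Q b n"
      using loc[OF small] by (simp add: Q_def add_divide_distrib)
    then show "\<phi> (a + b) = \<phi> a \<otimes> \<phi> b"
      using \<phi>[OF n(1), of a] \<phi>[OF n(1), of b] \<phi>[OF n(1), of "a + b"] n(2) by simp
  qed
qed

abbreviation E11_mult :: "real^3 \<Rightarrow> real^3 \<Rightarrow> real^3" (infixl "\<star>" 70) where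
  "a \<star> b \<equiv> a \<otimes>\<^bsub>E11\<^esub> b"

lemma E11_mult_nth [simp]:
  "(a \<star> b) $ 1 = a $ 1 + b $ 1" "(a \<star> b) $ 2 = a $ 2 + exp (a $ 1) * b $ 2"
  "(a \<star> b) $ 3 = a $ 3 + exp (- a $ 1) * b $ 3"
  by (simp_all add: E11_def)

lemma E11_carrier [simp]: "carrier E11 = UNIV"
  by (simp add: E11_def)

definition E11_inverse :: "real^3 \<Rightarrow> real^3" where
  "E11_inverse a = vec3 (- a $ 1) (- exp (- a $ 1) * a $ 2) (- exp (a $ 1) * a $ 3)"

lemma E11_inverse_left: "E11_inverse a \<star> a = 0"
  by (simp add: E11_inverse_def vec3_eq_iff)

lemma E11_assoc: "(a \<star> b) \<star> c = a \<star> (b \<star> c)"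
  by (simp add: vec3_eq_iff algebra_simps exp_add exp_diff exp_minus field_simps)

lemma E11_zero_left [simp]: "0 \<star> a = a" and E11_zero_right [simp]: "a \<star> 0 = a"
  by (simp_all add: vec3_eq_iff)

lemma E11_inverse_right: "a \<star> E11_inverse a = 0"
  by (simp add: E11_inverse_def vec3_eq_iff exp_minus field_simps)

lemma continuous_on_vec3:
  fixes f :: "'a::topological_space \<Rightarrow> real^3"
  assumes "\<And>i. continuous_on S (\<lambda>x. f x $ i)"
  shows "continuous_on S f"
  using continuous_on_vec_lambda[of S "\<lambda>i x. f x $ i"] assms by (simp add: vec_lambda_eta)

lemma continuous_on_E11_mult:
  assumes "continuous_on S f" "continuous_on S h"
  shows "continuous_on S (\<lambda>x. f x \<star> h x)"
proof (rule continuous_on_vec3)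
  fix i
  have "continuous_on S (\<lambda>x. f x $ i)" "continuous_on S (\<lambda>x. h x $ i)" for i
    using assms by (auto intro: continuous_on_component)
  then show "continuous_on S (\<lambda>x. (f x \<star> h x) $ i)"
    using exhaust_3[of i]
    by (auto intro!: continuous_on_add continuous_on_mult continuous_on_exp continuous_on_minus)
qed

lemma continuous_on_E11_inverse:
  assumes "continuous_on S f"
  shows "continuous_on S (\<lambda>x. E11_inverse (f x))"
proof (rule continuous_on_vec3)
  fix i
  have "continuous_on S (\<lambda>x. f x $ i)" for i
    using assms by (auto intro: continuous_on_component)
  then show "continuous_on S (\<lambda>x. E11_inverse (f x) $ i)"
    using exhaust_3[of i]
    by (auto simp: E11_inverse_def intro!: continuous_on_mult continuous_on_exp continuous_on_minus)
qed

locale topological_group_type = group G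
  for G :: "'g::topological_space monoid" (structure) +
  assumes carrier [simp]: "carrier G = UNIV"
    and continuous_mult: "continuous_on UNIV (\<lambda>(x, y). x \<otimes> y)"
    and continuous_inv: "continuous_on UNIV (\<lambda>x. inv x)"
begin

lemma continuous_on_mult2:
  "continuous_on S f \<Longrightarrow> continuous_on S h \<Longrightarrow> continuous_on S (\<lambda>x. f x \<otimes> h x)"
  using continuous_on_compose2[OF continuous_mult continuous_on_Pair, of S f h] by simp

lemma continuous_on_inv2: "continuous_on S f \<Longrightarrow> continuous_on S (\<lambda>x. inv (f x))"
  using continuous_on_compose2[OF continuous_inv, of S f] by simp

lemma open_left_translate: "open W \<Longrightarrow> open ((\<lambda>x. a \<otimes> x) -` W)"
  by (intro open_vimage continuous_on_mult2 continuous_on_const continuous_on_id)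

end

text \<open>
  A homeomorphism \<open>\<sigma>\<close> from a neighbourhood of the unit of \<open>G\<close> to a neighbourhood of \<open>0\<close> in \<open>E(1,1)\<close> that
  is multiplicative where this makes sense. The smaller neighbourhood \<open>W1\<close> keeps the products of its
  elements in the domain of \<open>\<sigma>\<close>.
\<close>
locale E11_local_isomorphism = topological_group_type G
  for G :: "'g::topological_space monoid" (structure) +
  fixes W0 W1 :: "'g set" and V0 :: "(real^3) set" and \<sigma> :: "'g \<Rightarrow> real^3" and s0 :: "real^3 \<Rightarrow> 'g"
  assumes conn: "connected (UNIV :: 'g set)"
    and simply: "simply_connected (UNIV :: 'g set)"
    and hom0: "homeomorphism W0 V0 \<sigma> s0"
    and W0: "open W0" and V0: "open V0"
    and W1: "open W1" "\<one> \<in> W1" "W1 \<subseteq> W0" and \<sigma>_one: "\<sigma> \<one> = 0"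
    and W1_mult: "\<And>a b. a \<in> W1 \<Longrightarrow> b \<in> W1 \<Longrightarrow> a \<otimes> b \<in> W0"
    and \<sigma>_mult: "\<And>a b. a \<in> W1 \<Longrightarrow> b \<in> W1 \<Longrightarrow> \<sigma> (a \<otimes> b) = \<sigma> a \<star> \<sigma> b"
begin

lemma s0_\<sigma>: "w \<in> W0 \<Longrightarrow> s0 (\<sigma> w) = w" and \<sigma>_s0: "v \<in> V0 \<Longrightarrow> \<sigma> (s0 v) = v"
  using hom0 by (auto simp: homeomorphism_def)

definition V1 where "V1 = \<sigma> ` W1"

lemma V1: "open V1" "0 \<in> V1" "V1 \<subseteq> V0"
proof -
  have "openin (top_of_set V0) V1"
    unfolding V1_def using homeomorphism_imp_open_map[OF hom0] W1(1,3) by (simp add: open_subset)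
  then show "open V1" "V1 \<subseteq> V0" using V0 openin_open_eq openin_imp_subset by blast+
  show "0 \<in> V1" unfolding V1_def using W1 \<sigma>_one by force
qed

lemma s0_mult: "u \<in> V1 \<Longrightarrow> v \<in> V1 \<Longrightarrow> s0 (u \<star> v) = s0 u \<otimes> s0 v"
  unfolding V1_def using s0_\<sigma> W1 W1_mult \<sigma>_mult by (metis (no_types, lifting) imageE subsetD)

text \<open>
  Boxes suit the factorisation of \<open>E(1,1)\<close> into one-parameter subgroups better than balls.
\<close>
lemma small_box: obtains r where "r > 0"
  "\<And>v. \<bar>v $ 1\<bar> < r \<Longrightarrow> \<bar>v $ 2\<bar> < r \<Longrightarrow> \<bar>v $ 3\<bar> < r \<Longrightarrow> v \<in> V1"
proof -
  obtain d where d: "d > 0" "ball 0 d \<subseteq> V1" using V1 openE by blast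
  show thesis
  proof (rule that[of "d / 3"])
    fix v :: "real^3" assume "\<bar>v $ 1\<bar> < d / 3" "\<bar>v $ 2\<bar> < d / 3" "\<bar>v $ 3\<bar> < d / 3"
    then have "norm v < d" using norm_le_l1_cart[of v] by (simp add: sum_3)
    then show "v \<in> V1" using d by auto
  qed (use d in simp)
qed

text \<open>
  Every element of \<open>E(1,1)\<close> factors as \<open>(t, x, y) = (0, x, 0)(0, 0, y)(t, 0, 0)\<close>, so a homomorphism is
  given by three one-parameter subgroups \<open>X, Y, Z\<close> of \<open>G\<close> with \<open>Y(x) Z(y) = Z(y) Y(x)\<close>,
  \<open>X(t) Y(x) = Y(exp t x) X(t)\<close> and \<open>X(t) Z(y) = Z(exp (- t) y) X(t)\<close>. For small parameters these relations
  hold since \<open>s0\<close> is multiplicative, and each of them is stable under addition of parameters.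
\<close>
lemma global_homomorphism:
  obtains s N where "\<And>u v. s (u \<star> v) = s u \<otimes> s v" "open N" "0 \<in> N" "N \<subseteq> V1" "\<And>v. v \<in> N \<Longrightarrow> s v = s0 v"
proof -
  obtain r where r: "r > 0" and box: "\<And>v. \<bar>v $ 1\<bar> < r \<Longrightarrow> \<bar>v $ 2\<bar> < r \<Longrightarrow> \<bar>v $ 3\<bar> < r \<Longrightarrow> v \<in> V1"
    using small_box by blast
  have mult: "s0 (u \<star> v) = s0 u \<otimes> s0 v"
    if "\<bar>u $ 1\<bar> < r" "\<bar>u $ 2\<bar> < r" "\<bar>u $ 3\<bar> < r" "\<bar>v $ 1\<bar> < r" "\<bar>v $ 2\<bar> < r" "\<bar>v $ 3\<bar> < r" for u v
    using that by (intro s0_mult box)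
  have ext: "\<exists>X. (\<forall>a b. X (a + b) = X a \<otimes> X b) \<and> (\<forall>t. \<bar>t\<bar> < r \<longrightarrow> X t = s0 (\<iota> t))"
    if \<iota>: "\<And>a b. \<iota> (a + b) = \<iota> a \<star> \<iota> b"
      "\<And>a. \<bar>a\<bar> < r \<Longrightarrow> \<bar>\<iota> a $ 1\<bar> < r \<and> \<bar>\<iota> a $ 2\<bar> < r \<and> \<bar>\<iota> a $ 3\<bar> < r" for \<iota>
  proof -
    obtain X where "\<And>a b. X (a + b) = X a \<otimes> X b" "\<And>t. \<bar>t\<bar> < r \<Longrightarrow> X t = s0 (\<iota> t)"
      by (rule one_parameter_extension[OF r, of "\<lambda>t. s0 (\<iota> t)"]) (use \<iota> mult in auto)
    then show ?thesis by blast
  qed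
  obtain X where X: "\<And>a b. X (a + b) = X a \<otimes> X b" "\<And>t. \<bar>t\<bar> < r \<Longrightarrow> X t = s0 (vec3 t 0 0)"
    using ext[of "\<lambda>t. vec3 t 0 0"] r by (auto simp: vec3_eq_iff)
  obtain Y where Y: "\<And>a b. Y (a + b) = Y a \<otimes> Y b" "\<And>t. \<bar>t\<bar> < r \<Longrightarrow> Y t = s0 (vec3 0 t 0)"
    using ext[of "\<lambda>t. vec3 0 t 0"] r by (auto simp: vec3_eq_iff)
  obtain Z where Z: "\<And>a b. Z (a + b) = Z a \<otimes> Z b" "\<And>t. \<bar>t\<bar> < r \<Longrightarrow> Z t = s0 (vec3 0 0 t)"
    using ext[of "\<lambda>t. vec3 0 0 t"] r by (auto simp: vec3_eq_iff)
  have [simp]: "x \<otimes> (y \<otimes> z) = x \<otimes> y \<otimes> z" for x y z by (simp add: m_assoc)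
  \<comment> \<open>Exchanges two adjacent factors in a product bracketed to the left.\<close>
  have rewr: "p \<otimes> x \<otimes> y = p \<otimes> y' \<otimes> x'" if "x \<otimes> y = y' \<otimes> x'" for p x y x' y'
    using that by (metis m_assoc carrier UNIV_I)
  have YZ: "Y a \<otimes> Z b = Z b \<otimes> Y a" for a b
  proof -
    have small: "Y a \<otimes> Z b = Z b \<otimes> Y a" if "\<bar>a\<bar> < r" "\<bar>b\<bar> < r" for a b
    proof -
      have "vec3 0 a 0 \<star> vec3 0 0 b = vec3 0 0 b \<star> vec3 0 a 0" by (simp add: vec3_eq_iff)
      then show ?thesis
        using mult[of "vec3 0 a 0" "vec3 0 0 b"] mult[of "vec3 0 0 b" "vec3 0 a 0"] that r
        by (simp add: Y(2) Z(2))
    qed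
    have "\<forall>b. Y a \<otimes> Z b = Z b \<otimes> Y a"
    proof (rule real_local_to_global[OF r, of "\<lambda>a. \<forall>b. Y a \<otimes> Z b = Z b \<otimes> Y a"])
      fix a assume a: "\<bar>a\<bar> < r"
      show "\<forall>b. Y a \<otimes> Z b = Z b \<otimes> Y a"
      proof
        fix b show "Y a \<otimes> Z b = Z b \<otimes> Y a"
          by (rule real_local_to_global[OF r, of "\<lambda>b. Y a \<otimes> Z b = Z b \<otimes> Y a"])
            (use small a in \<open>simp_all add: Z(1)\<close>, metis rewr)
      qed
    next
      fix a a' assume "\<forall>b. Y a \<otimes> Z b = Z b \<otimes> Y a" "\<forall>b. Y a' \<otimes> Z b = Z b \<otimes> Y a'"
      then show "\<forall>b. Y (a + a') \<otimes> Z b = Z b \<otimes> Y (a + a')"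
        by (simp add: Y(1)) (metis rewr)
    qed
    then show ?thesis by blast
  qed
  \<comment> \<open>The relation is extended first in \<open>a\<close>, where the admissible size depends on \<open>t\<close>, and then in \<open>t\<close>.\<close>
  have conj: "X t \<otimes> Q a = Q (c t * a) \<otimes> X t"
    if Q: "\<And>a b. Q (a + b) = Q a \<otimes> Q b" and c: "\<And>t u. c (t + u) = c t * c u" "\<And>t. c t > 0"
      and small: "\<And>t a. \<bar>t\<bar> < r \<Longrightarrow> \<bar>a\<bar> < r \<Longrightarrow> \<bar>c t * a\<bar> < r \<Longrightarrow> X t \<otimes> Q a = Q (c t * a) \<otimes> X t"
    for t a :: real and Q c
  proof -
    have "\<forall>a. X t \<otimes> Q a = Q (c t * a) \<otimes> X t"
    proof (rule real_local_to_global[OF r, of "\<lambda>t. \<forall>a. X t \<otimes> Q a = Q (c t * a) \<otimes> X t"])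
      fix t assume t: "\<bar>t\<bar> < r"
      show "\<forall>a. X t \<otimes> Q a = Q (c t * a) \<otimes> X t"
      proof
        fix a
        have r': "min r (r / c t) > 0" using r c by simp
        show "X t \<otimes> Q a = Q (c t * a) \<otimes> X t"
        proof (rule real_local_to_global[OF r', of "\<lambda>a. X t \<otimes> Q a = Q (c t * a) \<otimes> X t"])
          fix a assume a: "\<bar>a\<bar> < min r (r / c t)"
          then have "\<bar>c t * a\<bar> < r" using c(2)[of t] by (simp add: abs_mult field_simps)
          then show "X t \<otimes> Q a = Q (c t * a) \<otimes> X t" using small t a by simp
        next
          fix a b assume "X t \<otimes> Q a = Q (c t * a) \<otimes> X t" "X t \<otimes> Q b = Q (c t * b) \<otimes> X t"
          then show "X t \<otimes> Q (a + b) = Q (c t * (a + b)) \<otimes> X t"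
            by (simp add: Q distrib_left) (metis rewr)
        qed
      qed
    next
      fix t u assume "\<forall>a. X t \<otimes> Q a = Q (c t * a) \<otimes> X t" "\<forall>a. X u \<otimes> Q a = Q (c u * a) \<otimes> X u"
      then show "\<forall>a. X (t + u) \<otimes> Q a = Q (c (t + u) * a) \<otimes> X (t + u)"
        by (simp add: X(1) c(1) mult.assoc) (metis rewr)
    qed
    then show ?thesis by blast
  qed
  have XY: "X t \<otimes> Y a = Y (exp t * a) \<otimes> X t" for t a
  proof (rule conj[of Y exp])
    fix t a :: real assume 1: "\<bar>t\<bar> < r" "\<bar>a\<bar> < r" "\<bar>exp t * a\<bar> < r"
    have "vec3 t 0 0 \<star> vec3 0 a 0 = vec3 0 (exp t * a) 0 \<star> vec3 t 0 0" by (simp add: vec3_eq_iff)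
    then show "X t \<otimes> Y a = Y (exp t * a) \<otimes> X t"
      using mult[of "vec3 t 0 0" "vec3 0 a 0"] mult[of "vec3 0 (exp t * a) 0" "vec3 t 0 0"] 1 r
      by (simp add: X(2) Y(2))
  qed (simp_all add: Y(1) exp_add)
  have XZ: "X t \<otimes> Z a = Z (exp (- t) * a) \<otimes> X t" for t a
  proof (rule conj[of Z "\<lambda>t. exp (- t)"])
    fix t a :: real assume 1: "\<bar>t\<bar> < r" "\<bar>a\<bar> < r" "\<bar>exp (- t) * a\<bar> < r"
    have "vec3 t 0 0 \<star> vec3 0 0 a = vec3 0 0 (exp (- t) * a) \<star> vec3 t 0 0" by (simp add: vec3_eq_iff)
    then show "X t \<otimes> Z a = Z (exp (- t) * a) \<otimes> X t"
      using mult[of "vec3 t 0 0" "vec3 0 0 a"] mult[of "vec3 0 0 (exp (- t) * a)" "vec3 t 0 0"] 1 r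
      by (simp add: X(2) Z(2))
  qed (simp_all add: Z(1) exp_add exp_diff exp_minus field_simps)
  define s where "s = (\<lambda>v::real^3. Y (v $ 2) \<otimes> Z (v $ 3) \<otimes> X (v $ 1))"
  show thesis
  proof (rule that[of s "{v. \<forall>i. \<bar>v $ i\<bar> < r}"])
    fix u v
    have "s (u \<star> v) = Y (u$2) \<otimes> Y (exp (u$1) * v$2) \<otimes> Z (u$3) \<otimes> Z (exp (- u$1) * v$3) \<otimes> X (u$1) \<otimes> X (v$1)"
      by (simp add: s_def Y(1) Z(1) X(1))
    also have "\<dots> = Y (u$2) \<otimes> Z (u$3) \<otimes> Y (exp (u$1) * v$2) \<otimes> Z (exp (- u$1) * v$3) \<otimes> X (u$1) \<otimes> X (v$1)"
      by (simp add: rewr[OF YZ])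
    also have "\<dots> = Y (u$2) \<otimes> Z (u$3) \<otimes> Y (exp (u$1) * v$2) \<otimes> X (u$1) \<otimes> Z (v$3) \<otimes> X (v$1)"
      by (simp add: rewr[OF XZ])
    also have "\<dots> = Y (u$2) \<otimes> Z (u$3) \<otimes> X (u$1) \<otimes> Y (v$2) \<otimes> Z (v$3) \<otimes> X (v$1)"
      by (simp add: rewr[OF XY])
    finally show "s (u \<star> v) = s u \<otimes> s v" by (simp add: s_def)
  next
    have "{v. \<forall>i. \<bar>v $ i\<bar> < r} = (\<Inter>i\<in>UNIV. {v :: real^3. \<bar>v $ i\<bar> < r})" by auto
    also have "open \<dots>"
      by (intro open_INT finite ballI open_Collect_less continuous_intros)
    finally show "open {v :: real^3. \<forall>i. \<bar>v $ i\<bar> < r}" .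
    show "0 \<in> {v :: real^3. \<forall>i. \<bar>v $ i\<bar> < r}" using r by simp
    show "{v. \<forall>i. \<bar>v $ i\<bar> < r} \<subseteq> V1" using box by blast
    fix v :: "real^3" assume v: "v \<in> {v. \<forall>i. \<bar>v $ i\<bar> < r}"
    have "v = vec3 0 (v$2) (v$3) \<star> vec3 (v$1) 0 0" "vec3 0 (v$2) (v$3) = vec3 0 (v$2) 0 \<star> vec3 0 0 (v$3)"
      by (simp_all add: vec3_eq_iff)
    then have "s0 v = s0 (vec3 0 (v$2) 0) \<otimes> s0 (vec3 0 0 (v$3)) \<otimes> s0 (vec3 (v$1) 0 0)"
      using mult[of "vec3 0 (v$2) (v$3)" "vec3 (v$1) 0 0"] mult[of "vec3 0 (v$2) 0" "vec3 0 0 (v$3)"] v r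
      by simp
    then show "s v = s0 v" using v by (simp add: s_def X(2) Y(2) Z(2))
  qed
qed

end

section \<open>From a local to a global isomorphism\<close>

text \<open>
  A Lebesgue number argument: on a compact set, \<open>dist\<close> has a positive minimum over the pairs that \<open>q\<close>
  sends outside \<open>W\<close>. The bound is expressed by \<open>norm w / n\<close>, the step length when the
  segment from \<open>0\<close> to \<open>w\<close> is cut into \<open>n\<close> pieces.
\<close>
lemma compact_uniform_subdivision:
  fixes q :: "'b::real_normed_vector \<times> 'b \<Rightarrow> 'c::topological_space"
  assumes K: "compact K" and q: "continuous_on (K \<times> K) q" and W: "open W"
    and diag: "\<And>u. u \<in> K \<Longrightarrow> q (u, u) \<in> W"
  obtains n :: nat where "n > 0"
    "\<And>u v w. w \<in> K \<Longrightarrow> u \<in> K \<Longrightarrow> v \<in> K \<Longrightarrow> dist u v \<le> norm w / real n \<Longrightarrow> q (u, v) \<in> W"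
proof -
  obtain R where R: "R > 0" "\<And>w. w \<in> K \<Longrightarrow> norm w \<le> R"
    using compact_imp_bounded[OF K] bounded_pos by blast
  let ?B = "(K \<times> K) \<inter> q -` (- W)"
  have "closedin (top_of_set (K \<times> K)) ?B"
    by (rule continuous_closedin_preimage[OF q]) (use W in auto)
  then have cB: "compact ?B"
    using closedin_compact[OF compact_Times[OF K K]] by blast
  obtain m where m: "m > 0" "\<And>u v. (u, v) \<in> ?B \<Longrightarrow> m \<le> dist u v"
  proof (cases "?B = {}")
    case True
    then show thesis using that[of 1] by auto
  next
    case False
    have "continuous_on ?B (\<lambda>z. dist (fst z) (snd z))" by (intro continuous_intros)
    from continuous_attains_inf[OF cB False this]
    obtain z where z: "z \<in> ?B" "\<And>y. y \<in> ?B \<Longrightarrow> dist (fst z) (snd z) \<le> dist (fst y) (snd y)" by blast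
    have "fst z \<noteq> snd z" using z(1) diag by (cases z) auto
    then show thesis using that[of "dist (fst z) (snd z)"] z(2) by force
  qed
  obtain n :: nat where n: "R / m < real n" using reals_Archimedean2 by blast
  have "n > 0" using n R m by (cases n) (auto simp: divide_less_0_iff)
  have "q (u, v) \<in> W" if "w \<in> K" "u \<in> K" "v \<in> K" "dist u v \<le> norm w / real n" for u v w
  proof (rule ccontr)
    assume "q (u, v) \<notin> W"
    then have "m \<le> dist u v" using m(2) that by simp
    also have "\<dots> \<le> R / real n" using that R \<open>n > 0\<close> by (meson divide_right_mono of_nat_0_le_iff order_trans)
    also have "\<dots> < m" using n m \<open>n > 0\<close> by (simp add: field_simps)
    finally show False by simp
  qed
  then show thesis using that \<open>n > 0\<close> by blast
qed

context E11_local_isomorphism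
begin

lemma cancel: "inv a \<otimes> (a \<otimes> b) = b" "a \<otimes> (inv a \<otimes> b) = b"
  by (simp_all add: m_assoc[symmetric])

text \<open>
  The range of \<open>s\<close> is an open subgroup, hence also closed, and thus all of the connected group \<open>G\<close>. For
  injectivity, a map \<open>k\<close> from a star-shaped compact set to \<open>G\<close> with \<open>k 0 = \<one>\<close> lifts through \<open>s\<close>: cut each
  ray into \<open>n\<close> pieces so short that \<open>(k(ju/n))\<^sup>-\<^sup>1 k((j+1)u/n)\<close> lies in the domain of \<open>\<sigma>\<close>, apply \<open>\<sigma>\<close> and
  multiply. The lift is continuous in \<open>u\<close> because every factor is.

  If \<open>s a = \<one>\<close>, then \<open>c(x) = s(x a)\<close> is a loop and contracts through a homotopy \<open>H\<close> of loops, whose base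
  points may move; \<open>k(t, x) = H(t, 0)\<^sup>-\<^sup>1 H(t, x)\<close> fixes them. Three sides of the square are mapped to
  \<open>\<one>\<close>, so the lift of \<open>k\<close> takes values in the discrete kernel there and is constantly \<open>0\<close>. On the fourth
  side it differs from \<open>x a\<close> by an element of the kernel, so it equals \<open>x a\<close>, and its end point yields \<open>a = 0\<close>.
\<close>
lemma global_isomorphism:
  obtains s N where "\<And>u v. s (u \<star> v) = s u \<otimes> s v" "bij s" "open N" "0 \<in> N" "N \<subseteq> V1"
    "\<And>v. v \<in> N \<Longrightarrow> s v = s0 v" "open (s ` N)" "continuous_on UNIV s"
proof -
  obtain s N where s: "\<And>u v. s (u \<star> v) = s u \<otimes> s v" and N: "open N" "0 \<in> N" "N \<subseteq> V1"
    and sN: "\<And>v. v \<in> N \<Longrightarrow> s v = s0 v"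
    using global_homomorphism by blast
  define W where "W = s ` N"
  have W_s0: "W = s0 ` N" unfolding W_def by (rule image_cong[OF refl sN])
  have NV0: "N \<subseteq> V0" using N(3) V1(3) by blast
  have W: "open W" "W \<subseteq> W0"
  proof -
    have "openin (top_of_set W0) (s0 ` N)"
      using homeomorphism_imp_open_map[OF homeomorphism_symD[OF hom0]] N(1) NV0 by (simp add: open_subset)
    then show "open W" "W \<subseteq> W0" using openin_open_eq[OF W0] by (simp_all add: W_s0)
  qed
  have s_zero: "s 0 = \<one>"
    using s[of 0 0] l_cancel_one[of "s 0" "s 0"] by simp
  have W_one: "\<one> \<in> W" unfolding W_def using N(2) s_zero by (metis imageI)
  have s_\<sigma>: "\<sigma> w \<in> N" "s (\<sigma> w) = w" if "w \<in> W" for w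
  proof -
    obtain v where v: "v \<in> N" "w = s0 v" using \<open>w \<in> W\<close> W_s0 by blast
    then show "\<sigma> w \<in> N" "s (\<sigma> w) = w" using \<sigma>_s0 NV0 sN by auto
  qed
  have cont_\<sigma>: "continuous_on W \<sigma>"
    using continuous_on_subset[OF homeomorphism_cont1[OF hom0] W(2)] .
  have s_inverse: "s (E11_inverse a) = inv (s a)" for a
    using s[of "E11_inverse a" a] inv_equality[of "s (E11_inverse a)" "s a"]
    by (simp add: E11_inverse_left s_zero)
  have cont_s: "continuous_on UNIV s"
  proof -
    have "isCont s a" for a
    proof -
      let ?M = "(\<lambda>b. E11_inverse a \<star> b) -` N"
      have cM: "continuous_on S (\<lambda>b. E11_inverse a \<star> b)" for S
        by (intro continuous_on_E11_mult continuous_on_const continuous_on_id)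
      have oM: "open ?M" using open_vimage[OF N(1) cM] .
      have aM: "a \<in> ?M" using N(2) by (simp add: E11_inverse_left)
      have "continuous_on N s0"
        using continuous_on_subset[OF homeomorphism_cont2[OF hom0] NV0] .
      then have "continuous_on ?M (\<lambda>b. s0 (E11_inverse a \<star> b))"
        by (rule continuous_on_compose2[OF _ cM]) auto
      then have "continuous_on ?M (\<lambda>b. s a \<otimes> s0 (E11_inverse a \<star> b))"
        by (intro continuous_on_mult2 continuous_on_const)
      then have "continuous_on ?M s"
      proof (rule continuous_on_eq)
        fix b assume "b \<in> ?M"
        then have "s0 (E11_inverse a \<star> b) = s (E11_inverse a \<star> b)" using sN by simp
        then show "s a \<otimes> s0 (E11_inverse a \<star> b) = s b"
          by (simp add: s s_inverse cancel)
      qed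
      then show ?thesis using oM aM by (simp add: continuous_on_eq_continuous_at)
    qed
    then show ?thesis by (simp add: continuous_at_imp_continuous_on)
  qed
  have surj: "range s = UNIV"
  proof -
    have op: "open ((\<lambda>x. inv a \<otimes> x) -` W)" for a by (rule open_left_translate[OF W(1)])
    have "range s = (\<Union>a\<in>range s. (\<lambda>x. inv a \<otimes> x) -` W)"
    proof
      show "range s \<subseteq> (\<Union>a\<in>range s. (\<lambda>x. inv a \<otimes> x) -` W)" using W_one by auto
      show "(\<Union>a\<in>range s. (\<lambda>x. inv a \<otimes> x) -` W) \<subseteq> range s"
      proof
        fix x assume "x \<in> (\<Union>a\<in>range s. (\<lambda>x. inv a \<otimes> x) -` W)"
        then obtain a where "inv (s a) \<otimes> x \<in> W" by blast
        then obtain v where "inv (s a) \<otimes> x = s v" unfolding W_def by blast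
        then have "x = s (a \<star> v)" using cancel(2)[of "s a" x] by (simp add: s)
        then show "x \<in> range s" by blast
      qed
    qed
    then have o1: "open (range s)" using op by (metis (no_types, lifting) open_UN)
    have "- range s = (\<Union>a\<in>- range s. (\<lambda>x. inv a \<otimes> x) -` W)"
    proof
      show "- range s \<subseteq> (\<Union>a\<in>- range s. (\<lambda>x. inv a \<otimes> x) -` W)" using W_one by auto
      show "(\<Union>a\<in>- range s. (\<lambda>x. inv a \<otimes> x) -` W) \<subseteq> - range s"
      proof
        fix x assume "x \<in> (\<Union>a\<in>- range s. (\<lambda>x. inv a \<otimes> x) -` W)"
        then obtain a where a: "a \<notin> range s" "inv a \<otimes> x \<in> W" by blast
        then obtain v where v: "inv a \<otimes> x = s v" unfolding W_def by blast
        show "x \<in> - range s"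
        proof
          assume "x \<in> range s"
          then obtain u where u: "x = s u" by blast
          have "a \<otimes> s v = s u" using cancel(2)[of a x] unfolding v by (simp add: u)
          then have "a = s u \<otimes> inv (s v)" by (metis carrier UNIV_I inv_solve_right)
          then have "a = s (u \<star> E11_inverse v)" by (simp add: s s_inverse)
          then show False using a(1) by blast
        qed
      qed
    qed
    then have o2: "open (- range s)" using op by (metis (no_types, lifting) open_UN)
    show ?thesis
      using connectedD[OF conn o1 o2] by auto
  qed
  \<comment> \<open>Lifting through \<open>s\<close> over a star-shaped compact set.\<close>
  have lift: thesis'
    if K: "compact K" "0 \<in> K" "\<And>u c. u \<in> K \<Longrightarrow> 0 \<le> c \<Longrightarrow> c \<le> 1 \<Longrightarrow> c *\<^sub>R u \<in> K"
      and k: "continuous_on K k" "k 0 = \<one>"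
      and th: "\<And>h. continuous_on K h \<Longrightarrow> (\<And>u. u \<in> K \<Longrightarrow> s (h u) = k u) \<Longrightarrow> h 0 = 0 \<Longrightarrow> thesis'"
    for K :: "(real \<times> real) set" and k thesis'
  proof -
    define q where "q = (\<lambda>(u, v). inv (k u) \<otimes> k v)"
    have cq: "continuous_on (K \<times> K) q"
      unfolding q_def split_beta
      by (intro continuous_on_mult2 continuous_on_inv2 continuous_on_compose2[OF k(1)] continuous_intros) auto
    obtain n :: nat where n: "n > 0"
      and small: "\<And>u v w. w \<in> K \<Longrightarrow> u \<in> K \<Longrightarrow> v \<in> K \<Longrightarrow> dist u v \<le> norm w / real n \<Longrightarrow> q (u, v) \<in> W"
      using compact_uniform_subdivision[OF K(1) cq W(1)] W_one by (auto simp: q_def)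
    define p where "p = (\<lambda>j (u::real \<times> real). (real j / real n) *\<^sub>R u)"
    have pK: "p j u \<in> K" if "u \<in> K" "j \<le> n" for j u
      unfolding p_def using that n by (intro K(3)) auto
    have step: "q (p j u, p (Suc j) u) \<in> W" if "u \<in> K" "j < n" for j u
    proof (rule small[OF that(1)])
      show "p j u \<in> K" "p (Suc j) u \<in> K" using pK that by auto
      have "p j u - p (Suc j) u = (- 1 / real n) *\<^sub>R u"
        unfolding p_def scaleR_diff_left[symmetric] by (simp add: diff_divide_distrib[symmetric])
      then show "dist (p j u) (p (Suc j) u) \<le> norm u / real n" by (simp add: dist_norm)
    qed
    define h where "h = rec_nat (\<lambda>u. 0) (\<lambda>j f u. f u \<star> \<sigma> (q (p j u, p (Suc j) u)))"
    have h: "h 0 = (\<lambda>u. 0)" "\<And>j. h (Suc j) = (\<lambda>u. h j u \<star> \<sigma> (q (p j u, p (Suc j) u)))"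
      by (simp_all add: h_def)
    have main: "continuous_on K (h j) \<and> (\<forall>u\<in>K. s (h j u) = k (p j u)) \<and> h j 0 = 0" if "j \<le> n" for j
      using that
    proof (induction j)
      case 0
      then show ?case using k(2) s_zero by (simp add: h p_def)
    next
      case (Suc j)
      then have j: "j < n" "j \<le> n" by auto
      have cp: "continuous_on K (p i)" for i unfolding p_def by (intro continuous_intros)
      have "continuous_on K (\<lambda>u. q (p j u, p (Suc j) u))"
        by (rule continuous_on_compose2[OF cq continuous_on_Pair[OF cp cp]]) (use pK j in auto)
      then have "continuous_on K (\<lambda>u. \<sigma> (q (p j u, p (Suc j) u)))"
        by (rule continuous_on_compose2[OF cont_\<sigma>]) (use step j in auto)
      then have 1: "continuous_on K (h (Suc j))"
        using Suc.IH[OF j(2)] unfolding h by (intro continuous_on_E11_mult) auto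
      have 2: "s (h (Suc j) u) = k (p (Suc j) u)" if "u \<in> K" for u
        using Suc.IH[OF j(2)] s_\<sigma>(2)[OF step[OF that j(1)]] that
        by (simp add: h s) (simp add: q_def cancel)
      have "q (p j 0, p (Suc j) 0) = \<one>" by (simp add: q_def p_def k(2))
      then have "h (Suc j) 0 = 0" using Suc.IH[OF j(2)] \<sigma>_one by (simp add: h)
      with 1 2 show ?case by blast
    qed
    have "p n u = u" for u using n by (simp add: p_def)
    then show thesis' using main[of n] th[of "h n"] by simp
  qed
  \<comment> \<open>The kernel of \<open>s\<close> is discrete, so a path in it that passes through \<open>0\<close> stays there.\<close>
  have discrete: "f x = 0"
    if f: "continuous_on S f" "connected S" "\<And>y. y \<in> S \<Longrightarrow> s (f y) = \<one>"
      and x0: "x0 \<in> S" "f x0 = 0" and x: "x \<in> S"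
    for S :: "'z::topological_space set" and f x0 x
  proof -
    have "\<exists>T. openin (top_of_set S) T \<and> z \<in> T \<and> (\<forall>y\<in>T. f y = f z)" if z: "z \<in> S" for z
    proof -
      let ?M = "(\<lambda>b. E11_inverse (f z) \<star> b) -` N"
      have cM: "continuous_on UNIV (\<lambda>b. E11_inverse (f z) \<star> b)"
        by (intro continuous_on_E11_mult continuous_on_const continuous_on_id)
      have M: "open ?M" "f z \<in> ?M" using open_vimage[OF N(1) cM] N(2) by (auto simp: E11_inverse_left)
      have "f y = f z" if "y \<in> S \<inter> f -` ?M" for y
      proof -
        have y: "y \<in> S" and d: "E11_inverse (f z) \<star> f y \<in> N" using that by auto
        have "s (E11_inverse (f z) \<star> f y) = \<one>" by (simp add: s s_inverse f(3) y z)
        then have "s0 (E11_inverse (f z) \<star> f y) = s0 0" using sN[OF d] sN[OF N(2)] s_zero by simp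
        then have "E11_inverse (f z) \<star> f y = 0" using \<sigma>_s0 NV0 d N(2) by (metis subsetD)
        then have "f z \<star> (E11_inverse (f z) \<star> f y) = f z" by simp
        then show ?thesis by (simp add: E11_assoc[symmetric] E11_inverse_right)
      qed
      moreover have "openin (top_of_set S) (S \<inter> f -` ?M)"
        by (rule continuous_openin_preimage_gen[OF f(1) M(1)])
      ultimately show ?thesis using M(2) z by (intro exI[of _ "S \<inter> f -` ?M"]) blast
    qed
    then have "f constant_on S"
      by (rule locally_constant_imp_constant[OF f(2)])
    then show ?thesis using x0 x by (metis constant_on_def)
  qed
  have "inj s"
  proof -
    have ker: "a = 0" if a: "s a = \<one>" for a
    proof -
      define c where "c = (\<lambda>x::real. s (x *\<^sub>R a))"
      have "continuous_on {0..1} c" unfolding c_def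
        by (intro continuous_on_compose2[OF cont_s] continuous_intros) auto
      then have pc: "path c" by (simp add: path_def)
      have ends: "pathstart c = \<one>" "pathfinish c = \<one>"
        using a s_zero by (simp_all add: pathstart_def pathfinish_def c_def)
      have "homotopic_loops UNIV c (\<lambda>_. \<one>)"
      proof -
        have "path (\<lambda>_::real. \<one>)" by (simp add: path_def)
        then show ?thesis
          using simply pc ends unfolding simply_connected_def
          by (auto simp: pathstart_def pathfinish_def)
      qed
      then obtain H :: "real \<times> real \<Rightarrow> 'g" where H: "continuous_on ({0..1} \<times> {0..1}) H" "\<forall>x\<in>{0..1}. H (0, x) = c x"
        "\<forall>x\<in>{0..1}. H (1, x) = \<one>" "\<forall>t\<in>{0..1}. pathfinish (H \<circ> Pair t) = pathstart (H \<circ> Pair t)"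
        unfolding homotopic_loops by (elim exE conjE) (rule that; assumption)
      define K :: "(real \<times> real) set" where "K = {0..1} \<times> {0..1}"
      define k where "k = (\<lambda>z::real \<times> real. inv (H (fst z, 0)) \<otimes> H z)"
      have ck: "continuous_on K k"
        unfolding k_def K_def
        by (intro continuous_on_mult2 continuous_on_inv2 H(1) continuous_on_compose2[OF H(1)] continuous_intros) auto
      have k0: "k (t, 0) = \<one>" for t by (simp add: k_def)
      have k1: "k (t, 1) = \<one>" if "t \<in> {0..1}" for t
      proof -
        have "H (t, 1) = H (t, 0)" using H(4) that by (simp add: pathstart_def pathfinish_def)
        then show ?thesis by (simp add: k_def)
      qed
      have kr: "k (1, x) = \<one>" if "x \<in> {0..1}" for x using H(3) that by (simp add: k_def)
      have kl: "k (0, x) = c x" if "x \<in> {0..1}" for x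
        using H(2) that s_zero by (simp add: k_def) (simp add: c_def)
      obtain h where h: "continuous_on K h" "\<And>u. u \<in> K \<Longrightarrow> s (h u) = k u" "h 0 = 0"
      proof (rule lift[of K k])
        show "compact K" by (simp add: K_def compact_Times)
        show "0 \<in> K" by (simp add: K_def zero_prod_def)
        show "c *\<^sub>R u \<in> K" if "u \<in> K" "0 \<le> c" "c \<le> 1" for u c
          using that by (cases u) (auto simp: K_def mult_le_one)
        show "k 0 = \<one>" using k0[of 0] by (simp add: zero_prod_def)
      qed (use ck in blast)+
      have seg: "f ` {0..1} \<subseteq> K \<Longrightarrow> continuous_on {0..1} f \<Longrightarrow> continuous_on {0..1} (\<lambda>x. h (f x))" for f :: "real \<Rightarrow> real \<times> real"
        using continuous_on_compose2[OF h(1)] by blast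
      have conn01: "connected {0..1::real}" by simp
      have b0: "h (1, 0) = 0"
        by (rule discrete[OF seg[of "\<lambda>t. (t, 0)"] conn01, of 0 1])
          (use h k0 in \<open>auto simp: K_def zero_prod_def intro!: continuous_intros\<close>)
      have b1: "h (1, 1) = 0"
        by (rule discrete[OF seg[of "\<lambda>x. (1, x)"] conn01, of 0 1])
          (use h kr b0 in \<open>auto simp: K_def intro!: continuous_on_Pair continuous_on_const continuous_on_id\<close>)
      have b2: "h (0, 1) = 0"
        by (rule discrete[OF seg[of "\<lambda>t. (t, 1)"] conn01, of 1 0])
          (use h k1 b1 in \<open>auto simp: K_def intro!: continuous_intros\<close>)
      have cont: "continuous_on {0..1} (\<lambda>x. E11_inverse (h (0, x)) \<star> (x *\<^sub>R a))"
        by (intro continuous_on_E11_mult continuous_on_E11_inverse seg[of "\<lambda>x. (0, x)"]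
            continuous_on_scaleR continuous_on_const continuous_on_id continuous_on_Pair)
          (auto simp: K_def)
      have "E11_inverse (h (0, 1)) \<star> (1 *\<^sub>R a) = 0"
      proof (rule discrete[OF cont conn01, of 0 1])
        show "s (E11_inverse (h (0, y)) \<star> (y *\<^sub>R a)) = \<one>" if "y \<in> {0..1}" for y
        proof -
          have "s (h (0, y)) = c y" using h(2)[of "(0, y)"] kl that by (simp add: K_def)
          then show ?thesis by (simp add: s s_inverse) (simp add: c_def)
        qed
        show "E11_inverse (h (0, 0)) \<star> (0 *\<^sub>R a) = 0"
          using h(3) by (simp add: zero_prod_def E11_inverse_def vec3_eq_iff)
      qed auto
      then show "a = 0" using b2 by (simp add: E11_inverse_def vec3_eq_iff)
    qed
    show ?thesis
    proof (rule injI)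
      fix a b assume "s a = s b"
      then have "s (E11_inverse a \<star> b) = \<one>" by (simp add: s s_inverse)
      then have "E11_inverse a \<star> b = 0" by (rule ker)
      then have "a \<star> (E11_inverse a \<star> b) = a" by simp
      then show "a = b" by (simp add: E11_assoc[symmetric] E11_inverse_right)
    qed
  qed
  then have "bij s" using surj by (simp add: bij_def)
  show thesis by (rule that[OF s \<open>bij s\<close> N sN W(1)[unfolded W_def] cont_s])
qed

end

section \<open>Recognising E(1,1) from its Lie algebra\<close>

lemma (in smooth_manifold) smooth_on_chart_expression:
  assumes "(U, \<phi>) \<in> A" "\<And>p. p \<in> U \<Longrightarrow> smooth_near A p f"
  shows "smooth_on (\<phi> ` U) (f \<circ> inv_into U \<phi>)"
proof (rule smooth_on_local)
  fix x assume "x \<in> \<phi> ` U"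
  then obtain p where p: "p \<in> U" "x = \<phi> p" by blast
  obtain W where W: "open W" "p \<in> W" "W \<subseteq> U" "smooth_on (\<phi> ` W) (f \<circ> inv_into U \<phi>)"
    using smooth_near_chart[OF assms(2)[OF p(1)] assms(1) p(1)] .
  then show "\<exists>W. open W \<and> x \<in> W \<and> smooth_on W (f \<circ> inv_into U \<phi>)"
    using chart_open_map[OF assms(1) W(1,3)] p(2) by blast
qed

context lorentz_frame
begin

text \<open>
  The left-invariant field with coordinates \<open>v\<close>, seen as a vector field on the image of the chart.
\<close>
definition chart_field :: "'m set \<Rightarrow> ('m \<Rightarrow> real^3) \<Rightarrow> real^3 \<Rightarrow> real^3 \<Rightarrow> real^3" where
  "chart_field U \<phi> v x = (\<chi> j. frame_comb e v (inv_into U \<phi> x) (\<lambda>q. \<phi> q $ j))"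

lemma smooth_near_component: "(U, \<phi>) \<in> A \<Longrightarrow> p \<in> U \<Longrightarrow> smooth_near A p (\<lambda>q. \<phi> q $ j)"
  using smooth_near_coord[of U \<phi> p "axis j 1"] by (simp add: inner_axis)

lemma chart_field_smooth:
  assumes "(U, \<phi>) \<in> A"
  shows "smooth_on (\<phi> ` U) (chart_field U \<phi> v)"
proof (rule smooth_on_vec[OF chart_image_open[OF assms]])
  fix j
  have "smooth_on (\<phi> ` U) ((\<lambda>p. frame_comb e v p (\<lambda>q. \<phi> q $ j)) \<circ> inv_into U \<phi>)"
    by (rule smooth_on_chart_expression[OF assms])
      (rule vector_field_smooth[OF vector_field_frame_comb smooth_near_component[OF assms]])
  then show "smooth_on (\<phi> ` U) (\<lambda>x. chart_field U \<phi> v x $ j)"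
    by (simp add: chart_field_def comp_def)
qed

lemma frame_comb_chart:
  assumes "(U, \<phi>) \<in> A" "p \<in> U" "smooth_near A p f"
  shows "frame_comb e v p f = dir_deriv (f \<circ> inv_into U \<phi>) (\<phi> p) (chart_field U \<phi> v (\<phi> p))"
  using tangent_chart[OF assms(1,2) frame_comb_tangent assms(3)] chart_inv[OF assms(1,2)]
  by (simp add: chart_field_def)

lemma dir_deriv_nth:
  fixes F :: "real^3 \<Rightarrow> real^3"
  assumes "smooth_on S F" "x \<in> S"
  shows "dir_deriv (\<lambda>x. F x $ i) x v = dir_deriv F x v $ i"
  using dir_deriv_eq[OF bounded_linear.has_derivative[OF bounded_linear_vec_nth
      smooth_on_derivative[OF assms]]] .

lemma chart_field_bracket:
  assumes U: "(U, \<phi>) \<in> A" and x: "x \<in> \<phi> ` U"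
    and br: "lie_bracket A (frame_comb e a) (frame_comb e b) = frame_comb e c"
  shows "dir_deriv (chart_field U \<phi> b) x (chart_field U \<phi> a x) - dir_deriv (chart_field U \<phi> a) x (chart_field U \<phi> b x)
    = chart_field U \<phi> c x"
proof -
  obtain p where p: "p \<in> U" "x = \<phi> p" using x by blast
  have der: "frame_comb e a p (\<lambda>q. frame_comb e b q (\<lambda>q. \<phi> q $ j))
      = dir_deriv (chart_field U \<phi> b) x (chart_field U \<phi> a x) $ j" for a b j
  proof -
    have s: "smooth_near A p (\<lambda>q. frame_comb e b q (\<lambda>q. \<phi> q $ j))"
      by (rule vector_field_smooth[OF vector_field_frame_comb smooth_near_component[OF U p(1)]])
    have "(\<lambda>q. frame_comb e b q (\<lambda>q. \<phi> q $ j)) \<circ> inv_into U \<phi> = (\<lambda>x. chart_field U \<phi> b x $ j)"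
      by (simp add: chart_field_def comp_def)
    then show ?thesis
      using frame_comb_chart[OF U p(1) s, of a] dir_deriv_nth[OF chart_field_smooth[OF U] x]
      by (simp add: p(2))
  qed
  have "chart_field U \<phi> c x $ j = dir_deriv (chart_field U \<phi> b) x (chart_field U \<phi> a x) $ j
      - dir_deriv (chart_field U \<phi> a) x (chart_field U \<phi> b x) $ j" for j
  proof -
    have "chart_field U \<phi> c x $ j = lie_bracket A (frame_comb e a) (frame_comb e b) p (\<lambda>q. \<phi> q $ j)"
      by (simp add: chart_field_def br p chart_inv[OF U p(1)])
    also have "\<dots> = frame_comb e a p (\<lambda>q. frame_comb e b q (\<lambda>q. \<phi> q $ j))
        - frame_comb e b p (\<lambda>q. frame_comb e a q (\<lambda>q. \<phi> q $ j))"
      by (rule lie_bracket_vector_field_apply[OF smooth_near_component[OF U p(1)]])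
    finally show ?thesis unfolding der .
  qed
  then show ?thesis by (simp add: vec_eq_iff)
qed

lemma chart_field_surj:
  assumes U: "(U, \<phi>) \<in> A" "p \<in> U"
  obtains v where "coordinate_tangent U \<phi> p w = frame_comb e v p" "chart_field U \<phi> v (\<phi> p) = w"
proof -
  obtain v where v: "coordinate_tangent U \<phi> p w = frame_comb e v p"
    using frame_spans[OF coordinate_tangent[OF U]] .
  have "chart_field U \<phi> v (\<phi> p) $ j = w $ j" for j
  proof -
    have "((\<lambda>x. x $ j) has_derivative (\<lambda>v. v $ j)) (at (\<phi> p))"
      using bounded_linear.has_derivative[OF bounded_linear_vec_nth has_derivative_ident] .
    then have "((\<lambda>q. \<phi> q $ j) \<circ> inv_into U \<phi> has_derivative (\<lambda>v. v $ j)) (at (\<phi> p))"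
      by (rule has_derivative_transform_within_open[OF _ chart_image_open[OF U(1)]])
        (use U in \<open>auto simp: chart_inv\<close>)
    from dir_deriv_eq[OF this, of w] have "coordinate_tangent U \<phi> p w (\<lambda>q. \<phi> q $ j) = w $ j"
      by (simp add: coordinate_tangent_def smooth_near_component[OF U])
    then show ?thesis by (simp add: chart_field_def chart_inv[OF U] v)
  qed
  then have "chart_field U \<phi> v (\<phi> p) = w" by (simp add: vec_eq_iff)
  with v show thesis by (rule that)
qed

lemma chart_field_linear:
  "chart_field U \<phi> (a *\<^sub>R u + b *\<^sub>R v + c *\<^sub>R w) x
    = a *\<^sub>R chart_field U \<phi> u x + b *\<^sub>R chart_field U \<phi> v x + c *\<^sub>R chart_field U \<phi> w x"
  by (simp add: chart_field_def vec_eq_iff frame_comb_def sum_3 algebra_simps)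

lemma frame_comb_linear:
  "frame_comb e (a *\<^sub>R u + b *\<^sub>R v + c *\<^sub>R w) p f
    = a * frame_comb e u p f + b * frame_comb e v p f + c * frame_comb e w p f"
  by (simp add: frame_comb_def sum_3 algebra_simps)

text \<open>
  A function that every field \<open>frame_comb e v\<close> annihilates has zero derivative in the chart, because
  these fields span.
\<close>
lemma annihilated_constant:
  assumes U: "(U, \<phi>) \<in> A" and B: "ball c r \<subseteq> \<phi> ` U"
    and f: "\<And>x. x \<in> ball c r \<Longrightarrow> smooth_near A (inv_into U \<phi> x) f"
    and z: "\<And>x v. x \<in> ball c r \<Longrightarrow> frame_comb e v (inv_into U \<phi> x) f = 0"
    and xy: "x \<in> ball c r" "y \<in> ball c r"
  shows "f (inv_into U \<phi> x) = f (inv_into U \<phi> y)"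
proof -
  have D: "((f \<circ> inv_into U \<phi>) has_derivative (\<lambda>h. 0)) (at x)" if x: "x \<in> ball c r" for x
  proof -
    obtain p where p: "p \<in> U" "x = \<phi> p" using x B by blast
    have ip: "inv_into U \<phi> x = p" using chart_inv[OF U p(1)] p(2) by simp
    have sm: "smooth_near A p f" using f[OF x] ip by simp
    have "dir_deriv (f \<circ> inv_into U \<phi>) x w = 0" for w
    proof -
      obtain v where "coordinate_tangent U \<phi> p w = frame_comb e v p"
        using chart_field_surj[OF U p(1)] .
      then have "coordinate_tangent U \<phi> p w f = 0" using z[OF x] ip by simp
      then show ?thesis by (simp add: coordinate_tangent_def sm p(2))
    qed
    then have "dir_deriv (f \<circ> inv_into U \<phi>) x = (\<lambda>h. 0)" by blast
    then show ?thesis using smooth_near_has_derivative[OF sm U p(1)] p(2) by simp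
  qed
  have "((f \<circ> inv_into U \<phi>) has_derivative (\<lambda>h. 0)) (at x within ball c r)" if "x \<in> ball c r" for x
    by (rule has_derivative_at_withinI[OF D[OF that]])
  then have "\<exists>k. \<forall>x\<in>ball c r. (f \<circ> inv_into U \<phi>) x = k"
    by (rule has_derivative_zero_constant[OF convex_ball])
  then show ?thesis using xy by auto
qed

end

lemma homeomorphism_restrict_left:
  assumes "homeomorphism S T f g" "U \<subseteq> T"
  shows "homeomorphism (g ` U) U f g"
proof -
  have "homeomorphism U (g ` U) g f"
    by (rule homeomorphism_of_subsets[OF homeomorphism_symD[OF assms(1)]])
      (use assms in \<open>auto simp: homeomorphism_def\<close>)
  then show ?thesis by (rule homeomorphism_symD)
qed

lemma lie_group_topological:
  assumes "lie_group A G" shows "topological_group_type G"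
proof -
  interpret group G using assms by (simp add: lie_group_def)
  show ?thesis
    by unfold_locales (use assms in \<open>simp_all add: lie_group_def smooth_map_def\<close>)
qed

lemma translation_smooth_near:
  assumes "lie_group A G" "smooth_near A (a \<otimes>\<^bsub>G\<^esub> p) f"
  shows "smooth_near A p (\<lambda>q. f (a \<otimes>\<^bsub>G\<^esub> q))"
proof -
  have m: "smooth_manifold A" using assms(1) by unfold_locales (simp add: lie_group_def)
  have "smooth_map A A (\<lambda>q. a \<otimes>\<^bsub>G\<^esub> q)"
    by (rule smooth_map_slice[OF m]) (use assms(1) in \<open>simp add: lie_group_def\<close>)
  from smooth_map_pullback[OF m m this assms(2)] show ?thesis by (simp add: comp_def)
qed

context lorentz_frame
begin

lemma frame_comb_translate:
  assumes "\<And>i. left_invariant G (e i)"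
  shows "frame_comb e v p (\<lambda>q. f (a \<otimes>\<^bsub>G\<^esub> q)) = frame_comb e v (a \<otimes>\<^bsub>G\<^esub> p) f"
proof -
  have "e i p (f \<circ> (\<lambda>q. a \<otimes>\<^bsub>G\<^esub> q)) = e i (a \<otimes>\<^bsub>G\<^esub> p) f" for i
    using assms[of i] unfolding left_invariant_def tangent_map_def by metis
  then show ?thesis by (simp add: frame_comb_def comp_def)
qed

text \<open>
  The hypotheses present \<open>x, y, z\<close> as a basis of the Lie algebra of \<open>G\<close> with the bracket relations of
  \<open>E(1,1)\<close>. The coordinates of \<open>E11_coordinates\<close> near the unit are a local isomorphism, which extends to
  \<open>G\<close>. Smoothness spreads from the unit by translations.
\<close>
lemma E11_isomorphism:
  fixes G (structure)
  assumes lg: "lie_group A G" and inv: "\<And>i. left_invariant G (e i)"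
    and conn: "connected (UNIV :: 'm set)" and simply: "simply_connected (UNIV :: 'm set)"
    and XY: "lie_bracket A (frame_comb e x) (frame_comb e y) = frame_comb e y"
    and XZ: "lie_bracket A (frame_comb e x) (frame_comb e z) = frame_comb e (- z)"
    and YZ: "lie_bracket A (frame_comb e y) (frame_comb e z) = frame_comb e 0"
    and span: "\<And>v. \<exists>a b c. v = a *\<^sub>R x + b *\<^sub>R y + c *\<^sub>R z"
  shows "lie_group_isomorphic A G E11_atlas E11"
proof -
  interpret topological_group_type G by (rule lie_group_topological[OF lg])
  obtain U \<phi> where U: "(U, \<phi>) \<in> A" "\<one> \<in> U" using chart_around .
  define c where "c = \<phi> \<one>"
  have oU: "open (\<phi> ` U)" by (rule chart_image_open[OF U(1)])
  have "c \<in> \<phi> ` U" using U(2) by (simp add: c_def)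
  then obtain r where r: "r > 0" "ball c r \<subseteq> \<phi> ` U" using oU openE by blast
  let ?j = "inv_into U \<phi>"
  define M where "M = chart_field U \<phi>"
  have smM: "smooth_on (ball c r) (M v)" for v
    unfolding M_def by (rule smooth_on_subset[OF chart_field_smooth[OF U(1)] r(2)])
  have Mneg: "M (- z) p = - M z p" "M 0 p = 0" for p
    by (simp_all add: M_def chart_field_def vec_eq_iff frame_comb_def sum_negf)
  have br: "dir_deriv (M b) p (M a p) - dir_deriv (M a) p (M b p) = M d p"
    if "lie_bracket A (frame_comb e a) (frame_comb e b) = frame_comb e d" "p \<in> ball c r" for a b d p
    unfolding M_def by (rule chart_field_bracket[OF U(1) _ that(1)]) (use that(2) r in blast)
  have Mall: "\<exists>a b d. w = a *\<^sub>R M x p + b *\<^sub>R M y p + d *\<^sub>R M z p" if p: "p \<in> ball c r" for p w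
  proof -
    obtain q where q: "q \<in> U" "p = \<phi> q" using p r by blast
    obtain v where v: "M v p = w" using chart_field_surj[OF U(1) q(1)] q(2) unfolding M_def by metis
    obtain a b d where "v = a *\<^sub>R x + b *\<^sub>R y + d *\<^sub>R z" using span by blast
    then show ?thesis using v chart_field_linear unfolding M_def by metis
  qed
  obtain F :: "real^3 \<Rightarrow> real^3" where smF: "smooth_on (ball c r) F" and F0: "F c = 0"
    and FX: "\<And>p. p \<in> ball c r \<Longrightarrow> dir_deriv F p (M x p) = vector [1, 0, 0]"
    and FY: "\<And>p. p \<in> ball c r \<Longrightarrow> dir_deriv F p (M y p) = vector [0, exp (F p $ 1), 0]"
    and FZ: "\<And>p. p \<in> ball c r \<Longrightarrow> dir_deriv F p (M z p) = vector [0, 0, exp (- F p $ 1)]"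
  proof (rule E11_coordinates[OF smM[of x] smM[of y] smM[of z]])
    fix p assume p: "p \<in> ball c r"
    show "dir_deriv (M y) p (M x p) - dir_deriv (M x) p (M y p) = M y p" by (rule br[OF XY p])
    show "dir_deriv (M z) p (M x p) - dir_deriv (M x) p (M z p) = - M z p" using br[OF XZ p] Mneg by simp
    show "dir_deriv (M z) p (M y p) - dir_deriv (M y) p (M z p) = 0" using br[OF YZ p] Mneg by simp
    fix w assume "M x p \<bullet> w = 0" "M y p \<bullet> w = 0" "M z p \<bullet> w = 0"
    moreover obtain a b d where "w = a *\<^sub>R M x p + b *\<^sub>R M y p + d *\<^sub>R M z p" using Mall[OF p] by blast
    ultimately have "w \<bullet> w = 0" by (metis add.right_neutral inner_add_left inner_scaleR_left mult_zero_right)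
    then show "w = 0" by simp
  qed (rule that)
  \<comment> \<open>The combination of the three fields that \<open>F\<close> carries to the constant field \<open>v\<close>.\<close>
  define Nv where "Nv = (\<lambda>(v::real^3) p. (v $ 1) *\<^sub>R M x p + (v $ 2 * exp (- 1 * F p $ 1)) *\<^sub>R M y p + (v $ 3 * exp (1 * F p $ 1)) *\<^sub>R M z p)"
  obtain U' V h where U': "open U'" "c \<in> U'" "U' \<subseteq> ball c r" and V: "open V"
    and FU': "homeomorphism U' V F h" and smh: "smooth_on V h"
  proof (rule smooth_local_inverse[OF open_ball _ smF, of c Nv])
    show "c \<in> ball c r" using r by simp
    have smF1: "smooth_on (ball c r) (\<lambda>p. F p $ 1)" by (rule smooth_on_nth[OF open_ball smF])
    have smE: "smooth_on (ball c r) (\<lambda>p. k * exp (l * F p $ 1))" for k l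
      by (intro smooth_on_mult[OF open_ball] smooth_on_exp[OF open_ball] smooth_on_const[OF open_ball] smF1)
    show "smooth_on (ball c r) (Nv v)" for v
      unfolding Nv_def
      by (intro smooth_on_add[OF open_ball] smooth_on_bilinear[OF open_ball bounded_bilinear_scaleR]
          smE smM smooth_on_const[OF open_ball])
    show "dir_deriv F p (Nv v p) = v" if p: "p \<in> ball c r" for p v
    proof -
      have lin: "linear (dir_deriv F p)" by (rule smooth_on_linear_dir_deriv[OF smF p])
      have "exp (- F p $ 1) * exp (F p $ 1) = 1" "exp (F p $ 1) * exp (- F p $ 1) = 1"
        by (simp_all add: exp_minus)
      then show ?thesis
        by (simp add: Nv_def linear_add[OF lin] linear_cmul[OF lin] FX[OF p] FY[OF p] FZ[OF p] vec3_eq_iff)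
    qed
  qed blast
  define \<tau> where "\<tau> = F \<circ> \<phi>"
  define W0 where "W0 = ?j ` U'"
  have U'U: "U' \<subseteq> \<phi> ` U" using U'(3) r by blast
  have W0: "open W0" "W0 \<subseteq> U" "\<one> \<in> W0"
  proof -
    show "open W0" unfolding W0_def by (rule chart_inv_open_map[OF U(1) U'(1) U'U])
    show "W0 \<subseteq> U" unfolding W0_def using U'U by (auto intro!: inv_into_into)
    show "\<one> \<in> W0" unfolding W0_def using U'(2) chart_inv[OF U] by (metis c_def imageI)
  qed
  have \<phi>W0: "\<phi> p \<in> U'" if "p \<in> W0" for p
    using that U'U homeomorphism_apply2[OF chart_homeomorphism[OF U(1)]] unfolding W0_def by force
  have homeo: "homeomorphism W0 V \<tau> (?j \<circ> h)"
    unfolding W0_def \<tau>_def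
    by (rule homeomorphism_compose[OF homeomorphism_restrict_left[OF chart_homeomorphism[OF U(1)] U'U] FU'])
  have sm\<tau>: "smooth_near A p (\<lambda>q. \<tau> q $ i)"
    and d\<tau>: "frame_comb e v p (\<lambda>q. \<tau> q $ i) = dir_deriv F (\<phi> p) (M v (\<phi> p)) $ i"
    if p: "p \<in> U" "\<phi> p \<in> ball c r" for p i v
  proof -
    show s: "smooth_near A p (\<lambda>q. \<tau> q $ i)"
      unfolding \<tau>_def comp_def
      by (rule smooth_near_chart_function[OF U(1) p(1) open_ball p(2) r(2) smooth_on_nth[OF open_ball smF]])
    have "frame_comb e v p (\<lambda>q. \<tau> q $ i) = dir_deriv ((\<lambda>q. \<tau> q $ i) \<circ> ?j) (\<phi> p) (M v (\<phi> p))"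
      unfolding M_def by (rule frame_comb_chart[OF U(1) p(1) s])
    also have "frechet_derivative ((\<lambda>q. \<tau> q $ i) \<circ> ?j) (at (\<phi> p)) = frechet_derivative (\<lambda>x. F x $ i) (at (\<phi> p))"
    proof (rule frechet_derivative_cong_open[OF open_ball p(2)])
      fix w assume "w \<in> ball c r"
      then show "((\<lambda>q. \<tau> q $ i) \<circ> ?j) w = F w $ i"
        using r homeomorphism_apply2[OF chart_homeomorphism[OF U(1)]] by (force simp: \<tau>_def)
    qed
    finally show "frame_comb e v p (\<lambda>q. \<tau> q $ i) = dir_deriv F (\<phi> p) (M v (\<phi> p)) $ i"
      using dir_deriv_nth[OF smF p(2)] by simp
  qed
  have W0_ball: "p \<in> U" "\<phi> p \<in> ball c r" if "p \<in> W0" for p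
    using \<phi>W0[OF that] U'(3) W0(2) that by auto
  obtain B where B: "open B" "\<one> \<in> B" "\<And>a b. a \<in> B \<Longrightarrow> b \<in> B \<Longrightarrow> a \<otimes> b \<in> W0"
  proof -
    have "open ((\<lambda>(a, b). a \<otimes> b) -` W0)" by (rule open_vimage[OF W0(1) continuous_mult])
    moreover have "(\<one>, \<one>) \<in> (\<lambda>(a, b). a \<otimes> b) -` W0" using W0(3) by simp
    ultimately obtain B1 B2 where "open B1" "open B2" "(\<one>, \<one>) \<in> B1 \<times> B2"
      "B1 \<times> B2 \<subseteq> (\<lambda>(a, b). a \<otimes> b) -` W0"
      by (rule open_prod_elim)
    then show thesis by (intro that[of "B1 \<inter> B2"]) auto
  qed
  have oB: "open (B \<inter> W0)" "B \<inter> W0 \<subseteq> U" "c \<in> \<phi> ` (B \<inter> W0)" using B W0 c_def by auto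
  obtain r1 where r1: "r1 > 0" "ball c r1 \<subseteq> \<phi> ` (B \<inter> W0)"
    using chart_open_map[OF U(1) oB(1,2)] oB(3) openE by blast
  define W1 where "W1 = ?j ` ball c r1"
  have r1U: "ball c r1 \<subseteq> \<phi> ` U" using r1(2) oB(2) by blast
  have W1: "open W1" "\<one> \<in> W1" "W1 \<subseteq> B \<inter> W0"
  proof -
    show "open W1" unfolding W1_def by (rule chart_inv_open_map[OF U(1) open_ball r1U])
    have "c \<in> ball c r1" using r1 by simp
    then show "\<one> \<in> W1" unfolding W1_def using chart_inv[OF U] by (metis c_def imageI)
    show "W1 \<subseteq> B \<inter> W0"
    proof
      fix p assume "p \<in> W1"
      then obtain w where w: "w \<in> ball c r1" "p = ?j w" unfolding W1_def by blast
      then obtain q where "q \<in> B \<inter> W0" "w = \<phi> q" using r1(2) by blast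
      then show "p \<in> B \<inter> W0" using w oB(2) chart_inv[OF U(1)] by auto
    qed
  qed
  have \<tau>_one: "\<tau> \<one> = 0" using F0 by (simp add: \<tau>_def c_def)
  have \<tau>_mult: "\<tau> (a \<otimes> b) = \<tau> a \<star> \<tau> b" if a: "a \<in> W1" and b: "b \<in> W1" for a b
  proof -
    \<comment> \<open>The constant \<open>\<tau> a $ i\<close> is the value of the left-hand side at the unit, where \<open>\<tau>\<close> vanishes.\<close>
    have const: "\<tau> (a \<otimes> b) $ i - k * \<tau> b $ i = \<tau> a $ i"
      if d: "\<And>p v. p \<in> W1 \<Longrightarrow> v \<in> {x, y, z} \<Longrightarrow>
        frame_comb e v (a \<otimes> p) (\<lambda>q. \<tau> q $ i) = k * frame_comb e v p (\<lambda>q. \<tau> q $ i)" and b: "b \<in> W1" for i k b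
    proof -
      define f where "f = (\<lambda>q. 1 * \<tau> (a \<otimes> q) $ i + (- k) * \<tau> q $ i)"
      have s1: "smooth_near A p (\<lambda>q. \<tau> (a \<otimes> q) $ i)" and s2: "smooth_near A p (\<lambda>q. \<tau> q $ i)"
        if "p \<in> W1" for p
      proof -
        have "a \<otimes> p \<in> W0" using B(3) W1(3) a that by blast
        then show "smooth_near A p (\<lambda>q. \<tau> (a \<otimes> q) $ i)"
          by (intro translation_smooth_near[OF lg] sm\<tau> W0_ball)
        show "smooth_near A p (\<lambda>q. \<tau> q $ i)" using that W1(3) by (intro sm\<tau> W0_ball) auto
      qed
      have z: "frame_comb e v p f = 0" if p: "p \<in> W1" for v p
      proof -
        have 0: "frame_comb e v p f = 0" if v: "v \<in> {x, y, z}" for v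
        proof -
          have "frame_comb e v p f = 1 * frame_comb e v p (\<lambda>q. \<tau> (a \<otimes> q) $ i) + (- k) * frame_comb e v p (\<lambda>q. \<tau> q $ i)"
            unfolding f_def by (rule tangent_comb_fun[OF frame_comb_tangent s1[OF p] s2[OF p]])
          also have "frame_comb e v p (\<lambda>q. \<tau> (a \<otimes> q) $ i) = frame_comb e v (a \<otimes> p) (\<lambda>q. \<tau> q $ i)"
            by (rule frame_comb_translate[OF inv, of v p "\<lambda>q. \<tau> q $ i" a])
          finally show ?thesis using d[OF p v] by simp
        qed
        obtain a b d where "v = a *\<^sub>R x + b *\<^sub>R y + d *\<^sub>R z" using span by blast
        then show ?thesis using 0 by (simp add: frame_comb_linear)
      qed
      obtain wb where wb: "wb \<in> ball c r1" "b = ?j wb" using b unfolding W1_def by blast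
      have "f (?j wb) = f (?j c)"
      proof (rule annihilated_constant[OF U(1) r1U])
        fix w assume "w \<in> ball c r1"
        then have w: "?j w \<in> W1" by (simp add: W1_def)
        show "smooth_near A (?j w) f"
          unfolding f_def by (rule smooth_near_comb[OF s1[OF w] s2[OF w]])
        show "frame_comb e v (?j w) f = 0" for v by (rule z[OF w])
      qed (use wb r1 in simp_all)
      also have "?j c = \<one>" using chart_inv[OF U] by (simp add: c_def)
      finally show ?thesis using wb(2) by (simp add: f_def \<tau>_one)
    qed
    have ap: "a \<otimes> p \<in> W0" "p \<in> W0" if "p \<in> W1" for p
      using B(3) W1(3) a that by blast+
    have \<tau>1: "F (\<phi> p) $ 1 = \<tau> p $ 1" for p by (simp add: \<tau>_def)
    note dx = d\<tau>[OF W0_ball, OF ap(1) ap(1)] d\<tau>[OF W0_ball, OF ap(2) ap(2)]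
    note FW = FX[OF W0_ball(2)] FY[OF W0_ball(2)] FZ[OF W0_ball(2)]
    have c1: "\<tau> (a \<otimes> p) $ 1 - 1 * \<tau> p $ 1 = \<tau> a $ 1" if "p \<in> W1" for p
      by (rule const[OF _ that]) (auto simp: dx FW ap)
    have c1': "\<tau> (a \<otimes> p) $ 1 = \<tau> a $ 1 + \<tau> p $ 1" if "p \<in> W1" for p
      using c1[OF that] by simp
    have c2: "\<tau> (a \<otimes> b) $ 2 - exp (\<tau> a $ 1) * \<tau> b $ 2 = \<tau> a $ 2"
      by (rule const[OF _ b]) (auto simp: dx FW ap \<tau>1 c1' exp_add)
    have c3: "\<tau> (a \<otimes> b) $ 3 - exp (- \<tau> a $ 1) * \<tau> b $ 3 = \<tau> a $ 3"
      by (rule const[OF _ b]) (auto simp: dx FW ap \<tau>1 c1' exp_add exp_diff exp_minus field_simps)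
    show ?thesis using c1'[OF b] c2 c3 by (simp add: vec3_eq_iff)
  qed
  have W1_mult: "a \<otimes> b \<in> W0" if "a \<in> W1" "b \<in> W1" for a b
    using B(3) W1(3) that by blast
  interpret L: E11_local_isomorphism G W0 W1 V \<tau> "?j \<circ> h"
    by unfold_locales (use conn simply homeo W0 V W1 \<tau>_one \<tau>_mult W1_mult in auto)
  obtain s N where s: "\<And>u v. s (u \<star> v) = s u \<otimes> s v" "bij s" and N: "open N" "0 \<in> N" "N \<subseteq> L.V1"
    and sN: "\<And>v. v \<in> N \<Longrightarrow> s v = (?j \<circ> h) v" and osN: "open (s ` N)" and cs: "continuous_on UNIV s"
    using L.global_isomorphism by blast
  define k where "k = inv_into UNIV s"
  have ks: "k (s v) = v" "s (k p) = p" for v p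
    using s(2) by (simp_all add: k_def bij_is_inj bij_is_surj inv_into_f_f surj_f_inv_f)
  have k_mult: "k (p \<otimes> q) = k p \<star> k q" for p q
    using s(1)[of "k p" "k q"] ks by metis
  have NV: "N \<subseteq> V" using N(3) L.V1(3) by blast
  have k_\<tau>: "k p = \<tau> p" "p \<in> W0" if p: "p \<in> s ` N" for p
  proof -
    obtain v where v: "v \<in> N" "p = s v" using p by blast
    then have "p = (?j \<circ> h) v" "v \<in> V" using sN NV by auto
    then show "k p = \<tau> p" using v(2) ks(1) L.\<sigma>_s0 by metis
    show "p \<in> W0" using \<open>p = (?j \<circ> h) v\<close> \<open>v \<in> V\<close> homeo unfolding homeomorphism_def by blast
  qed
  have s0: "s 0 = \<one>"
    using s(1)[of 0 0] l_cancel_one[of "s 0" "s 0"] by simp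
  have k_local: "k q = k p \<star> \<tau> (inv p \<otimes> q)" if "inv p \<otimes> q \<in> s ` N" for p q
  proof -
    have "k q = k (p \<otimes> (inv p \<otimes> q))" by (simp add: m_assoc[symmetric])
    then show ?thesis using k_mult k_\<tau>(1)[OF that] by simp
  qed
  \<comment> \<open>Near \<open>p\<close> the inverse \<open>k\<close> of \<open>s\<close> is a left translate of \<open>\<tau>\<close>.\<close>
  define T where "T = (\<lambda>p. (\<lambda>q. inv p \<otimes> q) -` (s ` N))"
  have T: "open (T p)" "p \<in> T p" for p
    unfolding T_def using open_left_translate[OF osN] s0 N(2) by (auto simp: image_iff) metis
  have sm_k: "smooth_near A p (\<lambda>q. k q $ i)" for p i
  proof -
    have "smooth_near A p (\<lambda>q. \<tau> (inv p \<otimes> q) $ i)" for i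
      by (rule translation_smooth_near[OF lg], rule sm\<tau>) (use W0(3) W0_ball in auto)
    then have "smooth_near A p (\<lambda>q. k p $ i + m * \<tau> (inv p \<otimes> q) $ i)" for m
      by (intro smooth_near_add smooth_near_mult smooth_near_const)
    from this[of "if i = 1 then 1 else if i = 2 then exp (k p $ 1) else exp (- k p $ 1)"]
    have "smooth_near A p (\<lambda>q. (k p \<star> \<tau> (inv p \<otimes> q)) $ i)"
      using exhaust_3[of i] by auto
    then show ?thesis
      by (rule smooth_near_cong[OF _ T]) (simp add: T_def k_local)
  qed
  have ck: "continuous_on UNIV k"
  proof -
    have c\<tau>: "continuous_on (s ` N) \<tau>"
      by (rule continuous_on_subset[OF homeomorphism_cont1[OF homeo]]) (use k_\<tau>(2) in blast)
    have "continuous_on (T p) k" for p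
    proof -
      have "continuous_on (T p) (\<lambda>q. \<tau> (inv p \<otimes> q))"
        by (rule continuous_on_compose2[OF c\<tau> continuous_on_mult2[OF continuous_on_const continuous_on_id]])
          (auto simp: T_def)
      then have "continuous_on (T p) (\<lambda>q. k p \<star> \<tau> (inv p \<otimes> q))"
        by (intro continuous_on_E11_mult continuous_on_const)
      then show ?thesis by (rule continuous_on_eq) (simp add: T_def k_local)
    qed
    then have "continuous_on (\<Union>p. T p) k" using T(1) by (intro continuous_on_open_UN) auto
    moreover have "(\<Union>p. T p) = UNIV" using T(2) by blast
    ultimately show ?thesis by simp
  qed
  have smooth_k: "smooth_map A E11_atlas k"
  proof -
    have "smooth_on (\<phi>' ` U') (k \<circ> inv_into U' \<phi>')" if U': "(U', \<phi>') \<in> A" for U' \<phi>'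
    proof (rule smooth_on_vec[OF chart_image_open[OF U']])
      show "smooth_on (\<phi>' ` U') (\<lambda>x. (k \<circ> inv_into U' \<phi>') x $ i)" for i
        using smooth_on_chart_expression[OF U' sm_k] by (simp add: comp_def)
    qed
    then show ?thesis using ck by (auto simp: smooth_map_def E11_atlas_def)
  qed
  have sm_s: "\<exists>O'. open O' \<and> v \<in> O' \<and> smooth_on O' (\<lambda>v. f (s v))" if f: "smooth_near A (s v) f" for v f
  proof -
    have "smooth_near A \<one> (\<lambda>q. f (s v \<otimes> q))"
      by (rule translation_smooth_near[OF lg]) (use f in simp)
    then obtain Q where Q: "open Q" "\<one> \<in> Q" "Q \<subseteq> U"
      "smooth_on (\<phi> ` Q) ((\<lambda>q. f (s v \<otimes> q)) \<circ> ?j)"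
      using smooth_near_chart U by blast
    define O1 where "O1 = N \<inter> h -` (\<phi> ` Q)"
    have hV: "h ` V \<subseteq> U'" using FU' by (auto simp: homeomorphism_def)
    have oQ: "open (\<phi> ` Q)" by (rule chart_open_map[OF U(1) Q(1,3)])
    have O1: "open O1"
      unfolding O1_def
      by (rule continuous_open_preimage[OF _ N(1) oQ]) (rule continuous_on_subset[OF smooth_on_continuous[OF smh] NV])
    have "h 0 = c" using homeomorphism_apply1[OF FU' U'(2)] F0 by simp
    then have O1_0: "0 \<in> O1" using N(2) Q(2) by (simp add: O1_def c_def)
    have sh: "smooth_on O1 h" by (rule smooth_on_subset[OF smh]) (use NV O1_def in blast)
    have "smooth_on O1 (\<lambda>u. ((\<lambda>q. f (s v \<otimes> q)) \<circ> ?j) (h u))"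
      by (rule smooth_on_compose[OF Q(4) sh O1 oQ]) (auto simp: O1_def)
    then have 1: "smooth_on O1 (\<lambda>u. f (s (v \<star> u)))"
      by (rule smooth_on_cong[OF _ O1]) (simp add: s(1) sN O1_def)
    define O2 where "O2 = (\<lambda>w. E11_inverse v \<star> w) -` O1"
    have O2: "open O2" unfolding O2_def
      by (intro open_vimage O1 continuous_on_E11_mult continuous_on_const continuous_on_id)
    have tr: "smooth_on O2 (\<lambda>w. E11_inverse v \<star> w)"
    proof (rule smooth_on_vec[OF O2])
      fix i
      have "smooth_on O2 (\<lambda>w. E11_inverse v $ i + m * w $ i)" for m
        by (intro smooth_on_add[OF O2] smooth_on_mult[OF O2] smooth_on_const[OF O2] smooth_on_nth[OF O2] smooth_on_id[OF O2])
      from this[of "if i = 1 then 1 else if i = 2 then exp (E11_inverse v $ 1) else exp (- E11_inverse v $ 1)"]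
      show "smooth_on O2 (\<lambda>w. (E11_inverse v \<star> w) $ i)" using exhaust_3[of i] by auto
    qed
    have "smooth_on O2 (\<lambda>w. f (s (v \<star> (E11_inverse v \<star> w))))"
      by (rule smooth_on_compose[OF 1 tr O2 O1]) (auto simp: O2_def)
    then have "smooth_on O2 (\<lambda>w. f (s w))" by (simp add: E11_assoc[symmetric] E11_inverse_right)
    moreover have "v \<in> O2" using O1_0 by (simp add: O2_def E11_inverse_left)
    ultimately show ?thesis using O2 by blast
  qed
  have smooth_s: "smooth_map E11_atlas A s"
  proof -
    have "smooth_on (s -` U') (\<phi>' \<circ> s)" if U': "(U', \<phi>') \<in> A" for U' \<phi>'
    proof (rule smooth_on_vec[OF open_vimage[OF chart_open[OF U'] cs]])
      fix i
      have "smooth_on (s -` U') (\<lambda>v. \<phi>' (s v) $ i)"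
      proof (rule smooth_on_local)
        fix v assume "v \<in> s -` U'"
        then show "\<exists>W. open W \<and> v \<in> W \<and> smooth_on W (\<lambda>v. \<phi>' (s v) $ i)"
          by (intro sm_s smooth_near_component[OF U']) simp
      qed
      then show "smooth_on (s -` U') (\<lambda>v. (\<phi>' \<circ> s) v $ i)" by (simp add: comp_def)
    qed
    then show ?thesis using cs by (auto simp: smooth_map_def E11_atlas_def id_def[symmetric])
  qed
  have bk: "bij k" unfolding k_def by (rule bij_imp_bij_inv[OF s(2)])
  have "k \<in> iso G E11"
    unfolding iso_def hom_def using bk by (auto simp: k_mult)
  moreover have "inv_into (carrier G) k = s"
    using bk ks by (auto simp: fun_eq_iff intro: inv_f_eq bij_is_inj)
  ultimately show ?thesis
    unfolding lie_group_isomorphic_def using smooth_k smooth_s by metis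
qed

end

section \<open>The classification of Cotton solitons\<close>

lemma (in lorentz_frame) lie_algebra_frame_comb:
  assumes "lie_algebra_basis A G e"
  shows "frame_comb e c \<in> lie_algebra A G"
proof -
  have inv: "left_invariant G (e i)" for i
    using assms by (simp add: lie_algebra_basis_def lie_algebra_def)
  have "left_invariant G (frame_comb e c)"
    using frame_comb_translate[OF inv, of c] by (auto simp: left_invariant_def tangent_map_def comp_def)
  then show ?thesis by (simp add: lie_algebra_def vector_field_frame_comb)
qed

context type_II_frame
begin

text \<open>
  Left-invariant fields are determined by their coordinates, so it suffices to give a linear bijection from
  coordinate vectors to matrices that respects brackets.
\<close>
lemma lie_algebra_isomorphic_matricesI:
  fixes M :: "real^3 \<Rightarrow> real^'n^'n"
  assumes basis: "lie_algebra_basis A G e" and bij: "bij_betw M UNIV S"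
    and add: "\<And>a b. M (a + b) = M a + M b" and scale: "\<And>r a. M (r *\<^sub>R a) = r *\<^sub>R M a"
    and bracket: "\<And>a b. M (bracket_coords a b) = M a ** M b - M b ** M a"
  shows "lie_algebra_isomorphic_matrices A G S"
proof -
  \<comment> \<open>Left-invariant fields have constant coordinates, so the point at which they are read off is arbitrary.\<close>
  define \<Phi> where "\<Phi> = (\<lambda>X. M (frame_coord e X undefined))"
  have \<Phi>: "\<Phi> (frame_comb e c) = M c" for c by (simp add: \<Phi>_def)
  have ex: "\<exists>c. X = frame_comb e c" if "X \<in> lie_algebra A G" for X
    using basis that unfolding lie_algebra_basis_def by blast
  have "bij_betw (\<lambda>X. frame_coord e X undefined) (lie_algebra A G) UNIV"
  proof (rule bij_betwI[where g = "frame_comb e"])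
    show "frame_comb e (frame_coord e X undefined) = X" if "X \<in> lie_algebra A G" for X
      using ex[OF that] by auto
  qed (auto simp: lie_algebra_frame_comb[OF basis])
  then have "bij_betw \<Phi> (lie_algebra A G) S"
    using bij_betw_trans[OF _ bij] by (simp add: \<Phi>_def comp_def)
  moreover have "\<Phi> (vf_add X Y) = \<Phi> X + \<Phi> Y" "\<Phi> (vf_scale (\<lambda>_. r) X) = r *\<^sub>R \<Phi> X"
    "\<Phi> (lie_bracket A X Y) = \<Phi> X ** \<Phi> Y - \<Phi> Y ** \<Phi> X"
    if XY: "X \<in> lie_algebra A G" "Y \<in> lie_algebra A G" for X Y r
  proof -
    obtain a b where ab: "X = frame_comb e a" "Y = frame_comb e b" using ex XY by blast
    have "vf_add X Y = frame_comb e (a + b)" "vf_scale (\<lambda>_. r) X = frame_comb e (r *\<^sub>R a)"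
      by (simp_all add: ab vf_add_def vf_scale_def frame_comb_def sum_3 algebra_simps)
    then show "\<Phi> (vf_add X Y) = \<Phi> X + \<Phi> Y" "\<Phi> (vf_scale (\<lambda>_. r) X) = r *\<^sub>R \<Phi> X"
      "\<Phi> (lie_bracket A X Y) = \<Phi> X ** \<Phi> Y - \<Phi> Y ** \<Phi> X"
      by (simp_all add: \<Phi> ab lie_bracket_comb add scale bracket)
  qed
  ultimately show ?thesis unfolding lie_algebra_isomorphic_matrices_def by blast
qed

text \<open>
  For \<open>\<alpha> = \<beta>\<close> the vectors \<open>H = - 2e\<^sub>1/\<beta>\<close>, \<open>E = e\<^sub>2 + e\<^sub>3\<close> and \<open>F = (e\<^sub>2 - e\<^sub>3 + E/(2\<beta>))/\<beta>\<^sup>2\<close> satisfy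
  \<open>[H, E] = 2E\<close>, \<open>[H, F] = - 2F\<close> and \<open>[E, F] = H\<close>. The next three functions are the coordinates with
  respect to \<open>H, E, F\<close>, and \<open>from_sl2\<close> is their inverse.
\<close>
definition sl2_h :: "real^3 \<Rightarrow> real" where "sl2_h a = - \<beta> * a$1 / 2"
definition sl2_x :: "real^3 \<Rightarrow> real" where "sl2_x a = (a$2 + a$3) / 2 - (a$2 - a$3) / (4 * \<beta>)"
definition sl2_y :: "real^3 \<Rightarrow> real" where "sl2_y a = \<beta>\<^sup>2 * (a$2 - a$3) / 2"

definition from_sl2 :: "real \<Rightarrow> real \<Rightarrow> real \<Rightarrow> real^3" where
  "from_sl2 h x y = vec3 (- 2 * h / \<beta>) (x + y / (2 * \<beta> ^ 3) + y / \<beta>\<^sup>2) (x + y / (2 * \<beta> ^ 3) - y / \<beta>\<^sup>2)"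

lemma sl2_coordinates:
  assumes "\<alpha> = \<beta>" "\<beta> \<noteq> 0"
  shows "sl2_h (bracket_coords a b) = sl2_x a * sl2_y b - sl2_y a * sl2_x b"
    and "sl2_x (bracket_coords a b) = 2 * (sl2_h a * sl2_x b - sl2_x a * sl2_h b)"
    and "sl2_y (bracket_coords a b) = 2 * (sl2_y a * sl2_h b - sl2_h a * sl2_y b)"
    and "sl2_h (from_sl2 h x y) = h" "sl2_x (from_sl2 h x y) = x" "sl2_y (from_sl2 h x y) = y"
    and "from_sl2 (sl2_h a) (sl2_x a) (sl2_y a) = a"
  unfolding bracket_coords_def
  using assms
  by (simp_all add: vec3_eq_iff sl2_h_def sl2_x_def sl2_y_def from_sl2_def field_simps power2_eq_square power3_eq_cube)

lemma sl2_additive: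
  "sl2_h (a + b) = sl2_h a + sl2_h b" "sl2_x (a + b) = sl2_x a + sl2_x b" "sl2_y (a + b) = sl2_y a + sl2_y b"
  "sl2_h (r *\<^sub>R a) = r * sl2_h a" "sl2_x (r *\<^sub>R a) = r * sl2_x a" "sl2_y (r *\<^sub>R a) = r * sl2_y a"
  by (simp_all add: sl2_h_def sl2_x_def sl2_y_def algebra_simps add_divide_distrib diff_divide_distrib)

lemma isomorphic_sl2:
  assumes basis: "lie_algebra_basis A G e" and ab: "\<alpha> = \<beta>" "\<beta> \<noteq> 0"
  shows "lie_algebra_isomorphic_matrices A G sl2"
proof -
  note c = sl2_coordinates[OF ab]
  define M where "M = (\<lambda>a. vector [vector [sl2_h a, sl2_x a], vector [sl2_y a, - sl2_h a]] :: real^2^2)"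
  have nth: "M a $ 1 $ 1 = sl2_h a" "M a $ 1 $ 2 = sl2_x a" "M a $ 2 $ 1 = sl2_y a" "M a $ 2 $ 2 = - sl2_h a" for a
    by (simp_all add: M_def)
  show ?thesis
  proof (rule lie_algebra_isomorphic_matricesI[OF basis, of M])
    show "bij_betw M UNIV sl2"
    proof (rule bij_betwI[where g = "\<lambda>m. from_sl2 (m$1$1) (m$1$2) (m$2$1)"])
      show "M \<in> UNIV \<rightarrow> sl2" by (auto simp: sl2_def trace_def sum_2 nth)
      show "M (from_sl2 (m$1$1) (m$1$2) (m$2$1)) = m" if "m \<in> sl2" for m
        using that by (simp add: sl2_def trace_def sum_2 vec_eq_iff forall_2 nth c)
    qed (auto simp: nth c)
    show "M (a + b) = M a + M b" "M (r *\<^sub>R a) = r *\<^sub>R M a" for a b r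
      by (simp_all add: vec_eq_iff forall_2 nth sl2_additive)
    show "M (bracket_coords a b) = M a ** M b - M b ** M a" for a b
      by (simp add: vec_eq_iff forall_2 matrix_matrix_mult_def sum_2 nth c algebra_simps)
  qed
qed

lemma so12_iff: "m \<in> so12 \<longleftrightarrow> m$1$1 = 0 \<and> m$2$2 = 0 \<and> m$3$3 = 0 \<and> m$2$1 = m$1$2 \<and> m$3$1 = m$1$3 \<and> m$3$2 = - m$2$3"
  by (auto simp: so12_def Let_def vec_eq_iff forall_3 matrix_matrix_mult_def transpose_def sum_3)

text \<open>
  With \<open>P, Q, R\<close> the elements of \<open>so(1,2)\<close> whose entries above the diagonal are the unit vectors in the
  positions \<open>12\<close>, \<open>13\<close>, \<open>23\<close>, one has \<open>[P, Q] = R\<close>, \<open>[P, R] = Q\<close> and \<open>[R, Q] = P\<close>. So \<open>H = 2P\<close>,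
  \<open>E = Q + R\<close> and \<open>F = Q - R\<close> satisfy the relations of \<open>sl(2)\<close>.
\<close>
lemma isomorphic_so12:
  assumes basis: "lie_algebra_basis A G e" and ab: "\<alpha> = \<beta>" "\<beta> \<noteq> 0"
  shows "lie_algebra_isomorphic_matrices A G so12"
proof -
  note c = sl2_coordinates[OF ab]
  define M where "M = (\<lambda>a. vector [vector [0, 2 * sl2_h a, sl2_x a + sl2_y a], vector [2 * sl2_h a, 0, sl2_x a - sl2_y a],
      vector [sl2_x a + sl2_y a, sl2_y a - sl2_x a, 0]] :: real^3^3)"
  have nth: "M a $ 1 $ 1 = 0" "M a $ 1 $ 2 = 2 * sl2_h a" "M a $ 1 $ 3 = sl2_x a + sl2_y a"
    "M a $ 2 $ 1 = 2 * sl2_h a" "M a $ 2 $ 2 = 0" "M a $ 2 $ 3 = sl2_x a - sl2_y a"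
    "M a $ 3 $ 1 = sl2_x a + sl2_y a" "M a $ 3 $ 2 = sl2_y a - sl2_x a" "M a $ 3 $ 3 = 0" for a
    by (simp_all add: M_def)
  show ?thesis
  proof (rule lie_algebra_isomorphic_matricesI[OF basis, of M])
    show "bij_betw M UNIV so12"
    proof (rule bij_betwI[where g = "\<lambda>m. from_sl2 (m$1$2 / 2) ((m$1$3 + m$2$3) / 2) ((m$1$3 - m$2$3) / 2)"])
      show "M \<in> UNIV \<rightarrow> so12" by (auto simp: so12_iff nth)
      show "M (from_sl2 (m$1$2 / 2) ((m$1$3 + m$2$3) / 2) ((m$1$3 - m$2$3) / 2)) = m" if "m \<in> so12" for m
        using that by (simp add: so12_iff vec_eq_iff forall_3 nth c field_simps)
    qed (auto simp: nth c field_simps)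
    show "M (a + b) = M a + M b" "M (r *\<^sub>R a) = r *\<^sub>R M a" for a b r
      by (simp_all add: vec_eq_iff forall_3 nth sl2_additive algebra_simps)
    show "M (bracket_coords a b) = M a ** M b - M b ** M a" for a b
      by (simp add: vec_eq_iff forall_3 matrix_matrix_mult_def sum_3 nth c algebra_simps)
  qed
qed

lemma isomorphic_E11:
  assumes lg: "lie_group A G" and basis: "lie_algebra_basis A G e"
    and conn: "connected (UNIV :: 'm set)" and simply: "simply_connected (UNIV :: 'm set)"
    and ab: "\<alpha> = 0" "\<beta> \<noteq> 0"
  shows "lie_group_isomorphic A G E11_atlas E11"
proof -
  have inv: "left_invariant G (e i)" for i
    using basis by (simp add: lie_algebra_basis_def lie_algebra_def)
  define x where "x = vec3 (1 / \<beta>) 0 0"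
  define y where "y = vec3 0 (1 / (2 * \<beta>) + 1) (1 / (2 * \<beta>) - 1)"
  define z where "z = vec3 0 1 1"
  have br: "bracket_coords x y = y" "bracket_coords x z = - z" "bracket_coords y z = 0"
    unfolding bracket_coords_def using ab by (simp_all add: vec3_eq_iff x_def y_def z_def field_simps)
  show ?thesis
  proof (rule E11_isomorphism[OF lg inv conn simply, of x y z])
    fix v :: "real^3"
    have "v = (\<beta> * v$1) *\<^sub>R x + ((v$2 - v$3) / 2) *\<^sub>R y
        + ((v$2 + v$3) / 2 - (v$2 - v$3) / 2 / (2 * \<beta>)) *\<^sub>R z"
      using ab(2) by (simp add: vec3_eq_iff x_def y_def z_def field_simps)
    then show "\<exists>a b c. v = a *\<^sub>R x + b *\<^sub>R y + c *\<^sub>R z" by blast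
  qed (simp_all add: lie_bracket_comb br)
qed

end

theorem theorem5:
  fixes G :: "'g::{t2_space, second_countable_topology} monoid"
    and A :: "('g, real^3) atlas"
    and g :: "'g metric"
    and D :: "'g connection"
    and e :: "3 \<Rightarrow> 'g vfield"
    and \<alpha> \<beta> :: real
  assumes "lie_group A G"
    and "connected (UNIV :: 'g set)"
    and "simply_connected (UNIV :: 'g set)"
    and "lorentzian_metric A g"
    and "left_invariant_metric A G g"
    and "levi_civita_connection A g D"
    and "lie_algebra_basis A G e"
    and "\<And>i j p. metric_on g (e i) (e j) p = minkowski i j"
    and "lie_bracket A (e 1) (e 2) = frame_comb e (vector [0, 1/2, - (\<beta> - 1/2)])"
    and "lie_bracket A (e 1) (e 3) = frame_comb e (vector [0, - (\<beta> + 1/2), - (1/2)])"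
    and "lie_bracket A (e 2) (e 3) = frame_comb e (vector [\<alpha>, 0, 0])"
  shows "((\<not> cotton_flat A g D e \<and> (\<exists>X\<in>lie_algebra A G. \<exists>c. cotton_soliton A g D e X c)) \<longleftrightarrow>
            (\<alpha> = \<beta> \<and> \<beta> \<noteq> 0) \<or> (\<alpha> = 0 \<and> \<beta> \<noteq> 0)) \<and>
         (\<alpha> = \<beta> \<and> \<beta> \<noteq> 0 \<longrightarrow>
            lie_algebra_isomorphic_matrices A G so12 \<and>
            lie_algebra_isomorphic_matrices A G sl2 \<and>
            (\<forall>X\<in>lie_algebra A G. \<forall>c. cotton_soliton A g D e X c \<longleftrightarrow>
               c = 0 \<and> (\<exists>\<kappa>. X = frame_comb e (vector [3/4 * \<beta>\<^sup>2, \<kappa>, \<kappa>])))) \<and>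
         (\<alpha> = 0 \<and> \<beta> \<noteq> 0 \<longrightarrow>
            lie_group_isomorphic A G E11_atlas E11 \<and>
            (\<forall>X\<in>lie_algebra A G. \<forall>c. cotton_soliton A g D e X c \<longleftrightarrow>
               c = 0 \<and> X = frame_comb e (vector [2 * \<beta>\<^sup>2, 0, 0])))"
proof -
  interpret type_II_connection A g e \<alpha> \<beta> D
  proof
    show "smooth_atlas A" using assms(1) by (simp add: lie_group_def)
    show "vector_field A (e i)" for i
      using assms(7) by (simp add: lie_algebra_basis_def lie_algebra_def)
  qed (fact assms)+
  have basis: "\<exists>x. X = frame_comb e x" if "X \<in> lie_algebra A G" for X
    using assms(7) that unfolding lie_algebra_basis_def by blast
  have inject: "frame_comb e x = frame_comb e y \<longleftrightarrow> x = y" for x y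
    using frame_comb_inject by metis
  have ex: "(\<exists>X\<in>lie_algebra A G. \<exists>c. cotton_soliton A g D e X c) \<longleftrightarrow> \<alpha>\<^sup>2 * (\<alpha> - \<beta>) = 0"
  proof
    assume "\<exists>X\<in>lie_algebra A G. \<exists>c. cotton_soliton A g D e X c"
    then show "\<alpha>\<^sup>2 * (\<alpha> - \<beta>) = 0" using basis cotton_soliton_iff by blast
  next
    assume "\<alpha>\<^sup>2 * (\<alpha> - \<beta>) = 0"
    then have "cotton_soliton A g D e (frame_comb e (vec3 cotton_p 0 0)) 0"
      by (simp add: cotton_soliton_iff)
    then show "\<exists>X\<in>lie_algebra A G. \<exists>c. cotton_soliton A g D e X c"
      using lie_algebra_frame_comb[OF assms(7)] by blast
  qed
  have main: "(\<not> cotton_flat A g D e \<and> (\<exists>X\<in>lie_algebra A G. \<exists>c. cotton_soliton A g D e X c)) \<longleftrightarrow>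
      (\<alpha> = \<beta> \<and> \<beta> \<noteq> 0) \<or> (\<alpha> = 0 \<and> \<beta> \<noteq> 0)"
    unfolding ex cotton_flat_iff by (auto simp: cotton_p_def power2_eq_square)
  have case_i: "\<forall>X\<in>lie_algebra A G. \<forall>c. cotton_soliton A g D e X c \<longleftrightarrow>
      c = 0 \<and> (\<exists>\<kappa>. X = frame_comb e (vector [3/4 * \<beta>\<^sup>2, \<kappa>, \<kappa>]))" if "\<alpha> = \<beta>"
  proof (intro ballI allI)
    fix X c assume "X \<in> lie_algebra A G"
    then obtain x where x: "X = frame_comb e x" using basis by blast
    show "cotton_soliton A g D e X c \<longleftrightarrow> c = 0 \<and> (\<exists>\<kappa>. X = frame_comb e (vector [3/4 * \<beta>\<^sup>2, \<kappa>, \<kappa>]))"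
      unfolding x cotton_soliton_iff inject cotton_p_def
      by (auto simp: that vec3_eq_iff power2_eq_square)
  qed
  have case_ii: "\<forall>X\<in>lie_algebra A G. \<forall>c. cotton_soliton A g D e X c \<longleftrightarrow>
      c = 0 \<and> X = frame_comb e (vector [2 * \<beta>\<^sup>2, 0, 0])" if "\<alpha> = 0" "\<beta> \<noteq> 0"
  proof (intro ballI allI)
    fix X c assume "X \<in> lie_algebra A G"
    then obtain x where x: "X = frame_comb e x" using basis by blast
    show "cotton_soliton A g D e X c \<longleftrightarrow> c = 0 \<and> X = frame_comb e (vector [2 * \<beta>\<^sup>2, 0, 0])"
      unfolding x cotton_soliton_iff inject cotton_p_def
      using that by (auto simp: vec3_eq_iff)
  qed
  show ?thesis
    using main case_i case_ii isomorphic_so12[OF assms(7)] isomorphic_sl2[OF assms(7)]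
      isomorphic_E11[OF assms(1,7,2,3)]
    by blast
qed

end
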